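(* In the v-set interpretation the unrestricted principle of Choice is false: it is not the case that every set of inhabited sets admits a choice function.
   Context: Work in Heyting arithmetic extended by unary predicates $\mathcal V$ ("v-set"), $\mathcal M$ ("Meaningful condition"), $\mathcal T$ ("True condition"). $\langle\cdot,\cdot\rangle$ is Cantor pairing with projections $(\cdot)_L,(\cdot)_R$; $en$ is Kleene application, $en\!\downarrow$ means it is defined. Write $\mathrm{cd}_x(n)=(xn)_R$, $\mathrm{el}_x(n)=(xn)_L$. $\Xi(f,g)$ is a fixed primitive recursive injective coding of pairs. Axioms: (V1) $\forall x\,[\forall n\,(xn\!\downarrow\wedge\mathcal M(\mathrm{cd}_x(n))\wedge(\mathcal T(\mathrm{cd}_x(n))\to\mathcal V(\mathrm{el}_x(n))))]\to\mathcal V(x)$; (V2) for every formula $\phi$: if the antecedent of (V1) with $\mathcal V$ replaced by $\phi$ implies $\phi(x)$ for all $x$, then $\forall x(\mathcal V(x)\to\phi(x))$; (X1) $\mathcal M(\Xi(f,g))\to(\mathcal T(\Xi(f,g))\leftrightarrow\forall n(fn\!\downarrow\wedge\mathcal T(fn)\to gn\!\downarrow\wedge\mathcal T(gn)))$; (X2) if $\forall n(fn\!\downarrow\to\mathcal M(fn))$ and $\forall n(fn\!\downarrow\wedge gn\!\downarrow\wedge\mathcal T(fn)\to\mathcal M(gn))$ then $\mathcal M(\Xi(f,g))$; ($\mathsf{ECT}_V$) $(\forall n(\phi(n)\to\exists m\,\psi(n,m)))\to\exists e\,\forall n(\phi(n)\to en\!\downarrow\wedge\psi(n,en))$ for arbitrary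 $\psi$ and almost-negative $\phi$ (built from $\Sigma_1$ formulas and atoms $\mathcal V(t),\mathcal M(t),\mathcal T(t)$ by $\wedge,\to,\forall_{\mathbb N}$). Sets are interpreted as v-sets (numbers $x$ with $\mathcal V(x)$); $EL(x)=\{\mathrm{el}_x(n):\mathcal T(\mathrm{cd}_x(n))\}$. Set equality is extensional equality $\simeq$ of v-sets, characterized by $x\simeq y\iff(\forall a\in EL(x)\exists b\in EL(y)\,a\simeq b)\wedge(\forall b\in EL(y)\exists a\in EL(x)\,b\simeq a)$. Unbounded set quantifiers range over v-sets, bounded quantifiers range over $EL(x)$, and $x\in y$ means $\exists y'\in EL(y)\,x\simeq y'$. A set-theoretic statement is false in the v-set interpretation if the interpretation of its negation is provable in this system. *)

theory Defs
  imports Main "HOL-Library.Nat_Bijection"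
begin

section \<open>Primitive recursive function symbols\<close>

datatype prsym = PZero | PSucc | PProj nat | PComp prsym "prsym list" | PRec prsym prsym

text \<open>Symbols are variadic: a symbol applied to \<open>n\<close> arguments is its \<open>n\<close>-ary version.
  The values for arguments that are missing are irrelevant; the theory below leaves the
  corresponding terms unspecified.\<close>

fun eval :: "prsym \<Rightarrow> nat list \<Rightarrow> nat" where
  "eval PZero xs = 0"
| "eval PSucc xs = (case xs of [] \<Rightarrow> 0 | x # _ \<Rightarrow> Suc x)"
| "eval (PProj i) xs = (if i < length xs then xs ! i else 0)"
| "eval (PComp f gs) xs = eval f (map (\<lambda>g. eval g xs) gs)"
| "eval (PRec f g) xs =
    (case xs of [] \<Rightarrow> 0 | x # ys \<Rightarrow> rec_nat (eval f ys) (\<lambda>t r. eval g (t # r # ys)) x)"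

definition "p_pred = PRec PZero (PProj 0)"
definition "p_add = PRec (PProj 0) (PComp PSucc [PProj 1])"
definition "p_monus = PComp (PRec (PProj 0) (PComp p_pred [PProj 1])) [PProj 1, PProj 0]"
definition "p_dist = PComp p_add [p_monus, PComp p_monus [PProj 1, PProj 0]]"
definition "p_if0 = PRec (PProj 0) (PProj 3)"
definition "p_triangle = PRec PZero (PComp p_add [PComp PSucc [PProj 0], PProj 1])"

text \<open>Cantor pairing \<open>(x, y) \<mapsto> (x + y)(x + y + 1)/2 + x\<close>; \<open>p_diag\<close> computes \<open>x + y\<close>
  from the code.\<close>

definition "p_pair = PComp p_add [PComp p_triangle [p_add], PProj 0]"
definition "p_diag = PRec PZero
  (PComp p_if0 [PComp p_dist [PComp PSucc [PProj 0], PComp p_triangle [PComp PSucc [PProj 1]]],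
                PComp PSucc [PProj 1], PProj 1])"
definition "p_left = PComp p_monus [PProj 0, PComp p_triangle [p_diag]]"
definition "p_right = PComp p_monus [p_diag, p_left]"

lemma eval_arith [simp]:
  "eval p_pred [x] = x - 1"
  "eval p_add [x, y] = x + y"
  "eval p_monus [x, y] = x - y"
  "eval p_dist [x, y] = (x - y) + (y - x)"
  "eval p_if0 [x, y, z] = (if x = 0 then y else z)"
  "eval p_triangle [x] = triangle x"
proof -
  show pred: "eval p_pred [x] = x - 1" for x
    by (cases x) (auto simp: p_pred_def)
  show add: "eval p_add [x, y] = x + y" for x y
    by (induction x) (auto simp: p_add_def)
  have "rec_nat y (\<lambda>t r. r - Suc 0) x = y - x" for x y :: nat
    by (induction x) auto
  then show monus: "eval p_monus [x, y] = x - y" for x y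
    by (simp add: p_monus_def pred)
  show "eval p_dist [x, y] = (x - y) + (y - x)"
    by (simp add: p_dist_def add monus)
  show "eval p_if0 [x, y, z] = (if x = 0 then y else z)"
    by (cases x) (auto simp: p_if0_def)
  show "eval p_triangle [x] = triangle x"
    by (induction x) (auto simp: p_triangle_def add)
qed

lemma eval_pair [simp]: "eval p_pair [x, y] = prod_encode (x, y)"
  by (simp add: p_pair_def prod_encode_def)

lemma eval_diag: "eval p_diag [triangle n + k] = n" if "k \<le> n"
proof -
  have diag_Suc: "eval p_diag [Suc z] = (let s = eval p_diag [z] in
      if Suc z = triangle (Suc s) then Suc s else s)" for z
    by (auto simp: p_diag_def Let_def)
  have step: "eval p_diag [triangle n] = n \<Longrightarrow> k \<le> n \<Longrightarrow> eval p_diag [triangle n + k] = n" for n k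
    by (induction k) (auto simp: diag_Suc Let_def)
  have "eval p_diag [triangle n] = n" for n
  proof (induction n)
    case (Suc n)
    then have "eval p_diag [triangle n + n] = n" by (intro step) auto
    then show ?case using diag_Suc[of "triangle n + n"] by (simp add: Let_def)
  qed (simp add: p_diag_def)
  then show ?thesis using that by (rule step)
qed

lemma eval_proj [simp]:
  "eval p_left [prod_encode (x, y)] = x"
  "eval p_right [prod_encode (x, y)] = y"
proof -
  have "eval p_diag [prod_encode (x, y)] = x + y"
    by (simp add: prod_encode_def eval_diag)
  then show "eval p_left [prod_encode (x, y)] = x" "eval p_right [prod_encode (x, y)] = y"
    by (simp_all add: p_left_def p_right_def) (simp_all add: prod_encode_def)
qed


section \<open>Kleene application\<close>

text \<open>Indices of partial recursive functions, for a pair \<open>\<langle>t, a\<rangle>\<close> by the tag \<open>t\<close>: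
  \<^item> 0, 1, 2, 3: zero, successor, left projection, right projection;
  \<^item> 4, \<open>a = \<langle>f, g\<rangle>\<close>: composition \<open>n \<mapsto> f (g n)\<close>;
  \<^item> 5, \<open>a = \<langle>f, g\<rangle>\<close>: pairing \<open>n \<mapsto> \<langle>f n, g n\<rangle>\<close>;
  \<^item> 6, \<open>a = \<langle>f, g\<rangle>\<close>: primitive recursion \<open>h \<langle>x, 0\<rangle> = f x\<close>,
    \<open>h \<langle>x, z + 1\<rangle> = g \<langle>\<langle>x, z\<rangle>, h \<langle>x, z\<rangle>\<rangle>\<close>;
  \<^item> 7, \<open>a = f\<close>: minimization \<open>x \<mapsto> \<mu>k. f \<langle>x, k\<rangle> = 0\<close>.

  A configuration \<open>\<langle>s, v\<rangle>\<close> of the evaluator consists of a stack \<open>s\<close> of indices still to be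
  applied (\<open>0\<close> if empty, otherwise \<open>\<langle>top, rest\<rangle> + 1\<close>) and the current value \<open>v\<close>; it is
  final if the stack is empty. The tags 8 to 11 serve as intermediate stack entries.
  On any other tag the evaluator loops, so such indices denote the nowhere defined
  function.\<close>

primrec p_num :: "nat \<Rightarrow> prsym" where
  "p_num 0 = PZero"
| "p_num (Suc n) = PComp PSucc [p_num n]"

fun p_switch :: "prsym \<Rightarrow> prsym list \<Rightarrow> prsym \<Rightarrow> prsym" where
  "p_switch t [] d = d"
| "p_switch t (b # bs) d = PComp p_if0 [t, b, p_switch (PComp p_pred [t]) bs d]"

abbreviation "pL f \<equiv> PComp p_left [f]"
abbreviation "pR f \<equiv> PComp p_right [f]"
abbreviation "pP f g \<equiv> PComp p_pair [f, g]"
abbreviation "p_push f s \<equiv> PComp PSucc [pP f s]"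
abbreviation "p_tagged t f \<equiv> pP (p_num t) f"

definition p_step :: prsym where
  "p_step =
    (let c = PProj 0; s = pL c; v = pR c;
         top = pL (PComp p_pred [s]); rest = pR (PComp p_pred [s]);
         tag = pL top; a = pR top; f = pL a; g = pR a;
         next_p = pP (pL g) (PComp PSucc [pR g])
     in PComp p_if0 [s, c, p_switch tag
      [pP rest PZero,
       pP rest (PComp PSucc [v]),
       pP rest (pL v),
       pP rest (pR v),
       pP (p_push g (p_push f rest)) v,
       pP (p_push f (p_push (p_tagged 8 (pP g v)) rest)) v,
       PComp p_if0 [pR v,
         pP (p_push f rest) (pL v),
         (let w = pP (pL v) (PComp p_pred [pR v])
          in pP (p_push top (p_push (p_tagged 10 (pP g w)) rest)) w)],
       (let w = pP v PZero in pP (p_push a (p_push (p_tagged 11 (pP a w)) rest)) w),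
       pP (p_push f (p_push (p_tagged 9 v) rest)) g,
       pP rest (pP a v),
       pP (p_push f rest) (pP g v),
       PComp p_if0 [v,
         pP rest (pR g),
         pP (p_push f (p_push (p_tagged 11 (pP f next_p)) rest)) next_p]]
      c])"

text \<open>\<open>p_run\<close> applied to \<open>w, e, n\<close> is the configuration after \<open>w\<close> steps, starting with
  index \<open>e\<close> and argument \<open>n\<close>.\<close>

definition p_run :: prsym where
  "p_run = PRec (pP (p_push (PProj 0) PZero) (PProj 1)) (PComp p_step [PProj 1])"


text \<open>Adequacy of the evaluator: the indices enumerate the unary \<open>\<mu>\<close>-recursive functions,
  with the intended graphs and domains.\<close>

lemma eval_num [simp]: "eval (p_num n) xs = n"
  by (induction n) auto

datatype mu = MZero | MSucc | MLeft | MRight | MComp mu mu | MPair mu mu | MRec mu mu | MMin mu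

primrec index :: "mu \<Rightarrow> nat" where
  "index MZero = prod_encode (0, 0)"
| "index MSucc = prod_encode (1, 0)"
| "index MLeft = prod_encode (2, 0)"
| "index MRight = prod_encode (3, 0)"
| "index (MComp f g) = prod_encode (4, prod_encode (index f, index g))"
| "index (MPair f g) = prod_encode (5, prod_encode (index f, index g))"
| "index (MRec f g) = prod_encode (6, prod_encode (index f, index g))"
| "index (MMin f) = prod_encode (7, index f)"

inductive computes :: "mu \<Rightarrow> nat \<Rightarrow> nat \<Rightarrow> bool" where
  "computes MZero n 0"
| "computes MSucc n (Suc n)"
| "computes MLeft (prod_encode (x, y)) x"
| "computes MRight (prod_encode (x, y)) y"
| "computes g n k \<Longrightarrow> computes f k m \<Longrightarrow> computes (MComp f g) n m"
| "computes f n k \<Longrightarrow> computes g n m \<Longrightarrow> computes (MPair f g) n (prod_encode (k, m))"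
| "computes f x m \<Longrightarrow> computes (MRec f g) (prod_encode (x, 0)) m"
| "computes (MRec f g) (prod_encode (x, z)) r \<Longrightarrow> computes g (prod_encode (prod_encode (x, z), r)) m
    \<Longrightarrow> computes (MRec f g) (prod_encode (x, Suc z)) m"
| "(\<And>j. j < k \<Longrightarrow> computes f (prod_encode (x, j)) (Suc (r j))) \<Longrightarrow> computes f (prod_encode (x, k)) 0
    \<Longrightarrow> computes (MMin f) x k"

abbreviation (input) "step c \<equiv> eval p_step [c]"
abbreviation (input) "cfg s v \<equiv> prod_encode (s, v)"
abbreviation (input) "push e s \<equiv> Suc (prod_encode (e, s))"

lemma eval_comp [simp]: "eval (PComp f [g]) xs = eval f [eval g xs]"
  "eval (PComp f [g,h]) xs = eval f [eval g xs, eval h xs]"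
  "eval (PComp f [g,h,k]) xs = eval f [eval g xs, eval h xs, eval k xs]"
  by simp_all

lemma step_simps:
  "step (cfg 0 v) = cfg 0 v"
  "step (cfg (push (prod_encode (0, a)) s) v) = cfg s 0"
  "step (cfg (push (prod_encode (Suc 0, a)) s) v) = cfg s (Suc v)"
  "step (cfg (push (prod_encode (2, a)) s) (prod_encode (x, y))) = cfg s x"
  "step (cfg (push (prod_encode (3, a)) s) (prod_encode (x, y))) = cfg s y"
  "step (cfg (push (prod_encode (4, prod_encode (f, g))) s) v) = cfg (push g (push f s)) v"
  "step (cfg (push (prod_encode (5, prod_encode (f, g))) s) v)
    = cfg (push f (push (prod_encode (8, prod_encode (g, v))) s)) v"
  "step (cfg (push (prod_encode (6, prod_encode (f, g))) s) (prod_encode (x, 0))) = cfg (push f s) x"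
  "step (cfg (push (prod_encode (6, prod_encode (f, g))) s) (prod_encode (x, Suc z)))
    = cfg (push (prod_encode (6, prod_encode (f, g)))
        (push (prod_encode (10, prod_encode (g, prod_encode (x, z)))) s)) (prod_encode (x, z))"
  "step (cfg (push (prod_encode (7, a)) s) v)
    = cfg (push a (push (prod_encode (11, prod_encode (a, prod_encode (v, 0)))) s)) (prod_encode (v, 0))"
  "step (cfg (push (prod_encode (8, prod_encode (g, x))) s) v)
    = cfg (push g (push (prod_encode (9, v)) s)) x"
  "step (cfg (push (prod_encode (9, u)) s) v) = cfg s (prod_encode (u, v))"
  "step (cfg (push (prod_encode (10, prod_encode (g, w))) s) v) = cfg (push g s) (prod_encode (w, v))"
  "step (cfg (push (prod_encode (11, prod_encode (f, prod_encode (x, k)))) s) 0) = cfg s k"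
  "step (cfg (push (prod_encode (11, prod_encode (f, prod_encode (x, k)))) s) (Suc r))
    = cfg (push f (push (prod_encode (11, prod_encode (f, prod_encode (x, Suc k)))) s))
        (prod_encode (x, Suc k))"
  "t > 11 \<Longrightarrow> step (cfg (push (prod_encode (t, a)) s) v) = cfg (push (prod_encode (t, a)) s) v"
  by (simp_all add: p_step_def Let_def)

definition run where "run w c = ((\<lambda>c. eval p_step [c]) ^^ w) c"

lemma eval_run: "eval p_run [w, e, n] = run w (cfg (push e 0) n)"
  by (induction w) (simp_all add: p_run_def run_def)

lemma run_0: "run 0 c = c" and run_Suc: "run (Suc w) c = run w (step c)"
  by (simp_all add: run_def funpow_Suc_right del: funpow.simps(2))
lemma run_add: "run (a + b) c = run b (run a c)"
  by (metis run_def add.commute comp_def funpow_add)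

lemma run_complete: "computes f n m \<Longrightarrow> \<exists>w. run w (cfg (push (index f) s) n) = cfg s m"
proof (induction arbitrary: s rule: computes.induct)
  case (9 k f x r)
  let ?c = "\<lambda>j. cfg (push (index f) (push (prod_encode (11, prod_encode (index f, prod_encode (x, j)))) s))
        (prod_encode (x, j))"
  have "j \<le> k \<Longrightarrow> \<exists>w. run w (?c 0) = ?c j" for j
  proof (induction j)
    case 0 show ?case using run_0 by blast
  next
    case (Suc j)
    then obtain w where w: "run w (?c 0) = ?c j" by auto
    obtain w' where "run w' (?c j) = cfg (push (prod_encode (11, prod_encode (index f, prod_encode (x, j)))) s) (Suc (r j))"
      using "9.IH"(1) Suc.prems by (meson Suc_le_lessD)
    then have "run (w + (w' + 1)) (?c 0) = ?c (Suc j)"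
      by (simp only: run_add run_Suc) (simp add: w run_Suc run_0 step_simps)
    then show ?case by blast
  qed
  then obtain w where w: "run w (?c 0) = ?c k" by blast
  obtain w' where "run w' (?c k) = cfg (push (prod_encode (11, prod_encode (index f, prod_encode (x, k)))) s) 0"
    using "9.IH"(2) by blast
  then have "run (Suc (w + (w' + 1))) (cfg (push (index (MMin f)) s) x) = cfg s k"
    by (simp only: run_add run_Suc) (simp add: w run_Suc run_0 step_simps)
  then show ?case by blast
next
  case (5 g n k f m)
  obtain a b where "run a (cfg (push (index g) (push (index f) s)) n) = cfg (push (index f) s) k"
     "run b (cfg (push (index f) s) k) = cfg s m" using 5 by blast
  then have "run (Suc (a + b)) (cfg (push (index (MComp f g)) s) n) = cfg s m"
    by (simp add: run_add run_Suc step_simps)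
  then show ?case by blast
next
  case (6 f n k g m)
  obtain a b where "run a (cfg (push (index f) (push (prod_encode (8, prod_encode (index g, n))) s)) n)
      = cfg (push (prod_encode (8, prod_encode (index g, n))) s) k"
     "run b (cfg (push (index g) (push (prod_encode (9, k)) s)) n) = cfg (push (prod_encode (9, k)) s) m" using 6 by blast
  then have "run (Suc (a + (Suc (b + 1)))) (cfg (push (index (MPair f g)) s) n) = cfg s (prod_encode (k, m))"
    by (simp only: run_add run_Suc) (simp add: run_Suc run_0 step_simps)
  then show ?case by blast
next
  case (7 f x m g)
  then obtain a where "run a (cfg (push (index f) s) x) = cfg s m" by blast
  then have "run (Suc a) (cfg (push (index (MRec f g)) s) (prod_encode (x, 0))) = cfg s m"
    by (simp add: run_Suc step_simps)
  then show ?case by blast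
next
  case (8 f g x z r m)
  let ?s = "push (prod_encode (10, prod_encode (index g, prod_encode (x, z)))) s"
  obtain a b where "run a (cfg (push (index (MRec f g)) ?s) (prod_encode (x, z))) = cfg ?s r"
     "run b (cfg (push (index g) s) (prod_encode (prod_encode (x, z), r))) = cfg s m" using 8 by blast
  then have "run (Suc (a + Suc b)) (cfg (push (index (MRec f g)) s) (prod_encode (x, Suc z))) = cfg s m"
    by (simp only: run_add run_Suc) (simp add: run_Suc run_0 step_simps)
  then show ?case by blast
qed (rule exI[of _ 1], simp add: run_Suc run_0 step_simps)+


lemma run_sound: "run w (cfg (push (index p) s) n) = cfg 0 m \<Longrightarrow>
    \<exists>w' k. w' < w \<and> computes p n k \<and> run w' (cfg s k) = cfg 0 m"
proof (induction w arbitrary: p s n rule: less_induct)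
  case (less w)
  obtain v where w: "w = Suc v" using less.prems by (cases w) (auto simp: run_0)
  obtain x y where n: "n = prod_encode (x, y)" by (metis prod_decode_inverse surj_pair)
  have r: "run v (step (cfg (push (index p) s) n)) = cfg 0 m" using less.prems by (simp add: w run_Suc)
  note IH = less.IH[unfolded w]
  show ?case
  proof (cases p)
    case (MComp f g)
    then have "run v (cfg (push (index g) (push (index f) s)) n) = cfg 0 m" using r by (simp add: step_simps)
    then obtain w1 k where 1: "w1 < v" "computes g n k" "run w1 (cfg (push (index f) s) k) = cfg 0 m"
      using IH[of v] by blast
    then obtain w2 l where "w2 < w1" "computes f k l" "run w2 (cfg s l) = cfg 0 m"
      using IH[of w1] by (meson less_SucI)
    then show ?thesis using 1 w MComp computes.intros(5) by (metis less_SucI less_trans)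
  next
    case (MPair f g)
    then have "run v (cfg (push (index f) (push (prod_encode (8, prod_encode (index g, n))) s)) n) = cfg 0 m"
      using r by (simp add: step_simps)
    then obtain w1 k where 1: "w1 < v" "computes f n k"
       "run w1 (cfg (push (prod_encode (8, prod_encode (index g, n))) s) k) = cfg 0 m"
      using IH[of v] by blast
    then obtain w2 where 2: "w1 = Suc w2" by (cases w1) (auto simp: run_0)
    have "run w2 (cfg (push (index g) (push (prod_encode (9, k)) s)) n) = cfg 0 m"
      using 1(3) by (simp add: 2 run_Suc step_simps)
    then obtain w3 l where 3: "w3 < w2" "computes g n l" "run w3 (cfg (push (prod_encode (9, k)) s) l) = cfg 0 m"
      using IH[of w2] 1(1) 2 by (metis Suc_lessD less_SucI)
    then obtain w4 where 4: "w3 = Suc w4" by (cases w3) (auto simp: run_0)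
    have "run w4 (cfg s (prod_encode (k, l))) = cfg 0 m"
      using 3(3) by (simp add: 4 run_Suc step_simps)
    moreover have "w4 < w" using 1 2 3 4 w by simp
    ultimately show ?thesis using 1 3 MPair computes.intros(6) by blast
  next
    case (MRec f g)
    show ?thesis
    proof (cases y)
      case 0
      then have "run v (cfg (push (index f) s) x) = cfg 0 m" using r MRec n by (simp add: step_simps)
      then show ?thesis using IH[of v] 0 n MRec w computes.intros(7) by (metis less_SucI lessI)
    next
      case (Suc z)
      then have "run v (cfg (push (index p) (push (prod_encode (10, prod_encode (index g, prod_encode (x, z)))) s)) (prod_encode (x, z))) = cfg 0 m"
        using r MRec n by (simp add: step_simps)
      then obtain w1 k where 1: "w1 < v" "computes p (prod_encode (x, z)) k"
        "run w1 (cfg (push (prod_encode (10, prod_encode (index g, prod_encode (x, z)))) s) k) = cfg 0 m"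
        using IH[of v] by blast
      then obtain w2 where 2: "w1 = Suc w2" by (cases w1) (auto simp: run_0)
      have "run w2 (cfg (push (index g) s) (prod_encode (prod_encode (x, z), k))) = cfg 0 m"
        using 1(3) by (simp add: 2 run_Suc step_simps)
      then obtain w3 l where 3: "w3 < w2" "computes g (prod_encode (prod_encode (x, z), k)) l"
        "run w3 (cfg s l) = cfg 0 m" using IH[of w2] 1(1) 2 by (metis Suc_lessD less_SucI)
      have "computes p n l" using 1(2) 3(2) unfolding MRec n Suc by (rule computes.intros(8))
      moreover have "w3 < w" using 1 2 3 w by simp
      ultimately show ?thesis using 3 by blast
    qed
  next
    case (MMin f)
    have *: "run u (cfg (push (index f) (push (prod_encode (11, prod_encode (index f, prod_encode (n, j)))) s))
        (prod_encode (n, j))) = cfg 0 m \<Longrightarrow> u \<le> v \<Longrightarrow>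
        (\<And>i. i < j \<Longrightarrow> \<exists>r. computes f (prod_encode (n, i)) (Suc r)) \<Longrightarrow>
        \<exists>w' k. w' < w \<and> computes p n k \<and> run w' (cfg s k) = cfg 0 m" for u j
    proof (induction u arbitrary: j rule: less_induct)
      case (less u)
      obtain w1 k where 1: "w1 < u" "computes f (prod_encode (n, j)) k"
        "run w1 (cfg (push (prod_encode (11, prod_encode (index f, prod_encode (n, j)))) s) k) = cfg 0 m"
        using IH[OF _ less.prems(1)] less.prems(2) by auto
      then obtain w2 where 2: "w1 = Suc w2" by (cases w1) (auto simp: run_0)
      show ?case
      proof (cases k)
        case 0
        obtain r where "\<And>i. i < j \<Longrightarrow> computes f (prod_encode (n, i)) (Suc (r i))"
          using less.prems(3) by metis
        then have "computes p n j" using 1(2) 0 unfolding MMin by (auto intro: computes.intros(9))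
        moreover have "run w2 (cfg s j) = cfg 0 m" using 1(3) by (simp add: 2 0 run_Suc step_simps)
        moreover have "w2 < w" using 1 2 less.prems(2) w by simp
        ultimately show ?thesis by blast
      next
        case (Suc r)
        show ?thesis
        proof (rule less.IH[of w2 "Suc j"])
          show "run w2 (cfg (push (index f) (push (prod_encode (11, prod_encode (index f, prod_encode (n, Suc j)))) s)) (prod_encode (n, Suc j))) = cfg 0 m"
            using 1(3) by (simp add: 2 Suc run_Suc step_simps)
          show "\<exists>r. computes f (prod_encode (n, i)) (Suc r)" if "i < Suc j" for i
            using that less.prems(3) 1(2) Suc less_SucE by metis
        qed (use 1 2 less.prems(2) in auto)
      qed
    qed
    show ?thesis by (rule *[of v 0]) (use r MMin in \<open>auto simp: step_simps\<close>)
  qed (use r w n computes.intros(1-4) in \<open>auto simp: step_simps\<close>, (metis lessI computes.intros(1-4))+)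
qed

lemma run_final: "run w (cfg 0 k) = cfg 0 k" by (induction w) (auto simp: run_0 run_Suc step_simps)

theorem p_run_adequate: "(\<exists>w. eval p_run [w, index f, n] = prod_encode (0, m)) \<longleftrightarrow> computes f n m"
proof
  assume "\<exists>w. eval p_run [w, index f, n] = prod_encode (0, m)"
  then show "computes f n m" using run_sound[of _ f 0 n m] by (auto simp: eval_run run_final)
next
  show "computes f n m \<Longrightarrow> \<exists>w. eval p_run [w, index f, n] = prod_encode (0, m)"
    using run_complete by (auto simp: eval_run)
qed


section \<open>Terms and formulas\<close>

text \<open>Variables are de Bruijn indices. The atoms \<open>Vs\<close>, \<open>Mn\<close>, \<open>Tr\<close> stand for ``v-set'',
  ``Meaningful condition'', ``True condition''.\<close>

datatype tm = Var nat | Fn prsym "tm list"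

datatype fm =
    Bot
  | Eq tm tm (infix "\<^bold>=" 50)
  | Vs tm
  | Mn tm
  | Tr tm
  | And fm fm (infixr "\<^bold>\<and>" 35)
  | Or fm fm (infixr "\<^bold>\<or>" 30)
  | Imp fm fm (infixr "\<^bold>\<longrightarrow>" 25)
  | All fm
  | Ex fm

abbreviation Iff :: "fm \<Rightarrow> fm \<Rightarrow> fm" (infixr "\<^bold>\<longleftrightarrow>" 25) where
  "\<phi> \<^bold>\<longleftrightarrow> \<psi> \<equiv> (\<phi> \<^bold>\<longrightarrow> \<psi>) \<^bold>\<and> (\<psi> \<^bold>\<longrightarrow> \<phi>)"

abbreviation zero :: tm where "zero \<equiv> Fn PZero []"
abbreviation suc :: "tm \<Rightarrow> tm" where "suc t \<equiv> Fn PSucc [t]"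
abbreviation pair :: "tm \<Rightarrow> tm \<Rightarrow> tm" where "pair s t \<equiv> Fn p_pair [s, t]"
abbreviation left :: "tm \<Rightarrow> tm" where "left t \<equiv> Fn p_left [t]"
abbreviation right :: "tm \<Rightarrow> tm" where "right t \<equiv> Fn p_right [t]"

primrec tsubst :: "(nat \<Rightarrow> tm) \<Rightarrow> tm \<Rightarrow> tm" where
  "tsubst \<sigma> (Var i) = \<sigma> i"
| "tsubst \<sigma> (Fn f ts) = Fn f (map (tsubst \<sigma>) ts)"

abbreviation up :: "tm \<Rightarrow> tm" where "up \<equiv> tsubst (\<lambda>i. Var (Suc i))"

definition under :: "(nat \<Rightarrow> tm) \<Rightarrow> nat \<Rightarrow> tm" where
  "under \<sigma> = case_nat (Var 0) (\<lambda>i. up (\<sigma> i))"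

primrec subst :: "(nat \<Rightarrow> tm) \<Rightarrow> fm \<Rightarrow> fm" where
  "subst \<sigma> Bot = Bot"
| "subst \<sigma> (s \<^bold>= t) = (tsubst \<sigma> s \<^bold>= tsubst \<sigma> t)"
| "subst \<sigma> (Vs t) = Vs (tsubst \<sigma> t)"
| "subst \<sigma> (Mn t) = Mn (tsubst \<sigma> t)"
| "subst \<sigma> (Tr t) = Tr (tsubst \<sigma> t)"
| "subst \<sigma> (\<phi> \<^bold>\<and> \<psi>) = (subst \<sigma> \<phi> \<^bold>\<and> subst \<sigma> \<psi>)"
| "subst \<sigma> (\<phi> \<^bold>\<or> \<psi>) = (subst \<sigma> \<phi> \<^bold>\<or> subst \<sigma> \<psi>)"
| "subst \<sigma> (\<phi> \<^bold>\<longrightarrow> \<psi>) = (subst \<sigma> \<phi> \<^bold>\<longrightarrow> subst \<sigma> \<psi>)"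
| "subst \<sigma> (All \<phi>) = All (subst (under \<sigma>) \<phi>)"
| "subst \<sigma> (Ex \<phi>) = Ex (subst (under \<sigma>) \<phi>)"

abbreviation lift :: "fm \<Rightarrow> fm" where "lift \<equiv> subst (\<lambda>i. Var (Suc i))"

text \<open>\<open>inst k t \<phi>\<close> is \<open>\<phi>(t)\<close>, where \<open>\<phi>(x)\<close> has its argument at index 0, placed under
  \<open>k\<close> binders with respect to the parameters of \<open>\<phi>\<close>.\<close>

definition inst :: "nat \<Rightarrow> tm \<Rightarrow> fm \<Rightarrow> fm" where
  "inst k t = subst (case_nat t (\<lambda>i. Var (i + k)))"

text \<open>\<open>app e n m\<close> says that \<open>en\<close> is defined with value \<open>m\<close>, \<open>dfd e n\<close> that \<open>en\<close> is
  defined, and \<open>appl e n \<phi>\<close> that \<open>en\<close> is defined and \<open>\<phi>(en)\<close>; \<open>appl\<close> binds the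
  index 0 in \<open>\<phi>\<close>.\<close>

definition app :: "tm \<Rightarrow> tm \<Rightarrow> tm \<Rightarrow> fm" where
  "app e n m = Ex (Fn p_run [Var 0, up e, up n] \<^bold>= pair zero (up m))"

definition dfd :: "tm \<Rightarrow> tm \<Rightarrow> fm" where
  "dfd e n = Ex (app (up e) (up n) (Var 0))"

definition appl :: "tm \<Rightarrow> tm \<Rightarrow> fm \<Rightarrow> fm" where
  "appl e n \<phi> = Ex (app (up e) (up n) (Var 0) \<^bold>\<and> \<phi>)"


section \<open>The formal system\<close>

text \<open>\<open>Sigma_1\<close> formulas are existential quantifications of quantifier-free arithmetical
  formulas; bounded quantifiers are not needed in the presence of all primitive recursive
  function symbols.\<close>

primrec qfree_arith :: "fm \<Rightarrow> bool" where
  "qfree_arith Bot \<longleftrightarrow> True"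
| "qfree_arith (s \<^bold>= t) \<longleftrightarrow> True"
| "qfree_arith (Vs t) \<longleftrightarrow> False"
| "qfree_arith (Mn t) \<longleftrightarrow> False"
| "qfree_arith (Tr t) \<longleftrightarrow> False"
| "qfree_arith (\<phi> \<^bold>\<and> \<psi>) \<longleftrightarrow> qfree_arith \<phi> \<and> qfree_arith \<psi>"
| "qfree_arith (\<phi> \<^bold>\<or> \<psi>) \<longleftrightarrow> qfree_arith \<phi> \<and> qfree_arith \<psi>"
| "qfree_arith (\<phi> \<^bold>\<longrightarrow> \<psi>) \<longleftrightarrow> qfree_arith \<phi> \<and> qfree_arith \<psi>"
| "qfree_arith (All \<phi>) \<longleftrightarrow> False"
| "qfree_arith (Ex \<phi>) \<longleftrightarrow> False"

inductive Sigma_1 :: "fm \<Rightarrow> bool" where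
  "qfree_arith \<phi> \<Longrightarrow> Sigma_1 \<phi>"
| "Sigma_1 \<phi> \<Longrightarrow> Sigma_1 (Ex \<phi>)"

inductive almost_negative :: "fm \<Rightarrow> bool" where
  "Sigma_1 \<phi> \<Longrightarrow> almost_negative \<phi>"
| "almost_negative (Vs t)"
| "almost_negative (Mn t)"
| "almost_negative (Tr t)"
| "almost_negative \<phi> \<Longrightarrow> almost_negative \<psi> \<Longrightarrow> almost_negative (\<phi> \<^bold>\<and> \<psi>)"
| "almost_negative \<phi> \<Longrightarrow> almost_negative \<psi> \<Longrightarrow> almost_negative (\<phi> \<^bold>\<longrightarrow> \<psi>)"
| "almost_negative \<phi> \<Longrightarrow> almost_negative (All \<phi>)"

text \<open>\<open>V_step \<phi>\<close> is the antecedent of (V1) with \<open>V\<close> replaced by \<open>\<phi>\<close>; both in \<open>\<phi>\<close> and in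
  \<open>V_step \<phi>\<close> the index 0 is the set variable. Inside, the indices 0, 1, 2 are \<open>xn\<close>, \<open>n\<close>,
  \<open>x\<close>.\<close>

definition V_step :: "fm \<Rightarrow> fm" where
  "V_step \<phi> = All (appl (Var 1) (Var 0)
    (Mn (right (Var 0)) \<^bold>\<and> (Tr (right (Var 0)) \<^bold>\<longrightarrow> inst 3 (left (Var 0)) \<phi>)))"

inductive HA_axiom :: "fm \<Rightarrow> bool" where
  suc_neq_zero: "HA_axiom ((suc t \<^bold>= zero) \<^bold>\<longrightarrow> Bot)"
| suc_inject: "HA_axiom ((suc s \<^bold>= suc t) \<^bold>\<longrightarrow> (s \<^bold>= t))"
| pr_zero: "HA_axiom (Fn PZero ts \<^bold>= zero)"
| pr_proj: "i < length ts \<Longrightarrow> HA_axiom (Fn (PProj i) ts \<^bold>= ts ! i)"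
| pr_comp: "HA_axiom (Fn (PComp f gs) ts \<^bold>= Fn f (map (\<lambda>g. Fn g ts) gs))"
| pr_rec_zero: "HA_axiom (Fn (PRec f g) (zero # ts) \<^bold>= Fn f ts)"
| pr_rec_suc: "HA_axiom (Fn (PRec f g) (suc t # ts) \<^bold>= Fn g (t # Fn (PRec f g) (t # ts) # ts))"
| induction: "HA_axiom (inst 0 zero \<phi> \<^bold>\<and> All (\<phi> \<^bold>\<longrightarrow> inst 1 (suc (Var 0)) \<phi>) \<^bold>\<longrightarrow> All \<phi>)"

text \<open>The parameter \<open>xi\<close> is the symbol for the coding \<open>\<Xi>\<close>. In (X1) and (X2) the indices of
  \<open>f\<close>, \<open>g\<close> are 1, 0 outside and 2, 1 inside the quantifier on \<open>n\<close>. In ECT, \<open>\<phi>\<close> has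
  \<open>n\<close> at index 0, and \<open>\<psi>\<close> has \<open>m\<close>, \<open>n\<close> at indices 0, 1.\<close>

inductive axiom :: "prsym \<Rightarrow> fm \<Rightarrow> bool" for xi :: prsym where
  HA: "HA_axiom \<phi> \<Longrightarrow> axiom xi \<phi>"
| V1: "axiom xi (All (V_step (Vs (Var 0)) \<^bold>\<longrightarrow> Vs (Var 0)))"
| V2: "axiom xi (All (V_step \<phi> \<^bold>\<longrightarrow> \<phi>) \<^bold>\<longrightarrow> All (Vs (Var 0) \<^bold>\<longrightarrow> \<phi>))"
| X1: "axiom xi (All (All (Mn (Fn xi [Var 1, Var 0]) \<^bold>\<longrightarrow>
        (Tr (Fn xi [Var 1, Var 0]) \<^bold>\<longleftrightarrow>
         All (appl (Var 2) (Var 0) (Tr (Var 0)) \<^bold>\<longrightarrow> appl (Var 1) (Var 0) (Tr (Var 0)))))))"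
| X2: "axiom xi (All (All (
        All (dfd (Var 2) (Var 0) \<^bold>\<longrightarrow> appl (Var 2) (Var 0) (Mn (Var 0))) \<^bold>\<and>
        All (dfd (Var 2) (Var 0) \<^bold>\<and> dfd (Var 1) (Var 0) \<^bold>\<and> appl (Var 2) (Var 0) (Tr (Var 0)) \<^bold>\<longrightarrow>
             appl (Var 1) (Var 0) (Mn (Var 0)))
        \<^bold>\<longrightarrow> Mn (Fn xi [Var 1, Var 0]))))"
| ECT: "almost_negative \<phi> \<Longrightarrow>
        axiom xi (All (\<phi> \<^bold>\<longrightarrow> Ex \<psi>) \<^bold>\<longrightarrow>
          Ex (All (inst 2 (Var 0) \<phi> \<^bold>\<longrightarrow>
            appl (Var 1) (Var 0)
              (subst (case_nat (Var 0) (case_nat (Var 1) (\<lambda>i. Var (i + 3)))) \<psi>))))"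

inductive provable :: "prsym \<Rightarrow> fm list \<Rightarrow> fm \<Rightarrow> bool" for xi :: prsym where
  ax: "axiom xi \<phi> \<Longrightarrow> provable xi \<Gamma> \<phi>"
| hyp: "\<phi> \<in> set \<Gamma> \<Longrightarrow> provable xi \<Gamma> \<phi>"
| BotE: "provable xi \<Gamma> Bot \<Longrightarrow> provable xi \<Gamma> \<phi>"
| AndI: "provable xi \<Gamma> \<phi> \<Longrightarrow> provable xi \<Gamma> \<psi> \<Longrightarrow> provable xi \<Gamma> (\<phi> \<^bold>\<and> \<psi>)"
| AndE1: "provable xi \<Gamma> (\<phi> \<^bold>\<and> \<psi>) \<Longrightarrow> provable xi \<Gamma> \<phi>"
| AndE2: "provable xi \<Gamma> (\<phi> \<^bold>\<and> \<psi>) \<Longrightarrow> provable xi \<Gamma> \<psi>"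
| OrI1: "provable xi \<Gamma> \<phi> \<Longrightarrow> provable xi \<Gamma> (\<phi> \<^bold>\<or> \<psi>)"
| OrI2: "provable xi \<Gamma> \<psi> \<Longrightarrow> provable xi \<Gamma> (\<phi> \<^bold>\<or> \<psi>)"
| OrE: "provable xi \<Gamma> (\<phi> \<^bold>\<or> \<psi>) \<Longrightarrow> provable xi (\<phi> # \<Gamma>) \<chi> \<Longrightarrow> provable xi (\<psi> # \<Gamma>) \<chi> \<Longrightarrow>
        provable xi \<Gamma> \<chi>"
| ImpI: "provable xi (\<phi> # \<Gamma>) \<psi> \<Longrightarrow> provable xi \<Gamma> (\<phi> \<^bold>\<longrightarrow> \<psi>)"
| ImpE: "provable xi \<Gamma> (\<phi> \<^bold>\<longrightarrow> \<psi>) \<Longrightarrow> provable xi \<Gamma> \<phi> \<Longrightarrow> provable xi \<Gamma> \<psi>"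
| AllI: "provable xi (map lift \<Gamma>) \<phi> \<Longrightarrow> provable xi \<Gamma> (All \<phi>)"
| AllE: "provable xi \<Gamma> (All \<phi>) \<Longrightarrow> provable xi \<Gamma> (inst 0 t \<phi>)"
| ExI: "provable xi \<Gamma> (inst 0 t \<phi>) \<Longrightarrow> provable xi \<Gamma> (Ex \<phi>)"
| ExE: "provable xi \<Gamma> (Ex \<phi>) \<Longrightarrow> provable xi (\<phi> # map lift \<Gamma>) (lift \<psi>) \<Longrightarrow> provable xi \<Gamma> \<psi>"
| EqI: "provable xi \<Gamma> (t \<^bold>= t)"
| EqE: "provable xi \<Gamma> (s \<^bold>= t) \<Longrightarrow> provable xi \<Gamma> (inst 0 s \<phi>) \<Longrightarrow> provable xi \<Gamma> (inst 0 t \<phi>)"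


section \<open>The v-set interpretation\<close>

text \<open>Set-theoretic formulas, again with de Bruijn indices. \<open>SBAll i \<phi>\<close> and \<open>SBEx i \<phi>\<close>
  are quantifiers over the elements of the set variable \<open>i\<close>, which itself is not in the
  scope of the bound variable.\<close>

datatype sfm =
    SBot
  | SEq nat nat
  | SMem nat nat
  | SAnd sfm sfm
  | SOr sfm sfm
  | SImp sfm sfm
  | SAll sfm
  | SEx sfm
  | SBAll nat sfm
  | SBEx nat sfm

abbreviation "SNeg \<phi> \<equiv> SImp \<phi> SBot"
abbreviation "SIff \<phi> \<psi> \<equiv> SAnd (SImp \<phi> \<psi>) (SImp \<psi> \<phi>)"

text \<open>\<open>in_EL a x\<close> is \<open>a \<in> EL(x)\<close>.\<close>

definition in_EL :: "tm \<Rightarrow> tm \<Rightarrow> fm" where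
  "in_EL a x = Ex (appl (up x) (Var 0) (Tr (right (Var 0)) \<^bold>\<and> (up (up a) \<^bold>= left (Var 0))))"

text \<open>A formula \<open>E\<close> is read as a binary relation with its arguments at the indices 0
  and 1; further free variables, if any, are replaced by zero.\<close>

definition rel :: "fm \<Rightarrow> tm \<Rightarrow> tm \<Rightarrow> fm" where
  "rel E s t = subst (case_nat s (case_nat t (\<lambda>_. zero))) E"

text \<open>\<open>E\<close> defines extensional equality of v-sets if the system proves its recursive
  characterization. By (V2), this determines \<open>E\<close> on v-sets up to provable equivalence.\<close>

definition extensional_equality :: "prsym \<Rightarrow> fm \<Rightarrow> bool" where
  "extensional_equality xi E \<longleftrightarrow> provable xi [] (All (All (
     Vs (Var 1) \<^bold>\<and> Vs (Var 0) \<^bold>\<longrightarrow>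
     (rel E (Var 1) (Var 0) \<^bold>\<longleftrightarrow>
       All (in_EL (Var 0) (Var 2) \<^bold>\<longrightarrow> Ex (in_EL (Var 0) (Var 2) \<^bold>\<and> rel E (Var 1) (Var 0))) \<^bold>\<and>
       All (in_EL (Var 0) (Var 1) \<^bold>\<longrightarrow> Ex (in_EL (Var 0) (Var 3) \<^bold>\<and> rel E (Var 1) (Var 0)))))))"

primrec interp :: "fm \<Rightarrow> sfm \<Rightarrow> fm" where
  "interp E SBot = Bot"
| "interp E (SEq i j) = rel E (Var i) (Var j)"
| "interp E (SMem i j) = Ex (in_EL (Var 0) (Var (Suc j)) \<^bold>\<and> rel E (Var (Suc i)) (Var 0))"
| "interp E (SAnd \<phi> \<psi>) = (interp E \<phi> \<^bold>\<and> interp E \<psi>)"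
| "interp E (SOr \<phi> \<psi>) = (interp E \<phi> \<^bold>\<or> interp E \<psi>)"
| "interp E (SImp \<phi> \<psi>) = (interp E \<phi> \<^bold>\<longrightarrow> interp E \<psi>)"
| "interp E (SAll \<phi>) = All (Vs (Var 0) \<^bold>\<longrightarrow> interp E \<phi>)"
| "interp E (SEx \<phi>) = Ex (Vs (Var 0) \<^bold>\<and> interp E \<phi>)"
| "interp E (SBAll i \<phi>) = All (in_EL (Var 0) (Var (Suc i)) \<^bold>\<longrightarrow> interp E \<phi>)"
| "interp E (SBEx i \<phi>) = Ex (in_EL (Var 0) (Var (Suc i)) \<^bold>\<and> interp E \<phi>)"

definition false_in_vsets :: "prsym \<Rightarrow> fm \<Rightarrow> sfm \<Rightarrow> bool" where
  "false_in_vsets xi E \<phi> \<longleftrightarrow> provable xi [] (interp E (SNeg \<phi>))"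


section \<open>The principle of Choice\<close>

definition is_upair :: "nat \<Rightarrow> nat \<Rightarrow> nat \<Rightarrow> sfm" where
  "is_upair q y z = SAll (SIff (SMem 0 (q + 1)) (SOr (SEq 0 (y + 1)) (SEq 0 (z + 1))))"

text \<open>Kuratowski pairs \<open>p = {{y}, {y, z}}\<close>.\<close>

definition is_opair :: "nat \<Rightarrow> nat \<Rightarrow> nat \<Rightarrow> sfm" where
  "is_opair p y z = SAll (SIff (SMem 0 (p + 1))
     (SOr (is_upair 0 (y + 1) (y + 1)) (is_upair 0 (y + 1) (z + 1))))"

definition opair_mem :: "nat \<Rightarrow> nat \<Rightarrow> nat \<Rightarrow> sfm" where
  "opair_mem y z f = SBEx f (is_opair 0 (y + 1) (z + 1))"

definition is_function :: "nat \<Rightarrow> sfm" where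
  "is_function f =
    SAnd (SBAll f (SEx (SEx (is_opair 2 1 0))))
         (SAll (SAll (SAll (SImp (SAnd (opair_mem 2 1 (f + 3)) (opair_mem 2 0 (f + 3))) (SEq 1 0)))))"

definition has_domain :: "nat \<Rightarrow> nat \<Rightarrow> sfm" where
  "has_domain f x = SAll (SIff (SMem 0 (x + 1)) (SEx (opair_mem 1 0 (f + 2))))"

definition is_choice_function :: "nat \<Rightarrow> nat \<Rightarrow> sfm" where
  "is_choice_function f x =
    SAnd (is_function f) (SAnd (has_domain f x)
      (SBAll x (SAll (SImp (opair_mem 1 0 (f + 2)) (SMem 0 1)))))"

definition Choice :: sfm where
  "Choice = SAll (SImp (SBAll 0 (SEx (SMem 0 1))) (SEx (is_choice_function 0 1)))"

end

theory Submission
  imports Defs "HOL-Library.Countable"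
begin

text \<open>
  Choice decides every condition \<open>c\<close> by Diaconescu's argument, applied to the sets
  \<open>{0} \<union> {1 | c}\<close> and \<open>{1} \<union> {0 | c}\<close>. For \<open>c\<close> we take a condition \<open>c\<^sub>e\<close> saying that \<open>e\<close> applied
  to itself does not have the value \<open>0\<close>; by ECT the resulting decision of all \<open>c\<^sub>e\<close> is made by
  some index \<open>k\<close> that outputs \<open>0\<close> if \<open>c\<^sub>e\<close> holds and \<open>1\<close> otherwise, and \<open>k\<close> applied to itself is a
  contradiction.

  ECT also supplies an index for every function given by a term, so that hardly any index has
  to be computed; only one nowhere defined index is exhibited, to have a first condition.

  The derivation is carried out semantically: the system is complete for Kripke models whose
  nodes are prime theories with witnesses, and Choice is refuted at every node.
\<close>


section \<open>Substitution and free variables\<close>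

text \<open>Diaconescu's argument decides only Meaningful conditions, because (V1) admits a set only
  if the condition at every argument is Meaningful. An arbitrary formula therefore cannot be put
  into a set; the condition has to be built with \<open>xi\<close>, and (X1) then reads it as a
  universal implication between truths of values. "No stage of a computation is final with value
  \<open>0\<close>" has this form, which is why the decided statement is a negated one. Choice at a
  node persists to all later nodes, so the decision is available for every index at once. ECT
  applies because the premise is trivial and its conclusion may be any formula, in particular a
  disjunction. Output \<open>0\<close> asserts that the value is not \<open>0\<close>, and output
  \<open>1\<close> asserts the negation of that, so either answer of \<open>k\<close> at
  \<open>k\<close> refutes itself. In the Kripke model, disjunctions and existentials are settled at
  the node itself, so a case distinction inside the system is one of HOL; the price is a quantifier
  over later nodes at each implication and each universal quantifier. Classical reasoning occurs
  only about the nodes.\<close>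

primrec tvars :: "tm \<Rightarrow> nat set" where
  "tvars (Var i) = {i}"
| "tvars (Fn f ts) = \<Union> (set (map tvars ts))"

primrec fv :: "fm \<Rightarrow> nat set" where
  "fv Bot = {}"
| "fv (s \<^bold>= t) = tvars s \<union> tvars t"
| "fv (Vs t) = tvars t"
| "fv (Mn t) = tvars t"
| "fv (Tr t) = tvars t"
| "fv (\<phi> \<^bold>\<and> \<psi>) = fv \<phi> \<union> fv \<psi>"
| "fv (\<phi> \<^bold>\<or> \<psi>) = fv \<phi> \<union> fv \<psi>"
| "fv (\<phi> \<^bold>\<longrightarrow> \<psi>) = fv \<phi> \<union> fv \<psi>"
| "fv (All \<phi>) = {i. Suc i \<in> fv \<phi>}"
| "fv (Ex \<phi>) = {i. Suc i \<in> fv \<phi>}"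

lemma finite_tvars: "finite (tvars t)"
  by (induction t) auto

lemma finite_fv: "finite (fv \<phi>)"
proof (induction \<phi>)
  case (All \<phi>)
  then show ?case using finite_vimageI[of "fv \<phi>" Suc] by (simp add: vimage_def)
next
  case (Ex \<phi>)
  then show ?case using finite_vimageI[of "fv \<phi>" Suc] by (simp add: vimage_def)
qed (auto simp: finite_tvars)

lemma tsubst_cong: "(\<And>i. i \<in> tvars t \<Longrightarrow> \<sigma> i = \<tau> i) \<Longrightarrow> tsubst \<sigma> t = tsubst \<tau> t"
proof (induction t)
  case (Fn f ts)
  then show ?case by (auto intro!: map_cong)
qed simp

lemma tsubst_Var [simp]: "tsubst Var t = t"
  by (induction t) (auto intro: map_idI)

lemma tsubst_tsubst [simp]: "tsubst \<sigma> (tsubst \<tau> t) = tsubst (\<lambda>i. tsubst \<sigma> (\<tau> i)) t"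
  by (induction t) auto

lemma under_simps [simp]: "under \<sigma> 0 = Var 0" "under \<sigma> (Suc i) = up (\<sigma> i)"
  by (simp_all add: under_def)

lemma subst_cong: "(\<And>i. i \<in> fv \<phi> \<Longrightarrow> \<sigma> i = \<tau> i) \<Longrightarrow> subst \<sigma> \<phi> = subst \<tau> \<phi>"
proof (induction \<phi> arbitrary: \<sigma> \<tau>)
  case (All \<phi>)
  have "subst (under \<sigma>) \<phi> = subst (under \<tau>) \<phi>"
    by (rule All.IH) (use All.prems in \<open>auto simp: under_def split: nat.split\<close>)
  then show ?case by simp
next
  case (Ex \<phi>)
  have "subst (under \<sigma>) \<phi> = subst (under \<tau>) \<phi>"
    by (rule Ex.IH) (use Ex.prems in \<open>auto simp: under_def split: nat.split\<close>)
  then show ?case by simp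
next
  case (And \<phi> \<psi>)
  show ?case using And.IH[of \<sigma> \<tau>] And.prems by simp
next
  case (Or \<phi> \<psi>)
  show ?case using Or.IH[of \<sigma> \<tau>] Or.prems by simp
next
  case (Imp \<phi> \<psi>)
  show ?case using Imp.IH[of \<sigma> \<tau>] Imp.prems by simp
qed (auto intro!: tsubst_cong)

lemma under_Var [simp]: "under Var = Var"
  by (auto simp: under_def fun_eq_iff split: nat.split)

lemma subst_Var [simp]: "subst Var \<phi> = \<phi>"
  by (induction \<phi>) auto

lemma subst_subst [simp]: "subst \<sigma> (subst \<tau> \<phi>) = subst (\<lambda>i. tsubst \<sigma> (\<tau> i)) \<phi>"
proof (induction \<phi> arbitrary: \<sigma> \<tau>)
  case (All \<phi>)
  have "(\<lambda>i. tsubst (under \<sigma>) (under \<tau> i)) = under (\<lambda>i. tsubst \<sigma> (\<tau> i))"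
    by (auto simp: fun_eq_iff under_def split: nat.split)
  then show ?case using All by simp
next
  case (Ex \<phi>)
  have "(\<lambda>i. tsubst (under \<sigma>) (under \<tau> i)) = under (\<lambda>i. tsubst \<sigma> (\<tau> i))"
    by (auto simp: fun_eq_iff under_def split: nat.split)
  then show ?case using Ex by simp
qed auto

lemma tvars_tsubst: "tvars (tsubst \<sigma> t) = (\<Union>i\<in>tvars t. tvars (\<sigma> i))"
  by (induction t) auto

lemma fv_subst: "fv (subst \<sigma> \<phi>) = (\<Union>i\<in>fv \<phi>. tvars (\<sigma> i))"
proof (induction \<phi> arbitrary: \<sigma>)
  case (All \<phi>)
  have "Suc j \<in> tvars (under \<sigma> i) \<longleftrightarrow> (\<exists>k. i = Suc k \<and> j \<in> tvars (\<sigma> k))" for i j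
    by (cases i) (auto simp: tvars_tsubst)
  then show ?case using All by auto
next
  case (Ex \<phi>)
  have "Suc j \<in> tvars (under \<sigma> i) \<longleftrightarrow> (\<exists>k. i = Suc k \<and> j \<in> tvars (\<sigma> k))" for i j
    by (cases i) (auto simp: tvars_tsubst)
  then show ?case using Ex by auto
qed (auto simp: tvars_tsubst)

lemma subst_inst: "subst \<sigma> (inst 0 t \<phi>) = inst 0 (tsubst \<sigma> t) (subst (under \<sigma>) \<phi>)"
  by (auto simp: inst_def split: nat.split intro!: subst_cong)

text \<open>Links the instance rules of the calculus to the environments
  \<open>case_nat t \<sigma>\<close> of forcing; the quantifier cases of \<open>truth_lemma\<close>
  rest on it.\<close>

lemma inst_subst_under: "inst 0 t (subst (under \<sigma>) \<phi>) = subst (case_nat t \<sigma>) \<phi>"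
  by (auto simp: inst_def split: nat.split intro!: subst_cong)


section \<open>Structural properties of derivations\<close>

lemma subst_app [simp]: "subst \<sigma> (app e n m) = app (tsubst \<sigma> e) (tsubst \<sigma> n) (tsubst \<sigma> m)"
  by (simp add: app_def)

lemma subst_dfd [simp]: "subst \<sigma> (dfd e n) = dfd (tsubst \<sigma> e) (tsubst \<sigma> n)"
  by (simp add: dfd_def)

lemma subst_appl [simp]:
  "subst \<sigma> (appl e n \<phi>) = appl (tsubst \<sigma> e) (tsubst \<sigma> n) (subst (under \<sigma>) \<phi>)"
  by (simp add: appl_def)

lemma subst_V_step: "subst (under \<sigma>) (V_step \<phi>) = V_step (subst (under \<sigma>) \<phi>)"
proof -
  have "subst (under (under (under \<sigma>))) (inst 3 (left (Var 0)) \<phi>)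
      = inst 3 (left (Var 0)) (subst (under \<sigma>) \<phi>)"
    by (auto simp: inst_def eval_nat_numeral split: nat.split intro!: subst_cong)
  then show ?thesis by (simp add: V_step_def)
qed

lemma qfree_arith_subst: "qfree_arith (subst \<sigma> \<phi>) = qfree_arith \<phi>"
  by (induction \<phi> arbitrary: \<sigma>) auto

lemma Sigma_1_subst: "Sigma_1 \<phi> \<Longrightarrow> Sigma_1 (subst \<sigma> \<phi>)"
  by (induction arbitrary: \<sigma> rule: Sigma_1.induct) (auto intro: Sigma_1.intros simp: qfree_arith_subst)

lemma almost_negative_subst: "almost_negative \<phi> \<Longrightarrow> almost_negative (subst \<sigma> \<phi>)"
  by (induction arbitrary: \<sigma> rule: almost_negative.induct)
    (auto intro: almost_negative.intros Sigma_1_subst)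

lemma HA_axiom_subst: "HA_axiom \<phi> \<Longrightarrow> HA_axiom (subst \<sigma> \<phi>)"
proof (induction rule: HA_axiom.induct)
  case (pr_proj i ts)
  then show ?case using HA_axiom.pr_proj[of i "map (tsubst \<sigma>) ts"] by simp
next
  case (pr_comp f gs ts)
  then show ?case using HA_axiom.pr_comp[of f gs "map (tsubst \<sigma>) ts"] by (simp add: comp_def)
next
  case (induction \<phi>)
  have "subst (under \<sigma>) (inst 1 (suc (Var 0)) \<phi>) = inst 1 (suc (Var 0)) (subst (under \<sigma>) \<phi>)"
    by (auto simp: inst_def split: nat.split intro!: subst_cong)
  then show ?case using HA_axiom.induction[of "subst (under \<sigma>) \<phi>"] by (simp add: subst_inst)
qed (auto intro: HA_axiom.intros)

text \<open>The axioms are schemes in their parameters. The work is to see that the index shifts in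
  \<open>V_step\<close> and in ECT commute with a substitution pushed under the same
  binders.\<close>

lemma axiom_subst: "axiom xi \<phi> \<Longrightarrow> axiom xi (subst \<sigma> \<phi>)"
proof (induction rule: axiom.induct)
  case (HA \<phi>)
  then show ?case by (simp add: HA_axiom_subst axiom.HA)
next
  case V1
  then show ?case using axiom.V1[of xi] by (simp add: subst_V_step)
next
  case (V2 \<phi>)
  then show ?case using axiom.V2[of xi "subst (under \<sigma>) \<phi>"] by (simp add: subst_V_step)
next
  case X1
  then show ?case using axiom.X1[of xi] by (simp add: eval_nat_numeral)
next
  case X2
  then show ?case using axiom.X2[of xi] by (simp add: eval_nat_numeral)
next
  case (ECT \<phi> \<psi>)
  let ?u = "subst (under \<sigma>) \<phi>" and ?v = "subst (under (under \<sigma>)) \<psi>"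
  let ?t = "case_nat (Var 0) (case_nat (Var (Suc 0)) (\<lambda>i. Var (i + 3)))"
  have 1: "subst (under (under \<sigma>)) (inst 2 (Var 0) \<phi>) = inst 2 (Var 0) ?u"
    by (auto simp: inst_def eval_nat_numeral split: nat.split intro!: subst_cong)
  have 2: "subst (under (under (under \<sigma>))) (subst ?t \<psi>) = subst ?t ?v"
    by (auto simp: eval_nat_numeral split: nat.split intro!: subst_cong)
  have "almost_negative ?u" using ECT almost_negative_subst by blast
  from axiom.ECT[OF this, of xi ?v] show ?case
    by (simp add: 1 2 del: subst_subst)
qed

text \<open>Contexts matter only as sets, so one induction covers weakening, contraction and
  exchange. The eigenvariable rules lift whole contexts, and lifting preserves inclusion.\<close>

lemma provable_weaken: "provable xi \<Gamma> \<phi> \<Longrightarrow> set \<Gamma> \<subseteq> set \<Delta> \<Longrightarrow> provable xi \<Delta> \<phi>"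
proof (induction arbitrary: \<Delta> rule: provable.induct)
  case (ax \<phi> \<Gamma>)
  from ax.hyps show ?case by (rule provable.ax)
next
  case (hyp \<phi> \<Gamma>)
  then show ?case by (intro provable.hyp) auto
next
  case (BotE \<Gamma> \<phi>)
  from BotE.IH[OF BotE.prems] show ?case by (rule provable.BotE)
next
  case (AndI \<Gamma> \<phi> \<psi>)
  then show ?case by (simp add: provable.AndI)
next
  case (AndE1 \<Gamma> \<phi> \<psi>)
  from AndE1.IH[OF AndE1.prems] show ?case by (rule provable.AndE1)
next
  case (AndE2 \<Gamma> \<phi> \<psi>)
  from AndE2.IH[OF AndE2.prems] show ?case by (rule provable.AndE2)
next
  case (OrI1 \<Gamma> \<phi> \<psi>)
  then show ?case by (simp add: provable.OrI1)
next
  case (OrI2 \<Gamma> \<psi> \<phi>)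
  then show ?case by (simp add: provable.OrI2)
next
  case (OrE \<Gamma> \<phi> \<psi> \<chi>)
  show ?case by (rule provable.OrE[of xi \<Delta> \<phi> \<psi>]; rule OrE.IH) (use OrE.prems in auto)
next
  case (ImpI \<phi> \<Gamma> \<psi>)
  show ?case by (rule provable.ImpI, rule ImpI.IH) (use ImpI.prems in auto)
next
  case (ImpE \<Gamma> \<phi> \<psi>)
  from ImpE.IH[OF ImpE.prems] show ?case by (rule provable.ImpE)
next
  case (AllI \<Gamma> \<phi>)
  show ?case by (rule provable.AllI, rule AllI.IH) (use AllI.prems in auto)
next
  case (AllE \<Gamma> \<phi> t)
  from AllE.IH[OF AllE.prems] show ?case by (rule provable.AllE)
next
  case (ExI \<Gamma> t \<phi>)
  from ExI.IH[OF ExI.prems] show ?case by (rule provable.ExI)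
next
  case (ExE \<Gamma> \<phi> \<psi>)
  show ?case by (rule provable.ExE[of xi \<Delta> \<phi>]; rule ExE.IH) (use ExE.prems in auto)
next
  case (EqI \<Gamma> t)
  show ?case by (rule provable.EqI)
next
  case (EqE \<Gamma> s t \<phi>)
  from EqE.IH[OF EqE.prems] show ?case by (rule provable.EqE)
qed

lemma provable_subst: "provable xi \<Gamma> \<phi> \<Longrightarrow> provable xi (map (subst \<sigma>) \<Gamma>) (subst \<sigma> \<phi>)"
proof (induction arbitrary: \<sigma> rule: provable.induct)
  case (ax \<phi> \<Gamma>)
  then show ?case by (intro provable.ax axiom_subst)
next
  case (hyp \<phi> \<Gamma>)
  then show ?case by (intro provable.hyp) simp
next
  case (BotE \<Gamma> \<phi>)
  from BotE.IH[of \<sigma>] show ?case by (auto intro: provable.BotE)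
next
  case (AndI \<Gamma> \<phi> \<psi>)
  then show ?case by (simp add: provable.AndI)
next
  case (AndE1 \<Gamma> \<phi> \<psi>)
  from AndE1.IH[of \<sigma>] show ?case by (auto intro: provable.AndE1)
next
  case (AndE2 \<Gamma> \<phi> \<psi>)
  from AndE2.IH[of \<sigma>] show ?case by (auto intro: provable.AndE2)
next
  case (OrI1 \<Gamma> \<phi> \<psi>)
  then show ?case by (simp add: provable.OrI1)
next
  case (OrI2 \<Gamma> \<psi> \<phi>)
  then show ?case by (simp add: provable.OrI2)
next
  case (OrE \<Gamma> \<phi> \<psi> \<chi>)
  show ?case
    by (rule provable.OrE[of xi _ "subst \<sigma> \<phi>" "subst \<sigma> \<psi>"]) (use OrE.IH[of \<sigma>] in simp_all)
next
  case (ImpI \<phi> \<Gamma> \<psi>)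
  from ImpI.IH[of \<sigma>] show ?case by (simp add: provable.ImpI)
next
  case (ImpE \<Gamma> \<phi> \<psi>)
  from ImpE.IH[of \<sigma>] show ?case by (auto intro: provable.ImpE)
next
  case (AllI \<Gamma> \<phi>)
  from AllI.IH[of "under \<sigma>"] show ?case by (auto intro!: provable.AllI simp: comp_def)
next
  case (AllE \<Gamma> \<phi> t)
  from AllE.IH[of \<sigma>] show ?case unfolding subst_inst subst.simps by (rule provable.AllE)
next
  case (ExI \<Gamma> t \<phi>)
  from ExI.IH[of \<sigma>] show ?case unfolding subst_inst subst.simps by (rule provable.ExI)
next
  case (ExE \<Gamma> \<phi> \<psi>)
  show ?case
    by (rule provable.ExE[of xi _ "subst (under \<sigma>) \<phi>"])
      (use ExE.IH(1)[of \<sigma>] ExE.IH(2)[of "under \<sigma>"] in \<open>simp_all add: comp_def\<close>)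
next
  case (EqI \<Gamma> t)
  show ?case by (simp add: provable.EqI)
next
  case (EqE \<Gamma> s t \<phi>)
  from EqE.IH[of \<sigma>] show ?case unfolding subst_inst subst.simps by (rule provable.EqE)
qed

text \<open>Substituting \<open>Var 0\<close> for the fresh variable \<open>x\<close> and lifting all others turns an instance
  at \<open>x\<close> back into the body of the quantifier.\<close>

lemma subst_abstract_inst:
  assumes "x \<notin> fv (All \<phi>)"
  shows "subst (\<lambda>i. if i = x then Var 0 else Var (Suc i)) (inst 0 (Var x) \<phi>) = \<phi>"
proof -
  have "subst (\<lambda>i. if i = x then Var 0 else Var (Suc i)) (inst 0 (Var x) \<phi>) = subst Var \<phi>"
    unfolding inst_def subst_subst
    by (rule subst_cong) (use assms in \<open>auto split: nat.split\<close>)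
  then show ?thesis by simp
qed

lemma subst_abstract_fresh:
  "x \<notin> fv \<phi> \<Longrightarrow> subst (\<lambda>i. if i = x then Var 0 else Var (Suc i)) \<phi> = lift \<phi>"
  by (rule subst_cong) auto

text \<open>The calculus knows eigenvariables only as the index 0 over a lifted context. The nodes
  below use free variables as witnesses, which calls for the rule with an arbitrary fresh
  variable.\<close>

lemma provable_AllI_fresh:
  assumes "provable xi \<Gamma> (inst 0 (Var x) \<phi>)" and "x \<notin> fv (All \<phi>)" and "\<And>\<gamma>. \<gamma> \<in> set \<Gamma> \<Longrightarrow> x \<notin> fv \<gamma>"
  shows "provable xi \<Gamma> (All \<phi>)"
proof (rule provable.AllI)
  have "map (subst (\<lambda>i. if i = x then Var 0 else Var (Suc i))) \<Gamma> = map lift \<Gamma>"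
    using assms(3) by (intro map_cong refl subst_abstract_fresh) auto
  then show "provable xi (map lift \<Gamma>) \<phi>"
    using provable_subst[OF assms(1), of "\<lambda>i. if i = x then Var 0 else Var (Suc i)"]
    unfolding subst_abstract_inst[OF assms(2)] by (simp only:)
qed

lemma provable_ExE_fresh:
  assumes "provable xi (inst 0 (Var x) \<phi> # \<Gamma>) \<chi>" and "x \<notin> fv (All \<phi>)" and "x \<notin> fv \<chi>"
    and "\<And>\<gamma>. \<gamma> \<in> set \<Gamma> \<Longrightarrow> x \<notin> fv \<gamma>"
  shows "provable xi (Ex \<phi> # \<Gamma>) \<chi>"
proof (rule provable.ExE)
  show "provable xi (Ex \<phi> # \<Gamma>) (Ex \<phi>)" by (simp add: provable.hyp)
  have "map (subst (\<lambda>i. if i = x then Var 0 else Var (Suc i))) \<Gamma> = map lift \<Gamma>"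
    using assms(4) by (intro map_cong refl subst_abstract_fresh) auto
  then have "provable xi (\<phi> # map lift \<Gamma>) (lift \<chi>)"
    using provable_subst[OF assms(1), of "\<lambda>i. if i = x then Var 0 else Var (Suc i)"]
    unfolding list.map subst_abstract_inst[OF assms(2)] subst_abstract_fresh[OF assms(3)] by (simp only:)
  then show "provable xi (\<phi> # map lift (Ex \<phi> # \<Gamma>)) (lift \<chi>)"
    by (rule provable_weaken) auto
qed


section \<open>Kripke completeness\<close>

text \<open>Gives the enumeration of all formulas along which \<open>prime_extension\<close>
  proceeds.\<close>

instance prsym :: countable by countable_datatype
instance tm :: countable by countable_datatype
instance fm :: countable by countable_datatype

text \<open>The variables are split into infinitely many infinite blocks. A node of level \<open>k\<close> only
  uses the blocks up to \<open>k\<close>, so that its extensions never run out of fresh witnesses.\<close>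

definition block :: "nat \<Rightarrow> nat" where "block i = fst (prod_decode i)"

definition terms_upto :: "nat \<Rightarrow> tm set" where
  "terms_upto k = {t. \<forall>i\<in>tvars t. block i \<le> k}"

definition fms_upto :: "nat \<Rightarrow> fm set" where
  "fms_upto k = {\<phi>. \<forall>i\<in>fv \<phi>. block i \<le> k}"

lemma infinite_block: "infinite {i. block i = k}"
proof
  assume "finite {i. block i = k}"
  moreover have "range (\<lambda>j. prod_encode (k, j)) \<subseteq> {i. block i = k}"
    by (auto simp: block_def)
  moreover have "inj (\<lambda>j. prod_encode (k, j))"
    by (auto intro!: injI simp: inj_eq[OF inj_prod_encode[of UNIV]])
  ultimately show False
    using finite_subset finite_imageD infinite_UNIV_nat by metis
qed

lemma terms_upto_Fn [simp]: "Fn f ts \<in> terms_upto k \<longleftrightarrow> set ts \<subseteq> terms_upto k"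
  by (auto simp: terms_upto_def)

lemma terms_upto_mono: "k \<le> l \<Longrightarrow> terms_upto k \<subseteq> terms_upto l"
  by (fastforce simp: terms_upto_def)

lemma fms_upto_mono: "k \<le> l \<Longrightarrow> fms_upto k \<subseteq> fms_upto l"
  by (fastforce simp: fms_upto_def)

lemma fms_upto_simps [simp]:
  "Bot \<in> fms_upto k"
  "(s \<^bold>= t) \<in> fms_upto k \<longleftrightarrow> s \<in> terms_upto k \<and> t \<in> terms_upto k"
  "Vs t \<in> fms_upto k \<longleftrightarrow> t \<in> terms_upto k"
  "Mn t \<in> fms_upto k \<longleftrightarrow> t \<in> terms_upto k"
  "Tr t \<in> fms_upto k \<longleftrightarrow> t \<in> terms_upto k"
  "(\<phi> \<^bold>\<and> \<psi>) \<in> fms_upto k \<longleftrightarrow> \<phi> \<in> fms_upto k \<and> \<psi> \<in> fms_upto k"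
  "(\<phi> \<^bold>\<or> \<psi>) \<in> fms_upto k \<longleftrightarrow> \<phi> \<in> fms_upto k \<and> \<psi> \<in> fms_upto k"
  "(\<phi> \<^bold>\<longrightarrow> \<psi>) \<in> fms_upto k \<longleftrightarrow> \<phi> \<in> fms_upto k \<and> \<psi> \<in> fms_upto k"
  by (auto simp: fms_upto_def terms_upto_def)

lemma fms_upto_subst: "(\<And>i. \<sigma> i \<in> terms_upto k) \<Longrightarrow> subst \<sigma> \<phi> \<in> fms_upto k"
  by (auto simp: fms_upto_def terms_upto_def fv_subst)

lemma tsubst_terms_upto: "(\<And>i. \<sigma> i \<in> terms_upto k) \<Longrightarrow> tsubst \<sigma> t \<in> terms_upto k"
  by (auto simp: terms_upto_def tvars_tsubst)

lemma fms_upto_inst: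
  "(\<phi>' = All \<phi> \<or> \<phi>' = Ex \<phi>) \<Longrightarrow> \<phi>' \<in> fms_upto k \<Longrightarrow> t \<in> terms_upto k \<Longrightarrow> inst 0 t \<phi> \<in> fms_upto k"
  by (fastforce simp: fms_upto_def terms_upto_def inst_def fv_subst split: nat.splits)

datatype world = World (level: nat) (truths: "fm set")

datatype eq_class = Eq_Class (members: "tm set")

locale vset_system =
  fixes xi :: prsym
begin

section \<open>Derivability from arbitrary sets of formulas\<close>

definition derives :: "fm set \<Rightarrow> fm \<Rightarrow> bool" (infix "\<turnstile>" 20) where
  "(G \<turnstile> \<phi>) \<longleftrightarrow> (\<exists>\<Gamma>. set \<Gamma> \<subseteq> G \<and> provable xi \<Gamma> \<phi>)"

lemma derives_hyp: "\<phi> \<in> G \<Longrightarrow> G \<turnstile> \<phi>"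
  unfolding derives_def by (intro exI[of _ "[\<phi>]"]) (auto intro: provable.hyp)

lemma derives_provable: "provable xi [] \<phi> \<Longrightarrow> G \<turnstile> \<phi>"
  unfolding derives_def by (intro exI[of _ "[]"]) auto

lemma derives_mono: "G \<turnstile> \<phi> \<Longrightarrow> G \<subseteq> H \<Longrightarrow> H \<turnstile> \<phi>"
  unfolding derives_def by blast

lemma derives_insertE:
  assumes "insert \<phi> G \<turnstile> \<psi>"
  obtains \<Gamma> where "set \<Gamma> \<subseteq> G" "provable xi (\<phi> # \<Gamma>) \<psi>"
proof -
  obtain \<Gamma> where \<Gamma>: "set \<Gamma> \<subseteq> insert \<phi> G" "provable xi \<Gamma> \<psi>"
    using assms unfolding derives_def by auto
  show thesis
    by (rule that[of "removeAll \<phi> \<Gamma>"]) (use \<Gamma> in \<open>auto intro: provable_weaken\<close>)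
qed

lemma derives_ImpI: "insert \<phi> G \<turnstile> \<psi> \<Longrightarrow> G \<turnstile> \<phi> \<^bold>\<longrightarrow> \<psi>"
  by (erule derives_insertE) (auto simp: derives_def intro: provable.ImpI)

lemma derives_rule1:
  "G \<turnstile> \<phi> \<Longrightarrow> (\<And>\<Gamma>. provable xi \<Gamma> \<phi> \<Longrightarrow> provable xi \<Gamma> \<chi>) \<Longrightarrow> G \<turnstile> \<chi>"
  unfolding derives_def by blast

text \<open>The two premises come from different finite contexts; appending the lists gives a common
  one.\<close>

lemma derives_rule2:
  assumes "G \<turnstile> \<phi>" "G \<turnstile> \<psi>"
    and "\<And>\<Gamma>. provable xi \<Gamma> \<phi> \<Longrightarrow> provable xi \<Gamma> \<psi> \<Longrightarrow> provable xi \<Gamma> \<chi>"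
  shows "G \<turnstile> \<chi>"
proof -
  obtain \<Gamma> \<Delta> where "set \<Gamma> \<subseteq> G" "provable xi \<Gamma> \<phi>" "set \<Delta> \<subseteq> G" "provable xi \<Delta> \<psi>"
    using assms(1,2) unfolding derives_def by auto
  then have "provable xi (\<Gamma> @ \<Delta>) \<phi>" "provable xi (\<Gamma> @ \<Delta>) \<psi>" "set (\<Gamma> @ \<Delta>) \<subseteq> G"
    by (auto intro: provable_weaken)
  then show ?thesis using assms(3) unfolding derives_def by blast
qed

lemma derives_ImpE: "G \<turnstile> \<phi> \<^bold>\<longrightarrow> \<psi> \<Longrightarrow> G \<turnstile> \<phi> \<Longrightarrow> G \<turnstile> \<psi>"
  by (erule (1) derives_rule2) (rule provable.ImpE)

lemma derives_And: "(G \<turnstile> \<phi> \<^bold>\<and> \<psi>) \<longleftrightarrow> (G \<turnstile> \<phi>) \<and> (G \<turnstile> \<psi>)"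
proof (intro iffI conjI)
  assume conj: "G \<turnstile> \<phi> \<^bold>\<and> \<psi>"
  from conj show "G \<turnstile> \<phi>" by (rule derives_rule1) (rule provable.AndE1)
  from conj show "G \<turnstile> \<psi>" by (rule derives_rule1) (rule provable.AndE2)
next
  assume "(G \<turnstile> \<phi>) \<and> (G \<turnstile> \<psi>)"
  then have "G \<turnstile> \<phi>" "G \<turnstile> \<psi>" by auto
  then show "G \<turnstile> \<phi> \<^bold>\<and> \<psi>" by (rule derives_rule2) (rule provable.AndI)
qed

lemma derives_OrI1: "G \<turnstile> \<phi> \<Longrightarrow> G \<turnstile> \<phi> \<^bold>\<or> \<psi>"
  by (erule derives_rule1) (rule provable.OrI1)

lemma derives_OrI2: "G \<turnstile> \<psi> \<Longrightarrow> G \<turnstile> \<phi> \<^bold>\<or> \<psi>"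
  by (erule derives_rule1) (rule provable.OrI2)

lemma derives_BotE: "G \<turnstile> Bot \<Longrightarrow> G \<turnstile> \<phi>"
  by (erule derives_rule1) (rule provable.BotE)

lemma derives_cut: "G \<turnstile> \<phi> \<Longrightarrow> insert \<phi> G \<turnstile> \<psi> \<Longrightarrow> G \<turnstile> \<psi>"
  using derives_ImpI derives_ImpE by blast

lemma derives_OrE: "G \<turnstile> \<phi> \<^bold>\<or> \<psi> \<Longrightarrow> insert \<phi> G \<turnstile> \<chi> \<Longrightarrow> insert \<psi> G \<turnstile> \<chi> \<Longrightarrow> G \<turnstile> \<chi>"
proof -
  assume or: "G \<turnstile> \<phi> \<^bold>\<or> \<psi>" and "insert \<phi> G \<turnstile> \<chi>" and "insert \<psi> G \<turnstile> \<chi>"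
  then have "G \<turnstile> \<phi> \<^bold>\<longrightarrow> \<chi>" "G \<turnstile> \<psi> \<^bold>\<longrightarrow> \<chi>" by (auto intro: derives_ImpI)
  \<comment> \<open>\<open>derives_rule2\<close> merges just two contexts, so the minor premises are
    packed into one conjunction.\<close>
  then have imps: "G \<turnstile> (\<phi> \<^bold>\<longrightarrow> \<chi>) \<^bold>\<and> (\<psi> \<^bold>\<longrightarrow> \<chi>)" by (simp add: derives_And)
  show "G \<turnstile> \<chi>"
  proof (rule derives_rule2[OF or imps])
    fix \<Gamma>
    assume or: "provable xi \<Gamma> (\<phi> \<^bold>\<or> \<psi>)" and "provable xi \<Gamma> ((\<phi> \<^bold>\<longrightarrow> \<chi>) \<^bold>\<and> (\<psi> \<^bold>\<longrightarrow> \<chi>))"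
    then have "provable xi \<Gamma> (\<phi> \<^bold>\<longrightarrow> \<chi>)" "provable xi \<Gamma> (\<psi> \<^bold>\<longrightarrow> \<chi>)"
      by (blast intro: provable.AndE1 provable.AndE2)+
    then have "provable xi (\<phi> # \<Gamma>) (\<phi> \<^bold>\<longrightarrow> \<chi>)" "provable xi (\<psi> # \<Gamma>) (\<psi> \<^bold>\<longrightarrow> \<chi>)"
      by (auto intro: provable_weaken)
    moreover have "provable xi (\<phi> # \<Gamma>) \<phi>" "provable xi (\<psi> # \<Gamma>) \<psi>" by (auto intro: provable.hyp)
    ultimately have "provable xi (\<phi> # \<Gamma>) \<chi>" "provable xi (\<psi> # \<Gamma>) \<chi>"
      by (blast intro: provable.ImpE)+
    with or show "provable xi \<Gamma> \<chi>" by (rule provable.OrE)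
  qed
qed

lemma derives_ExE_fresh:
  assumes "insert (inst 0 (Var x) \<phi>) G \<turnstile> \<chi>" and "x \<notin> fv (All \<phi>)" and "x \<notin> fv \<chi>"
    and "\<And>\<gamma>. \<gamma> \<in> G \<Longrightarrow> x \<notin> fv \<gamma>"
  shows "insert (Ex \<phi>) G \<turnstile> \<chi>"
proof -
  obtain \<Gamma> where "set \<Gamma> \<subseteq> G" "provable xi (inst 0 (Var x) \<phi> # \<Gamma>) \<chi>"
    using assms(1) by (rule derives_insertE)
  then have "provable xi (Ex \<phi> # \<Gamma>) \<chi>" "set (Ex \<phi> # \<Gamma>) \<subseteq> insert (Ex \<phi>) G"
    using assms(2-4) by (auto intro!: provable_ExE_fresh simp del: fv.simps)
  then show ?thesis unfolding derives_def by blast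
qed

lemma derives_AllI_fresh:
  "G \<turnstile> inst 0 (Var x) \<phi> \<Longrightarrow> x \<notin> fv (All \<phi>) \<Longrightarrow> (\<And>\<gamma>. \<gamma> \<in> G \<Longrightarrow> x \<notin> fv \<gamma>) \<Longrightarrow> G \<turnstile> All \<phi>"
  unfolding derives_def by (meson provable_AllI_fresh subsetD)

text \<open>Consistent prime theories with witnesses, relative to the language of their level:
  closure under derivability and the choice of witnesses both refer only to blocks up to the
  level.\<close>

definition node :: "world \<Rightarrow> bool" where
  "node w \<longleftrightarrow> truths w \<subseteq> fms_upto (level w) \<and> (\<forall>\<phi>\<in>fms_upto (level w). (truths w \<turnstile> \<phi>) \<longrightarrow> \<phi> \<in> truths w) \<and>
     Bot \<notin> truths w \<and>
     (\<forall>\<phi> \<psi>. (\<phi> \<^bold>\<or> \<psi>) \<in> truths w \<longrightarrow> \<phi> \<in> truths w \<or> \<psi> \<in> truths w) \<and>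
     (\<forall>\<phi>. Ex \<phi> \<in> truths w \<longrightarrow> (\<exists>t\<in>terms_upto (level w). inst 0 t \<phi> \<in> truths w))"

text \<open>The construction of Lindenbaum and Henkin: all formulas are taken in turn and added
  unless \<open>\<chi>\<close> would become derivable, an existential one together with a witness
  from block \<open>Suc k\<close>. As \<open>G\<close> stays within the lower blocks, this block is
  entirely free at the start.\<close>

lemma prime_extension:
  assumes G: "G \<subseteq> fms_upto k" and \<chi>: "\<chi> \<in> fms_upto k" and "\<not> (G \<turnstile> \<chi>)"
  obtains H where "node (World (Suc k) H)" "G \<subseteq> H" "\<chi> \<notin> H"
proof -
  \<comment> \<open>The variables of the new block that occur so far. Each step adds only finitely
    many, so a fresh one always remains.\<close>
  define new where "new H = {x. block x = Suc k \<and> (\<exists>\<gamma>\<in>H. x \<in> fv \<gamma>)}" for H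
  let ?P = "\<lambda>(n::nat) H. G \<subseteq> H \<and> H \<subseteq> fms_upto (Suc k) \<and> \<not> (H \<turnstile> \<chi>) \<and> finite (new H)"
  let ?Q = "\<lambda>(n::nat) H H'. H \<subseteq> H' \<and> (\<forall>\<phi>\<in>fms_upto (Suc k). from_nat n = \<phi> \<longrightarrow>
      (insert \<phi> H \<turnstile> \<chi>) \<or> (\<phi> \<in> H' \<and> (\<forall>\<psi>. \<phi> = Ex \<psi> \<longrightarrow> (\<exists>t\<in>terms_upto (Suc k). inst 0 t \<psi> \<in> H'))))"
  have "\<exists>S. \<forall>n. ?P n (S n) \<and> ?Q n (S n) (S (Suc n))"
  proof (rule dependent_nat_choice)
    have "new G = {}" using G by (fastforce simp: fms_upto_def new_def)
    then have "finite (new G)" by (simp only: finite.emptyI)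
    then show "\<exists>H. ?P 0 H"
      using assms fms_upto_mono[of k "Suc k"] by (intro exI[of _ G] conjI) auto
  next
    fix H n
    assume H: "?P n H"
    define \<phi> :: fm where "\<phi> = from_nat n"
    have new_insert: "finite (new (insert \<psi> H'))" if "finite (new H')" for \<psi> H'
    proof -
      have "new (insert \<psi> H') \<subseteq> new H' \<union> fv \<psi>" by (auto simp: new_def)
      then show ?thesis by (rule finite_subset) (rule finite_UnI[OF that finite_fv])
    qed
    show "\<exists>H'. ?P (Suc n) H' \<and> ?Q n H H'"
    proof (cases "\<phi> \<in> fms_upto (Suc k) \<and> \<not> (insert \<phi> H \<turnstile> \<chi>)")
      case False
      then show ?thesis using H by (intro exI[of _ H] conjI) (auto simp: \<phi>_def)
    next
      case True
      show ?thesis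
      proof (cases "\<exists>\<psi>. \<phi> = Ex \<psi>")
        case False
        then show ?thesis using H True new_insert[of H \<phi>]
          by (intro exI[of _ "insert \<phi> H"] conjI) (auto simp: \<phi>_def)
      next
        case ex: True
        then obtain \<psi> where \<psi>: "\<phi> = Ex \<psi>" by blast
        have "finite (new (insert \<phi> H) \<union> fv \<chi>)"
          using H new_insert[of H \<phi>] finite_fv by auto
        then obtain x where x: "block x = Suc k" "x \<notin> new (insert \<phi> H) \<union> fv \<chi>"
          using finite_subset[of "{i. block i = Suc k}"] infinite_block[of "Suc k"] by blast
        then have fresh: "x \<notin> fv (All \<psi>)" "x \<notin> fv \<chi>" "\<And>\<gamma>. \<gamma> \<in> insert \<phi> H \<Longrightarrow> x \<notin> fv \<gamma>"
          using \<psi> by (auto simp: new_def)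
        have x_term: "Var x \<in> terms_upto (Suc k)" using x(1) by (simp add: terms_upto_def)
        let ?H = "insert (inst 0 (Var x) \<psi>) (insert \<phi> H)"
        have "\<not> (?H \<turnstile> \<chi>)"
        proof
          assume "?H \<turnstile> \<chi>"
          then have "insert (Ex \<psi>) (insert \<phi> H) \<turnstile> \<chi>"
            using fresh by (rule derives_ExE_fresh)
          with True \<psi> show False by simp
        qed
        moreover have "inst 0 (Var x) \<psi> \<in> fms_upto (Suc k)"
          using True \<psi> x_term by (auto intro: fms_upto_inst)
        moreover have "finite (new ?H)"
          using H new_insert by blast
        ultimately show ?thesis
          using H True \<psi> x_term by (intro exI[of _ ?H] conjI) (auto simp: \<phi>_def)
      qed
    qed
  qed
  then obtain S where S: "\<forall>n. ?P n (S n) \<and> ?Q n (S n) (S (Suc n))" ..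
  have P: "?P n (S n)" for n using S[THEN spec, of n] by (rule conjunct1)
  then have G_S: "G \<subseteq> S n" and S_lang: "S n \<subseteq> fms_upto (Suc k)" and S_\<chi>: "\<not> (S n \<turnstile> \<chi>)" for n
    by blast+
  have Q: "?Q n (S n) (S (Suc n))" for n using S[THEN spec, of n] by (rule conjunct2)
  define H where "H = (\<Union>n. S n)"
  have mono: "m \<le> n \<Longrightarrow> S m \<subseteq> S n" for m n
    by (rule lift_Suc_mono_le[of S]) (rule conjunct1[OF Q])
  have H_\<chi>: "\<not> (H \<turnstile> \<chi>)"
  proof
    assume "H \<turnstile> \<chi>"
    then obtain \<Gamma> where \<Gamma>: "set \<Gamma> \<subseteq> H" "provable xi \<Gamma> \<chi>" unfolding derives_def by auto
    have "\<exists>n. set \<Gamma> \<subseteq> S n"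
      using \<Gamma>(1)
    proof (induction \<Gamma>)
      case (Cons \<gamma> \<Gamma>)
      then obtain m n where "\<gamma> \<in> S m" "set \<Gamma> \<subseteq> S n" by (auto simp: H_def)
      then have "set (\<gamma> # \<Gamma>) \<subseteq> S (max m n)"
        using mono[of m "max m n"] mono[of n "max m n"] by auto
      then show ?case by blast
    qed simp
    then show False using \<Gamma>(2) S_\<chi> unfolding derives_def by blast
  qed
  have dichotomy: "(insert \<phi> H \<turnstile> \<chi>) \<or>
      (\<phi> \<in> H \<and> (\<forall>\<psi>. \<phi> = Ex \<psi> \<longrightarrow> (\<exists>t\<in>terms_upto (Suc k). inst 0 t \<psi> \<in> H)))"
    if \<phi>: "\<phi> \<in> fms_upto (Suc k)" for \<phi>
  proof -
    have "from_nat (to_nat \<phi>) = \<phi>" by simp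
    then consider "insert \<phi> (S (to_nat \<phi>)) \<turnstile> \<chi>" | "\<phi> \<in> S (Suc (to_nat \<phi>))"
        "\<forall>\<psi>. \<phi> = Ex \<psi> \<longrightarrow> (\<exists>t\<in>terms_upto (Suc k). inst 0 t \<psi> \<in> S (Suc (to_nat \<phi>)))"
      using conjunct2[OF Q[of "to_nat \<phi>"], THEN bspec, OF \<phi>] by blast
    then show ?thesis
    proof cases
      case 1
      then have "insert \<phi> H \<turnstile> \<chi>" by (rule derives_mono) (auto simp: H_def)
      then show ?thesis ..
    next
      case 2
      moreover have "S (Suc (to_nat \<phi>)) \<subseteq> H" by (auto simp: H_def)
      ultimately show ?thesis by blast
    qed
  qed
  have in_H: "\<phi> \<in> H" if "\<phi> \<in> fms_upto (Suc k)" "\<not> (insert \<phi> H \<turnstile> \<chi>)" for \<phi>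
    using dichotomy that by blast
  have H_lang: "H \<subseteq> fms_upto (Suc k)" using S_lang by (auto simp: H_def)
  have closed: "\<phi> \<in> H" if "\<phi> \<in> fms_upto (Suc k)" "H \<turnstile> \<phi>" for \<phi>
    using that in_H H_\<chi> derives_cut by blast
  have "node (World (Suc k) H)"
    unfolding node_def world.sel
  proof (intro conjI allI ballI impI)
    show "Bot \<notin> H"
      using H_\<chi> derives_hyp derives_BotE by blast
    show "\<phi> \<in> H \<or> \<psi> \<in> H" if "(\<phi> \<^bold>\<or> \<psi>) \<in> H" for \<phi> \<psi>
    proof (rule ccontr)
      assume "\<not> (\<phi> \<in> H \<or> \<psi> \<in> H)"
      moreover have "\<phi> \<in> fms_upto (Suc k)" "\<psi> \<in> fms_upto (Suc k)"
        using that H_lang by auto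
      \<comment> \<open>Neither disjunct was added, hence each of them yields \<open>\<chi>\<close>,
        and so would their disjunction, which is in \<open>H\<close>.\<close>
      ultimately have "insert \<phi> H \<turnstile> \<chi>" "insert \<psi> H \<turnstile> \<chi>" using in_H by auto
      then show False using derives_OrE[OF derives_hyp[OF that]] H_\<chi> by blast
    qed
    show "\<exists>t\<in>terms_upto (Suc k). inst 0 t \<phi> \<in> H" if "Ex \<phi> \<in> H" for \<phi>
    proof -
      have "\<not> (insert (Ex \<phi>) H \<turnstile> \<chi>)" using that H_\<chi> by (simp add: insert_absorb)
      then show ?thesis using dichotomy[of "Ex \<phi>"] that H_lang by blast
    qed
  qed (use H_lang closed in auto)
  moreover have "G \<subseteq> H" using G_S by (auto simp: H_def)
  moreover have "\<chi> \<notin> H" using H_\<chi> derives_hyp by blast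
  ultimately show thesis by (rule that)
qed

section \<open>The canonical Kripke model\<close>

definition D :: "world \<Rightarrow> tm set" where "D w = terms_upto (level w)"

text \<open>The accessibility relation. Levels must not decrease, because the domain of a node
  depends on its level alone.\<close>

definition future :: "world \<Rightarrow> world set" where
  "future w = {v. node v \<and> level w \<le> level v \<and> truths w \<subseteq> truths v}"

text \<open>Atoms hold if they are derivable, not if they are members, so the laws of equality also
  hold for terms outside the language of the node.\<close>

primrec forces :: "world \<Rightarrow> (nat \<Rightarrow> tm) \<Rightarrow> fm \<Rightarrow> bool" where
  "forces w \<sigma> Bot \<longleftrightarrow> False"
| "forces w \<sigma> (s \<^bold>= t) \<longleftrightarrow> (truths w \<turnstile> tsubst \<sigma> s \<^bold>= tsubst \<sigma> t)"
| "forces w \<sigma> (Vs t) \<longleftrightarrow> (truths w \<turnstile> Vs (tsubst \<sigma> t))"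
| "forces w \<sigma> (Mn t) \<longleftrightarrow> (truths w \<turnstile> Mn (tsubst \<sigma> t))"
| "forces w \<sigma> (Tr t) \<longleftrightarrow> (truths w \<turnstile> Tr (tsubst \<sigma> t))"
| "forces w \<sigma> (\<phi> \<^bold>\<and> \<psi>) \<longleftrightarrow> forces w \<sigma> \<phi> \<and> forces w \<sigma> \<psi>"
| "forces w \<sigma> (\<phi> \<^bold>\<or> \<psi>) \<longleftrightarrow> forces w \<sigma> \<phi> \<or> forces w \<sigma> \<psi>"
| "forces w \<sigma> (\<phi> \<^bold>\<longrightarrow> \<psi>) \<longleftrightarrow> (\<forall>v\<in>future w. forces v \<sigma> \<phi> \<longrightarrow> forces v \<sigma> \<psi>)"
| "forces w \<sigma> (All \<phi>) \<longleftrightarrow> (\<forall>v\<in>future w. \<forall>t\<in>D v. forces v (case_nat t \<sigma>) \<phi>)"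
| "forces w \<sigma> (Ex \<phi>) \<longleftrightarrow> (\<exists>t\<in>D w. forces w (case_nat t \<sigma>) \<phi>)"

lemma future_refl: "node w \<Longrightarrow> w \<in> future w"
  and future_trans: "v \<in> future w \<Longrightarrow> u \<in> future v \<Longrightarrow> u \<in> future w"
  and future_node: "v \<in> future w \<Longrightarrow> node v"
  by (auto simp: future_def)

lemma D_future: "v \<in> future w \<Longrightarrow> t \<in> D w \<Longrightarrow> t \<in> D v"
  using terms_upto_mono by (auto simp: future_def D_def)

lemma D_Fn [simp]: "Fn f ts \<in> D w \<longleftrightarrow> set ts \<subseteq> D w"
  by (simp add: D_def)

lemma D_tsubst: "(\<And>i. \<sigma> i \<in> D w) \<Longrightarrow> tsubst \<sigma> t \<in> D w"
  unfolding D_def by (rule tsubst_terms_upto)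

lemma node_derives: "node w \<Longrightarrow> \<phi> \<in> fms_upto (level w) \<Longrightarrow> (truths w \<turnstile> \<phi>) \<longleftrightarrow> \<phi> \<in> truths w"
  using derives_hyp by (auto simp: node_def)

text \<open>Only an underivable implication or universal statement requires a new node.
  \<open>prime_extension\<close> supplies it, one level up for an implication and two levels up for
  a universal statement, whose counterexample is a variable from the level in between.\<close>

lemma truth_lemma:
  "node w \<Longrightarrow> (\<And>i. \<sigma> i \<in> D w) \<Longrightarrow> forces w \<sigma> \<phi> \<longleftrightarrow> (truths w \<turnstile> subst \<sigma> \<phi>)"
proof (induction \<phi> arbitrary: w \<sigma>)
  case Bot
  then show ?case using node_derives[of w Bot] by (auto simp: node_def)
next
  case (And \<phi> \<psi>)
  then show ?case by (simp add: derives_And)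
next
  case (Or \<phi> \<psi>)
  have lang: "subst \<sigma> \<chi> \<in> fms_upto (level w)" for \<chi>
    using Or.prems(2) by (simp add: fms_upto_subst D_def)
  have "(truths w \<turnstile> subst \<sigma> (\<phi> \<^bold>\<or> \<psi>)) \<longleftrightarrow> (truths w \<turnstile> subst \<sigma> \<phi>) \<or> (truths w \<turnstile> subst \<sigma> \<psi>)"
  proof
    assume "truths w \<turnstile> subst \<sigma> (\<phi> \<^bold>\<or> \<psi>)"
    then have "(subst \<sigma> \<phi> \<^bold>\<or> subst \<sigma> \<psi>) \<in> truths w"
      using node_derives[OF Or.prems(1) lang[of "\<phi> \<^bold>\<or> \<psi>"]] by simp
    then have "subst \<sigma> \<phi> \<in> truths w \<or> subst \<sigma> \<psi> \<in> truths w"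
      using Or.prems(1) unfolding node_def by blast
    then show "(truths w \<turnstile> subst \<sigma> \<phi>) \<or> (truths w \<turnstile> subst \<sigma> \<psi>)" using derives_hyp by blast
  next
    assume "(truths w \<turnstile> subst \<sigma> \<phi>) \<or> (truths w \<turnstile> subst \<sigma> \<psi>)"
    then show "truths w \<turnstile> subst \<sigma> (\<phi> \<^bold>\<or> \<psi>)"
      by (auto intro: derives_OrI1 derives_OrI2)
  qed
  then show ?case using Or.IH[OF Or.prems] by simp
next
  case (Imp \<phi> \<psi>)
  have lang: "subst \<sigma> \<chi> \<in> fms_upto (level w)" for \<chi>
    using Imp.prems(2) by (simp add: fms_upto_subst D_def)
  have IH: "forces v \<sigma> \<phi> \<longleftrightarrow> (truths v \<turnstile> subst \<sigma> \<phi>)" "forces v \<sigma> \<psi> \<longleftrightarrow> (truths v \<turnstile> subst \<sigma> \<psi>)"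
    if "v \<in> future w" for v
    using Imp.IH[of v \<sigma>] future_node[OF that] D_future[OF that Imp.prems(2)] by auto
  show ?case
  proof
    assume forces: "forces w \<sigma> (\<phi> \<^bold>\<longrightarrow> \<psi>)"
    show "truths w \<turnstile> subst \<sigma> (\<phi> \<^bold>\<longrightarrow> \<psi>)"
    proof (rule ccontr)
      assume "\<not> (truths w \<turnstile> subst \<sigma> (\<phi> \<^bold>\<longrightarrow> \<psi>))"
      then have "\<not> (insert (subst \<sigma> \<phi>) (truths w) \<turnstile> subst \<sigma> \<psi>)"
        using derives_ImpI by auto
      moreover have "insert (subst \<sigma> \<phi>) (truths w) \<subseteq> fms_upto (level w)"
        using lang Imp.prems(1) by (auto simp: node_def)
      ultimately obtain H where H: "node (World (Suc (level w)) H)" "insert (subst \<sigma> \<phi>) (truths w) \<subseteq> H" "subst \<sigma> \<psi> \<notin> H"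
        using prime_extension lang by metis
      then have v: "(World (Suc (level w)) H) \<in> future w" by (auto simp: future_def)
      have "subst \<sigma> \<psi> \<in> fms_upto (Suc (level w))" using lang fms_upto_mono[of "level w" "Suc (level w)"] by auto
      then have "\<not> (H \<turnstile> subst \<sigma> \<psi>)" using node_derives[OF H(1)] H(3) by simp
      moreover have "H \<turnstile> subst \<sigma> \<phi>" using H(2) by (auto intro: derives_hyp)
      ultimately show False using forces v IH[OF v] by auto
    qed
  next
    assume imp: "truths w \<turnstile> subst \<sigma> (\<phi> \<^bold>\<longrightarrow> \<psi>)"
    show "forces w \<sigma> (\<phi> \<^bold>\<longrightarrow> \<psi>)"
      unfolding forces.simps
    proof (intro ballI impI)
      fix v assume v: "v \<in> future w" and "forces v \<sigma> \<phi>"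
      moreover have "truths v \<turnstile> subst \<sigma> \<phi> \<^bold>\<longrightarrow> subst \<sigma> \<psi>"
        using imp v derives_mono by (auto simp: future_def)
      ultimately show "forces v \<sigma> \<psi>" using IH[OF v] derives_ImpE by blast
    qed
  qed
next
  case (All \<phi>)
  have IH: "forces v (case_nat t \<sigma>) \<phi> \<longleftrightarrow> (truths v \<turnstile> inst 0 t (subst (under \<sigma>) \<phi>))"
    if "v \<in> future w" "t \<in> D v" for v t
    unfolding inst_subst_under
    by (rule All.IH) (use future_node[OF that(1)] D_future[OF that(1) All.prems(2)] that(2) in \<open>auto split: nat.split\<close>)
  show ?case
  proof
    assume forces: "forces w \<sigma> (All \<phi>)"
    show "truths w \<turnstile> subst \<sigma> (All \<phi>)"
    proof (rule ccontr)
      let ?k = "Suc (level w)"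
      assume not: "\<not> (truths w \<turnstile> subst \<sigma> (All \<phi>))"
      obtain x where x: "block x = ?k"
        using infinite_block[of ?k] by (metis (mono_tags, lifting) finite.emptyI empty_Collect_eq)
      have w_lang: "truths w \<subseteq> fms_upto (level w)" using All.prems(1) by (auto simp: node_def)
      have lang: "subst \<sigma> (All \<phi>) \<in> fms_upto (level w)"
        using All.prems(2) by (intro fms_upto_subst) (simp add: D_def)
      let ?\<chi> = "inst 0 (Var x) (subst (under \<sigma>) \<phi>)"
      have fresh: "x \<notin> fv \<gamma>" if "\<gamma> \<in> fms_upto (level w)" for \<gamma>
        using that x by (auto simp: fms_upto_def)
      have "\<not> (truths w \<turnstile> ?\<chi>)"
        using not fresh lang w_lang by (auto dest!: derives_AllI_fresh simp del: fv.simps)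
      moreover have \<chi>: "?\<chi> \<in> fms_upto ?k"
      proof (rule fms_upto_inst)
        show "All (subst (under \<sigma>) \<phi>) \<in> fms_upto ?k"
          using lang fms_upto_mono[of "level w" ?k] by auto
      qed (use x in \<open>auto simp: terms_upto_def\<close>)
      moreover have "truths w \<subseteq> fms_upto ?k" using w_lang fms_upto_mono[of "level w" ?k] by auto
      ultimately obtain H where H: "node (World (Suc ?k) H)" "truths w \<subseteq> H" "?\<chi> \<notin> H"
        using prime_extension by metis
      then have v: "(World (Suc ?k) H) \<in> future w" by (auto simp: future_def)
      have "?\<chi> \<in> fms_upto (Suc ?k)" using \<chi> fms_upto_mono[of ?k "Suc ?k"] by auto
      then have "\<not> (H \<turnstile> ?\<chi>)" using node_derives[OF H(1)] H(3) by simp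
      moreover have "Var x \<in> D (World (Suc ?k) H)" using x by (simp add: D_def terms_upto_def)
      ultimately show False using forces v IH[OF v, of "Var x"] by auto
    qed
  next
    assume all: "truths w \<turnstile> subst \<sigma> (All \<phi>)"
    show "forces w \<sigma> (All \<phi>)"
      unfolding forces.simps
    proof (intro ballI)
      fix v t assume v: "v \<in> future w" and t: "t \<in> D v"
      have "truths v \<turnstile> All (subst (under \<sigma>) \<phi>)"
        using all v derives_mono by (auto simp: future_def)
      then have "truths v \<turnstile> inst 0 t (subst (under \<sigma>) \<phi>)"
        by (rule derives_rule1) (rule provable.AllE)
      then show "forces v (case_nat t \<sigma>) \<phi>" using IH[OF v t] by simp
    qed
  qed
next
  case (Ex \<phi>)
  have IH: "forces w (case_nat t \<sigma>) \<phi> \<longleftrightarrow> (truths w \<turnstile> inst 0 t (subst (under \<sigma>) \<phi>))"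
    if "t \<in> D w" for t
    unfolding inst_subst_under
    by (rule Ex.IH) (use Ex.prems that in \<open>auto split: nat.split\<close>)
  have lang: "subst \<sigma> (Ex \<phi>) \<in> fms_upto (level w)"
    using Ex.prems(2) by (intro fms_upto_subst) (simp add: D_def)
  have "(truths w \<turnstile> subst \<sigma> (Ex \<phi>)) \<longleftrightarrow> (\<exists>t\<in>D w. truths w \<turnstile> inst 0 t (subst (under \<sigma>) \<phi>))"
  proof
    assume "truths w \<turnstile> subst \<sigma> (Ex \<phi>)"
    then have "Ex (subst (under \<sigma>) \<phi>) \<in> truths w"
      using node_derives[OF Ex.prems(1) lang] by simp
    then show "\<exists>t\<in>D w. truths w \<turnstile> inst 0 t (subst (under \<sigma>) \<phi>)"
      using Ex.prems(1) derives_hyp unfolding node_def D_def by blast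
  next
    assume "\<exists>t\<in>D w. truths w \<turnstile> inst 0 t (subst (under \<sigma>) \<phi>)"
    then obtain t where "truths w \<turnstile> inst 0 t (subst (under \<sigma>) \<phi>)" by blast
    then have "truths w \<turnstile> Ex (subst (under \<sigma>) \<phi>)" by (rule derives_rule1) (rule provable.ExI)
    then show "truths w \<turnstile> subst \<sigma> (Ex \<phi>)" by simp
  qed
  then show ?case using IH by auto
qed simp_all

theorem kripke_completeness:
  assumes "\<And>w \<sigma>. node w \<Longrightarrow> (\<And>i. \<sigma> i \<in> D w) \<Longrightarrow> forces w \<sigma> \<phi>"
  shows "provable xi [] \<phi>"
proof (rule ccontr)
  assume "\<not> provable xi [] \<phi>"
  then have "\<not> ({} \<turnstile> \<phi>)" by (auto simp: derives_def)
  moreover define k where "k = Max (insert 0 (block ` fv \<phi>))"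
  have block: "block i \<le> k" if "i \<in> fv \<phi>" for i
    using that finite_fv[of \<phi>] by (auto simp: k_def)
  then have \<phi>: "\<phi> \<in> fms_upto k" by (auto simp: fms_upto_def)
  ultimately obtain H where H: "node (World (Suc k) H)" "\<phi> \<notin> H"
    using prime_extension[of "{}" k \<phi>] by auto
  \<comment> \<open>The identity could leave the domain of the node at variables that do not occur
    in \<open>\<phi>\<close>; the default \<open>zero\<close> there does not affect
    \<open>subst \<sigma> \<phi>\<close>.\<close>
  define \<sigma> where "\<sigma> i = (if i \<in> fv \<phi> then Var i else zero)" for i
  have \<sigma>: "\<sigma> i \<in> D (World (Suc k) H)" for i
    using block[of i] by (auto simp: \<sigma>_def D_def terms_upto_def)
  have "subst \<sigma> \<phi> = subst Var \<phi>" by (intro subst_cong) (simp add: \<sigma>_def)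
  then have "H \<turnstile> \<phi>" using truth_lemma[of "World (Suc k) H" \<sigma> \<phi>] assms[of "World (Suc k) H" \<sigma>] H(1) \<sigma> by simp
  moreover have "\<phi> \<in> fms_upto (Suc k)" using \<phi> fms_upto_mono[of k "Suc k"] by auto
  ultimately show False using node_derives[OF H(1)] H(2) by simp
qed

lemma forces_provable: "provable xi [] \<phi> \<Longrightarrow> node w \<Longrightarrow> (\<And>i. \<sigma> i \<in> D w) \<Longrightarrow> forces w \<sigma> \<phi>"
  using truth_lemma derives_provable provable_subst[of xi "[]" \<phi> \<sigma>] by simp

text \<open>Persistence is inherited from the monotonicity of derivability through the truth lemma,
  without an induction on the formula.\<close>

lemma forces_mono:
  assumes "forces w \<sigma> \<phi>" "v \<in> future w" "node w" "\<And>i. \<sigma> i \<in> D w"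
  shows "forces v \<sigma> \<phi>"
proof -
  have "truths v \<turnstile> subst \<sigma> \<phi>"
    using truth_lemma[OF assms(3,4)] assms(1,2) derives_mono by (auto simp: future_def)
  then show ?thesis using truth_lemma[OF future_node[OF assms(2)]] D_future[OF assms(2,4)] by blast
qed

lemmas forces_All = forces.simps(9)

declare forces_All [simp del]

lemma forces_subst: "forces w \<sigma> (subst \<tau> \<phi>) \<longleftrightarrow> forces w (\<lambda>i. tsubst \<sigma> (\<tau> i)) \<phi>"
proof (induction \<phi> arbitrary: w \<sigma> \<tau>)
  case (All \<phi>)
  have "(\<lambda>i. tsubst (case_nat t \<sigma>) (under \<tau> i)) = case_nat t (\<lambda>i. tsubst \<sigma> (\<tau> i))" for t
    by (auto simp: fun_eq_iff split: nat.split)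
  then show ?case using All by (simp add: forces_All)
next
  case (Ex \<phi>)
  have "(\<lambda>i. tsubst (case_nat t \<sigma>) (under \<tau> i)) = case_nat t (\<lambda>i. tsubst \<sigma> (\<tau> i))" for t
    by (auto simp: fun_eq_iff split: nat.split)
  then show ?case using Ex by simp
qed auto


section \<open>Equality and arithmetic at a node\<close>

lemma derives_eq_subst: "G \<turnstile> s \<^bold>= t \<Longrightarrow> G \<turnstile> inst 0 s \<phi> \<Longrightarrow> G \<turnstile> inst 0 t \<phi>"
  by (erule (1) derives_rule2) (rule provable.EqE)

lemma derives_refl: "G \<turnstile> t \<^bold>= t"
  unfolding derives_def by (intro exI[of _ "[]"]) (auto intro: provable.EqI)

lemma derives_sym: "G \<turnstile> s \<^bold>= t \<Longrightarrow> G \<turnstile> t \<^bold>= s"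
  using derives_eq_subst[of G s t "Var 0 \<^bold>= up s"] derives_refl by (simp add: inst_def)

lemma derives_trans: "G \<turnstile> s \<^bold>= t \<Longrightarrow> G \<turnstile> t \<^bold>= u \<Longrightarrow> G \<turnstile> s \<^bold>= u"
  using derives_eq_subst[of G t u "up s \<^bold>= Var 0"] by (simp add: inst_def)

lemma derives_cong_arg: "G \<turnstile> s \<^bold>= t \<Longrightarrow> G \<turnstile> Fn f (xs @ s # ys) \<^bold>= Fn f (xs @ t # ys)"
  using derives_eq_subst[of G s t "up (Fn f (xs @ s # ys)) \<^bold>= Fn f (map up xs @ Var 0 # map up ys)"]
    derives_refl by (simp add: inst_def comp_def)

lemma derives_cong: "list_all2 (\<lambda>s t. G \<turnstile> s \<^bold>= t) ss ts \<Longrightarrow> G \<turnstile> Fn f ss \<^bold>= Fn f ts"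
proof -
  assume "list_all2 (\<lambda>s t. G \<turnstile> s \<^bold>= t) ss ts"
  then have "G \<turnstile> Fn f (xs @ ss) \<^bold>= Fn f (xs @ ts)" for xs
  proof (induction arbitrary: xs rule: list_all2_induct)
    case Nil
    show ?case by (rule derives_refl)
  next
    case (Cons s ss t ts)
    have "G \<turnstile> Fn f (xs @ s # ss) \<^bold>= Fn f (xs @ t # ss)" using Cons(1) by (rule derives_cong_arg)
    moreover have "G \<turnstile> Fn f ((xs @ [t]) @ ss) \<^bold>= Fn f ((xs @ [t]) @ ts)" by (rule Cons.IH)
    ultimately show ?case using derives_trans by simp
  qed
  from this[of "[]"] show ?thesis by simp
qed

text \<open>Classes of provably equal terms turn equational reasoning at a node into rewriting with
  the equality of HOL.\<close>

definition cls :: "world \<Rightarrow> tm \<Rightarrow> eq_class" where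
  "cls w t = Eq_Class {s. truths w \<turnstile> s \<^bold>= t}"

text \<open>The representatives are arbitrary; \<open>cls_Fn\<close> shows by congruence that their
  choice does not matter.\<close>

definition op :: "world \<Rightarrow> prsym \<Rightarrow> eq_class list \<Rightarrow> eq_class" where
  "op w f as = cls w (Fn f (map (\<lambda>a. SOME t. t \<in> members a) as))"

definition C :: "world \<Rightarrow> eq_class set" where "C w = cls w ` D w"

abbreviation Z :: "world \<Rightarrow> eq_class" where "Z w \<equiv> op w PZero []"
abbreviation S :: "world \<Rightarrow> eq_class \<Rightarrow> eq_class" where "S w a \<equiv> op w PSucc [a]"

lemma cls_eq_iff: "cls w s = cls w t \<longleftrightarrow> (truths w \<turnstile> s \<^bold>= t)"
proof
  assume "cls w s = cls w t"
  then have "{u. truths w \<turnstile> u \<^bold>= s} = {u. truths w \<turnstile> u \<^bold>= t}" by (simp add: cls_def)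
  then show "truths w \<turnstile> s \<^bold>= t" using derives_refl[of "truths w" s] by blast
next
  assume st: "truths w \<turnstile> s \<^bold>= t"
  have "(truths w \<turnstile> u \<^bold>= s) \<longleftrightarrow> (truths w \<turnstile> u \<^bold>= t)" for u
    using derives_trans[OF _ st, of u] derives_trans[OF _ derives_sym[OF st], of u] by blast
  then show "cls w s = cls w t" by (simp add: cls_def)
qed

lemma cls_some: "truths w \<turnstile> (SOME s. s \<in> members (cls w t)) \<^bold>= t"
  using someI_ex[of "\<lambda>s. s \<in> members (cls w t)"] derives_refl by (auto simp: cls_def)

lemma cls_Fn [simp]: "cls w (Fn f ts) = op w f (map (cls w) ts)"
proof -
  have "list_all2 (\<lambda>s t. truths w \<turnstile> s \<^bold>= t) ts (map (\<lambda>a. SOME t. t \<in> members a) (map (cls w) ts))"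
    using derives_sym[OF cls_some] by (simp add: list_all2_conv_all_nth)
  then show ?thesis unfolding op_def cls_eq_iff by (rule derives_cong)
qed

lemma cls_axiom: "HA_axiom (s \<^bold>= t) \<Longrightarrow> cls w s = cls w t"
  unfolding cls_eq_iff by (intro derives_provable provable.ax axiom.HA)

lemma cls_future: "cls w s = cls w t \<Longrightarrow> v \<in> future w \<Longrightarrow> cls v s = cls v t"
  unfolding cls_eq_iff future_def using derives_mono by blast

lemma cls_in_C [simp]: "t \<in> D w \<Longrightarrow> cls w t \<in> C w"
  by (simp add: C_def)

lemma C_listE:
  assumes "set as \<subseteq> C w"
  obtains ts where "as = map (cls w) ts" "set ts \<subseteq> D w"
proof -
  have "\<exists>ts. as = map (cls w) ts \<and> set ts \<subseteq> D w"
    using assms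
  proof (induction as)
    case (Cons a as)
    then obtain t ts where "a = cls w t" "t \<in> D w" "as = map (cls w) ts" "set ts \<subseteq> D w"
      by (auto simp: C_def)
    then show ?case by (intro exI[of _ "t # ts"]) simp
  qed simp
  then show thesis using that by blast
qed

lemma op_in_C [simp]: "op w f as \<in> C w" if "set as \<subseteq> C w"
proof -
  obtain ts where "as = map (cls w) ts" "set ts \<subseteq> D w" using \<open>set as \<subseteq> C w\<close> by (rule C_listE)
  then show ?thesis unfolding C_def by (intro image_eqI[of _ _ "Fn f ts"]) simp_all
qed

lemma op_zero [simp]: "op w PZero (a # as) = Z w" if "set (a # as) \<subseteq> C w"
proof -
  obtain ts where "a # as = map (cls w) ts" using \<open>set (a # as) \<subseteq> C w\<close> by (rule C_listE)
  then show ?thesis using cls_axiom[OF HA_axiom.pr_zero[of ts], of w] by simp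
qed

lemma op_proj [simp]: "op w (PProj i) as = as ! i" if "set as \<subseteq> C w" "i < length as"
proof -
  obtain ts where "as = map (cls w) ts" using \<open>set as \<subseteq> C w\<close> by (rule C_listE)
  then show ?thesis using cls_axiom[OF HA_axiom.pr_proj[of i ts], of w] \<open>i < length as\<close> by simp
qed

lemma op_comp [simp]: "op w (PComp f gs) as = op w f (map (\<lambda>g. op w g as) gs)" if "set as \<subseteq> C w"
proof -
  obtain ts where "as = map (cls w) ts" using \<open>set as \<subseteq> C w\<close> by (rule C_listE)
  then show ?thesis using cls_axiom[OF HA_axiom.pr_comp[of f gs ts], of w] by (simp add: comp_def)
qed

lemma op_rec_zero: "op w (PRec f g) (Z w # as) = op w f as" if "set as \<subseteq> C w"
proof -
  obtain ts where "as = map (cls w) ts" using \<open>set as \<subseteq> C w\<close> by (rule C_listE)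
  then show ?thesis using cls_axiom[OF HA_axiom.pr_rec_zero[of f g ts], of w] by simp
qed

lemma op_rec_suc: "op w (PRec f g) (S w a # as) = op w g (a # op w (PRec f g) (a # as) # as)"
  if "set (a # as) \<subseteq> C w"
proof -
  obtain ts where "a # as = map (cls w) ts" using \<open>set (a # as) \<subseteq> C w\<close> by (rule C_listE)
  then obtain t us where "ts = t # us" "a = cls w t" "as = map (cls w) us" by (cases ts) auto
  then show ?thesis using cls_axiom[OF HA_axiom.pr_rec_suc[of f g t us], of w] by simp
qed

lemma suc_neq_zero [simp]: "node w \<Longrightarrow> a \<in> C w \<Longrightarrow> S w a \<noteq> Z w" "node w \<Longrightarrow> a \<in> C w \<Longrightarrow> Z w \<noteq> S w a"
proof -
  have "S w a \<noteq> Z w" if w: "node w" and a: "a \<in> C w"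
  proof
    assume eq: "S w a = Z w"
    obtain t where "a = cls w t" using a by (auto simp: C_def)
    then have "truths w \<turnstile> suc t \<^bold>= zero" using eq by (simp flip: cls_eq_iff)
    moreover have "truths w \<turnstile> (suc t \<^bold>= zero) \<^bold>\<longrightarrow> Bot"
      by (intro derives_provable provable.ax axiom.HA HA_axiom.suc_neq_zero)
    ultimately have "truths w \<turnstile> Bot" by (metis derives_ImpE)
    then show False using w unfolding node_def by auto
  qed
  then show "node w \<Longrightarrow> a \<in> C w \<Longrightarrow> S w a \<noteq> Z w" "node w \<Longrightarrow> a \<in> C w \<Longrightarrow> Z w \<noteq> S w a" by auto
qed

lemma forces_Eq [simp]: "forces w \<sigma> (s \<^bold>= t) \<longleftrightarrow> cls w (tsubst \<sigma> s) = cls w (tsubst \<sigma> t)"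
  by (simp only: cls_eq_iff forces.simps)

declare forces.simps(2) [simp del]

text \<open>Unfolding gives two nested quantifiers over later nodes. Transitivity merges them in one
  direction, and reflexivity at the outer node gives the other.\<close>

lemma forces_All_Imp [simp]:
  "forces w \<sigma> (All (\<phi> \<^bold>\<longrightarrow> \<psi>)) \<longleftrightarrow>
    (\<forall>v\<in>future w. \<forall>t\<in>D v. forces v (case_nat t \<sigma>) \<phi> \<longrightarrow> forces v (case_nat t \<sigma>) \<psi>)"
proof -
  have "v \<in> future v" if "v \<in> future w" for v using future_refl future_node that by blast
  then show ?thesis
    unfolding forces.simps using future_trans D_future by blast
qed

lemma forces_Iff: "node w \<Longrightarrow> forces w \<sigma> (\<phi> \<^bold>\<longleftrightarrow> \<psi>) \<Longrightarrow> forces w \<sigma> \<phi> \<longleftrightarrow> forces w \<sigma> \<psi>"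
  using future_refl by auto

lemma forces_axiom: "axiom xi \<phi> \<Longrightarrow> node w \<Longrightarrow> (\<And>i. \<sigma> i \<in> D w) \<Longrightarrow> forces w \<sigma> \<phi>"
  by (intro forces_provable provable.ax)

lemma forces_inst: "forces w \<sigma> (inst k t \<phi>) \<longleftrightarrow> forces w (case_nat (tsubst \<sigma> t) (\<lambda>i. \<sigma> (i + k))) \<phi>"
proof -
  have "(\<lambda>i. tsubst \<sigma> (case_nat t (\<lambda>i. Var (i + k)) i)) = case_nat (tsubst \<sigma> t) (\<lambda>i. \<sigma> (i + k))"
    by (auto simp: fun_eq_iff split: nat.split)
  then show ?thesis by (simp add: inst_def forces_subst)
qed

text \<open>Induction of the system applies to formulas only, so each arithmetical law below is
  first phrased as a forced formula, and its step is proved at every later node.\<close>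

lemma forces_induct:
  assumes "node w" "\<And>i. \<sigma> i \<in> D w" "t \<in> D w"
    and "forces w (case_nat zero \<sigma>) \<phi>"
    and "\<And>v t. v \<in> future w \<Longrightarrow> node v \<Longrightarrow> t \<in> D v \<Longrightarrow> forces v (case_nat t \<sigma>) \<phi> \<Longrightarrow>
      forces v (case_nat (suc t) \<sigma>) \<phi>"
  shows "forces w (case_nat t \<sigma>) \<phi>"
proof -
  have "forces w \<sigma> (inst 0 zero \<phi> \<^bold>\<and> All (\<phi> \<^bold>\<longrightarrow> inst 1 (suc (Var 0)) \<phi>) \<^bold>\<longrightarrow> All \<phi>)"
    using assms(1,2) by (intro forces_axiom axiom.HA HA_axiom.induction)
  moreover have "forces w \<sigma> (inst 0 zero \<phi>)"
    using assms(4) by (simp add: forces_inst)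
  moreover have "forces w \<sigma> (All (\<phi> \<^bold>\<longrightarrow> inst 1 (suc (Var 0)) \<phi>))"
    using assms(1,5) future_node by (auto simp: forces_inst)
  moreover have "w \<in> future w" using assms(1) by (rule future_refl)
  ultimately show ?thesis using assms(3) by (auto simp only: forces.simps)
qed

lemma CE: "a \<in> C w \<Longrightarrow> (\<And>t. t \<in> D w \<Longrightarrow> a = cls w t \<Longrightarrow> P) \<Longrightarrow> P"
  by (auto simp: C_def)

section \<open>Arithmetic up to the inversion of Cantor pairing\<close>

lemma op_basic [simp]:
  "op w p_pred [Z w] = Z w"
  "a \<in> C w \<Longrightarrow> op w p_pred [S w a] = a"
  "b \<in> C w \<Longrightarrow> op w p_add [Z w, b] = b"
  "a \<in> C w \<Longrightarrow> b \<in> C w \<Longrightarrow> op w p_add [S w a, b] = S w (op w p_add [a, b])"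
  "a \<in> C w \<Longrightarrow> op w p_monus [a, Z w] = a"
  "a \<in> C w \<Longrightarrow> b \<in> C w \<Longrightarrow> op w p_monus [a, S w b] = op w p_pred [op w p_monus [a, b]]"
  "b \<in> C w \<Longrightarrow> c \<in> C w \<Longrightarrow> op w p_if0 [Z w, b, c] = b"
  "a \<in> C w \<Longrightarrow> b \<in> C w \<Longrightarrow> c \<in> C w \<Longrightarrow> op w p_if0 [S w a, b, c] = c"
  "op w p_triangle [Z w] = Z w"
  "a \<in> C w \<Longrightarrow> op w p_triangle [S w a] = op w p_add [S w a, op w p_triangle [a]]"
  by (simp_all add: p_pred_def p_add_def p_monus_def p_if0_def p_triangle_def op_rec_zero op_rec_suc)

lemma add_zero_right [simp]: "node w \<Longrightarrow> a \<in> C w \<Longrightarrow> op w p_add [a, Z w] = a"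
proof (elim CE)
  fix s assume "node w" "s \<in> D w" and a: "a = cls w s"
  then have "forces w (case_nat s (\<lambda>_. zero)) (Fn p_add [Var 0, zero] \<^bold>= Var 0)"
    by - (rule forces_induct; auto)
  then show ?thesis by (simp add: a)
qed

lemma add_suc_right [simp]:
  "node w \<Longrightarrow> a \<in> C w \<Longrightarrow> b \<in> C w \<Longrightarrow> op w p_add [a, S w b] = S w (op w p_add [a, b])"
proof (elim CE)
  fix s t assume "node w" "s \<in> D w" "t \<in> D w" and ab: "a = cls w s" "b = cls w t"
  then have "forces w (case_nat s (\<lambda>_. t)) (Fn p_add [Var 0, suc (Var 1)] \<^bold>= suc (Fn p_add [Var 0, Var 1]))"
    by - (rule forces_induct; auto simp: D_future)
  then show ?thesis by (simp add: ab)
qed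

lemma add_commute:
  "node w \<Longrightarrow> a \<in> C w \<Longrightarrow> b \<in> C w \<Longrightarrow> op w p_add [a, b] = op w p_add [b, a]"
proof (elim CE)
  fix s t assume "node w" "s \<in> D w" "t \<in> D w" and ab: "a = cls w s" "b = cls w t"
  then have "forces w (case_nat s (\<lambda>_. t)) (Fn p_add [Var 0, Var 1] \<^bold>= Fn p_add [Var 1, Var 0])"
    by - (rule forces_induct; auto simp: D_future)
  then show ?thesis by (simp add: ab)
qed

lemma add_assoc:
  "node w \<Longrightarrow> a \<in> C w \<Longrightarrow> b \<in> C w \<Longrightarrow> c \<in> C w \<Longrightarrow>
    op w p_add [op w p_add [a, b], c] = op w p_add [a, op w p_add [b, c]]"
proof (elim CE)
  fix s t u assume "node w" "s \<in> D w" "t \<in> D w" "u \<in> D w"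
    and abc: "a = cls w s" "b = cls w t" "c = cls w u"
  then have "forces w (case_nat s (case_nat t (\<lambda>_. u)))
      (Fn p_add [Fn p_add [Var 0, Var 1], Var 2] \<^bold>= Fn p_add [Var 0, Fn p_add [Var 1, Var 2]])"
    by - (rule forces_induct; auto simp: D_future eval_nat_numeral split: nat.split)
  then show ?thesis by (simp add: abc eval_nat_numeral)
qed

lemma add_monus [simp]:
  "node w \<Longrightarrow> a \<in> C w \<Longrightarrow> c \<in> C w \<Longrightarrow> op w p_monus [op w p_add [a, c], a] = c"
proof (elim CE)
  fix s t assume w: "node w" and s: "s \<in> D w" "a = cls w s" and t: "t \<in> D w" "c = cls w t"
  \<comment> \<open>The second summand is quantified because the step for \<open>c\<close> uses the
    hypothesis at \<open>suc c\<close>.\<close>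
  have "forces w (case_nat s (\<lambda>_. zero)) (All (Fn p_monus [Fn p_add [Var 1, Var 0], Var 1] \<^bold>= Var 0))"
  proof (rule forces_induct)
    fix v t
    assume v: "node v" and t: "t \<in> D v"
      and IH: "forces v (case_nat t (\<lambda>_. zero)) (All (Fn p_monus [Fn p_add [Var 1, Var 0], Var 1] \<^bold>= Var 0))"
    show "forces v (case_nat (suc t) (\<lambda>_. zero)) (All (Fn p_monus [Fn p_add [Var 1, Var 0], Var 1] \<^bold>= Var 0))"
      unfolding forces_All
    proof (intro ballI)
      fix u c assume u: "u \<in> future v" "c \<in> D u"
      then have "suc c \<in> D u" "t \<in> D u" "node u" using t by (auto simp: D_future intro: future_node)
      then show "forces u (case_nat c (case_nat (suc t) (\<lambda>_. zero))) (Fn p_monus [Fn p_add [Var 1, Var 0], Var 1] \<^bold>= Var 0)"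
        using IH u unfolding forces_All by fastforce
    qed
  qed (use w s in \<open>auto simp: forces_All intro: future_node\<close>)
  then show ?thesis using future_refl[OF w] s t by (auto simp: forces_All)
qed

lemma monus_self [simp]: "node w \<Longrightarrow> a \<in> C w \<Longrightarrow> op w p_monus [a, a] = Z w"
  using add_monus[of w a "Z w"] by simp

lemma op_defined [simp]:
  "a \<in> C w \<Longrightarrow> b \<in> C w \<Longrightarrow> op w p_dist [a, b] = op w p_add [op w p_monus [a, b], op w p_monus [b, a]]"
  "op w p_diag [Z w] = Z w"
  "a \<in> C w \<Longrightarrow> op w p_diag [S w a] = op w p_if0 [op w p_dist [S w a, op w p_triangle [S w (op w p_diag [a])]],
     S w (op w p_diag [a]), op w p_diag [a]]"
  by (simp_all add: p_dist_def p_diag_def op_rec_zero op_rec_suc)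

text \<open>At \<open>z + 1\<close>, \<open>p_diag\<close> advances only if \<open>z + 1\<close> is
  the next triangular number. Here \<open>z\<close> is the triangle of \<open>n\<close> plus
  \<open>a\<close>, and the triangle of \<open>n + 1\<close> exceeds \<open>z + 1\<close> by
  \<open>S w b\<close>; so the tested distance is a successor and the value stays
  \<open>n\<close>.\<close>

lemma diag_triangle_add_step:
  assumes "node w" "a \<in> C w" "b \<in> C w" "n = op w p_add [a, S w b]"
    and "op w p_diag [op w p_add [op w p_triangle [n], a]] = n"
  shows "op w p_diag [op w p_add [op w p_triangle [n], S w a]] = n"
proof -
  let ?t = "op w p_triangle [n]"
  have C: "n \<in> C w" "?t \<in> C w" using assms(1-4) by simp_all
  have "op w p_add [n, t] = op w p_add [op w p_add [t, a], S w b]" if "t \<in> C w" for t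
    using assms(1-3) that by (simp add: assms(4) add_assoc[of w t a b] add_commute[of w "op w p_add [a, b]" t])
  from this[OF C(2)] have eq: "op w p_triangle [S w n] = op w p_add [S w (op w p_add [?t, a]), S w b]"
    using assms(1-3) C by simp
  have "op w p_monus [op w p_triangle [S w n], S w (op w p_add [?t, a])] = S w b"
    unfolding eq using assms(1-3) C by (intro add_monus) simp_all
  then show ?thesis using assms(1-3,5) C by (simp del: op_basic(6,10))
qed

lemma diag_triangle_add:
  assumes w: "node w" and n: "n \<in> D w" and "k \<in> D w" "y \<in> D w"
    and diag: "cls w (Fn p_diag [Fn p_triangle [n]]) = cls w n" and sum: "cls w (Fn p_add [k, y]) = cls w n"
  shows "cls w (Fn p_diag [Fn p_add [Fn p_triangle [n], k]]) = cls w n"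
proof -
  \<comment> \<open>That the offset is at most \<open>n\<close> is expressed by a complement. The
    complement is quantified, since going back from \<open>suc t\<close> to \<open>t\<close> turns
    \<open>y\<close> into \<open>suc y\<close>.\<close>
  let ?\<phi> = "All (Fn p_add [Var 1, Var 0] \<^bold>= Var 2 \<^bold>\<longrightarrow> Fn p_diag [Fn p_add [Fn p_triangle [Var 2], Var 1]] \<^bold>= Var 2)"
  have "forces w (case_nat k (\<lambda>_. n)) ?\<phi>"
  proof (rule forces_induct)
    have "cls v (Fn p_diag [Fn p_triangle [n]]) = cls v n" "node v" "n \<in> D v" if "v \<in> future w" for v
      using cls_future[OF diag that] future_node[OF that] D_future[OF that n] .
    then show "forces w (case_nat zero (\<lambda>_. n)) ?\<phi>"
      using w by (auto simp: eval_nat_numeral)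
  next
    fix v t
    assume v: "v \<in> future w" "node v" "t \<in> D v" and IH: "forces v (case_nat t (\<lambda>_. n)) ?\<phi>"
    show "forces v (case_nat (suc t) (\<lambda>_. n)) ?\<phi>"
      unfolding forces_All_Imp
    proof (intro ballI impI)
      fix u y
      assume u: "u \<in> future v" "y \<in> D u"
        and "forces u (case_nat y (case_nat (suc t) (\<lambda>_. n))) (Fn p_add [Var 1, Var 0] \<^bold>= Var 2)"
      moreover have D: "t \<in> D u" "n \<in> D u" "node u"
        using u v n by (auto intro: D_future future_node)
      ultimately have sum: "cls u n = op u p_add [cls u t, S u (cls u y)]"
        by (auto simp: eval_nat_numeral)
      have "suc y \<in> D u" using u by simp
      with IH u D sum have "op u p_diag [op u p_add [op u p_triangle [cls u n], cls u t]] = cls u n"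
        unfolding forces_All_Imp by (fastforce simp: eval_nat_numeral)
      from diag_triangle_add_step[OF D(3) _ _ sum this]
      show "forces u (case_nat y (case_nat (suc t) (\<lambda>_. n)))
          (Fn p_diag [Fn p_add [Fn p_triangle [Var 2], Var 1]] \<^bold>= Var 2)"
        using D u(2) by (simp add: eval_nat_numeral del: op_basic op_defined add_suc_right)
    qed
  qed (use assms in auto)
  with w future_refl[OF w] assms(4) sum show ?thesis
    by (auto simp: eval_nat_numeral)
qed

text \<open>The last position of diagonal \<open>t\<close> is its triangle plus \<open>t\<close>.
  Its successor is the triangle of \<open>t + 1\<close>, where the tested distance vanishes and
  \<open>p_diag\<close> advances.\<close>

lemma diag_triangle: "op w p_diag [op w p_triangle [n]] = n" if w: "node w" and "n \<in> C w"
proof -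
  obtain t where t: "t \<in> D w" "n = cls w t" using \<open>n \<in> C w\<close> by (rule CE)
  have "forces w (case_nat t (\<lambda>_. zero)) (Fn p_diag [Fn p_triangle [Var 0]] \<^bold>= Var 0)"
  proof (rule forces_induct)
    fix v t
    assume v: "node v" "t \<in> D v"
      and IH: "forces v (case_nat t (\<lambda>_. zero)) (Fn p_diag [Fn p_triangle [Var 0]] \<^bold>= Var 0)"
    have "cls v (Fn p_diag [Fn p_add [Fn p_triangle [t], t]]) = cls v t"
      by (rule diag_triangle_add[where y = zero]) (use v IH in auto)
    then have diag: "op v p_diag [op v p_add [op v p_triangle [cls v t], cls v t]] = cls v t" by simp
    have "op v p_triangle [S v (cls v t)] = S v (op v p_add [op v p_triangle [cls v t], cls v t])"
      using v by (simp add: add_commute)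
    then show "forces v (case_nat (suc t) (\<lambda>_. zero)) (Fn p_diag [Fn p_triangle [Var 0]] \<^bold>= Var 0)"
      using v diag by (simp del: op_basic(10))
  qed (use w t in auto)
  then show ?thesis by (simp add: t)
qed

lemma diag_pair: "op w p_diag [op w p_add [op w p_triangle [op w p_add [a, b]], a]] = op w p_add [a, b]"
  if w: "node w" and ab: "a \<in> C w" "b \<in> C w"
proof -
  obtain s t where st: "s \<in> D w" "a = cls w s" "t \<in> D w" "b = cls w t" using ab by (elim CE)
  have "cls w (Fn p_diag [Fn p_add [Fn p_triangle [Fn p_add [s, t]], s]]) = cls w (Fn p_add [s, t])"
    by (rule diag_triangle_add[where y = t]) (use w st diag_triangle in auto)
  then show ?thesis by (simp add: st)
qed

lemma left_pair [simp]: "node w \<Longrightarrow> a \<in> C w \<Longrightarrow> b \<in> C w \<Longrightarrow> op w p_left [op w p_pair [a, b]] = a"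
  by (simp add: p_left_def p_pair_def diag_pair)

lemma right_pair [simp]: "node w \<Longrightarrow> a \<in> C w \<Longrightarrow> b \<in> C w \<Longrightarrow> op w p_right [op w p_pair [a, b]] = b"
  using left_pair[of w a b] by (simp add: p_right_def p_pair_def diag_pair)

text \<open>The final configuration with value \<open>0\<close> is the number zero, so
  \<open>p_if0\<close> can test for it.\<close>

lemma pair_zero_zero: "op w p_pair [Z w, Z w] = Z w"
  by (simp add: p_pair_def)


section \<open>Kleene application at a node\<close>

lemma run_zero: "e \<in> C w \<Longrightarrow> n \<in> C w \<Longrightarrow> op w p_run [Z w, e, n] = op w p_pair [S w (op w p_pair [e, Z w]), n]"
  and run_suc: "x \<in> C w \<Longrightarrow> e \<in> C w \<Longrightarrow> n \<in> C w \<Longrightarrow> op w p_run [S w x, e, n] = op w p_step [op w p_run [x, e, n]]"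
  by (simp_all add: p_run_def op_rec_zero op_rec_suc)

lemma step_final: "op w p_step [op w p_pair [Z w, m]] = op w p_pair [Z w, m]" if "node w" "m \<in> C w"
  using that by (simp add: p_step_def Let_def del: op_defined)

lemma case_nat_in_D: "t \<in> D w \<Longrightarrow> (\<And>i. \<sigma> i \<in> D w) \<Longrightarrow> case_nat t \<sigma> i \<in> D w"
  by (simp split: nat.split)

text \<open>A forced disjunction or existential is settled at the node itself, so the dichotomy
  proved inside the system becomes a case rule of HOL.\<close>

lemma C_cases:
  assumes w: "node w" and "a \<in> C w"
  obtains "a = Z w" | b where "b \<in> C w" "a = S w b"
proof -
  obtain t where t: "t \<in> D w" "a = cls w t" using \<open>a \<in> C w\<close> by (rule CE)
  have "forces w (case_nat t (\<lambda>_. zero)) ((Var 0 \<^bold>= zero) \<^bold>\<or> Ex (Var 1 \<^bold>= suc (Var 0)))"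
    by (rule forces_induct) (use w t in auto)
  then have "cls w t = Z w \<or> (\<exists>b\<in>C w. cls w t = S w b)" by auto
  then show thesis using that t(2) by blast
qed

text \<open>Makes step counts comparable: in \<open>App_unique\<close> the result of the shorter
  computation is carried on to the longer one.\<close>

lemma C_linear:
  assumes w: "node w" and "a \<in> C w" "b \<in> C w"
  obtains d where "d \<in> C w" "b = op w p_add [d, a]" | d where "d \<in> C w" "a = op w p_add [d, b]"
proof -
  obtain s t where st: "s \<in> D w" "a = cls w s" "t \<in> D w" "b = cls w t" using assms(2,3) by (elim CE)
  let ?\<phi> = "Ex (Var 2 \<^bold>= Fn p_add [Var 0, Var 1]) \<^bold>\<or> Ex (Var 1 \<^bold>= Fn p_add [Var 0, Var 2])"
  have "forces w (case_nat s (\<lambda>_. t)) ?\<phi>"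
  proof (rule forces_induct)
    show "forces w (case_nat zero (\<lambda>_. t)) ?\<phi>"
      using w st by (auto simp: eval_nat_numeral)
  next
    fix v s
    assume v: "v \<in> future w" "node v" "s \<in> D v" and IH: "forces v (case_nat s (\<lambda>_. t)) ?\<phi>"
    have t: "t \<in> D v" using v st D_future by blast
    consider d where "d \<in> D v" "cls v t = op v p_add [cls v d, cls v s]"
      | d where "d \<in> D v" "cls v s = op v p_add [cls v d, cls v t]"
      using IH by (auto simp: eval_nat_numeral)
    then show "forces v (case_nat (suc s) (\<lambda>_. t)) ?\<phi>"
    proof cases
      case 1
      have "cls v d \<in> C v" using 1(1) by simp
      with v(2) show ?thesis
      proof (cases rule: C_cases)
        case 1
        then have "cls v (suc s) = cls v (Fn p_add [suc zero, t])" using \<open>cls v t = _\<close> v t by simp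
        then have "\<exists>d\<in>D v. cls v (suc s) = cls v (Fn p_add [d, t])" by (intro bexI[of _ "suc zero"]) auto
        then show ?thesis by (simp add: eval_nat_numeral)
      next
        case (2 b)
        then obtain u where u: "u \<in> D v" "b = cls v u" using CE by blast
        then have "cls v t = cls v (Fn p_add [u, suc s])" using \<open>cls v t = _\<close> 2 v by simp
        then have "\<exists>d\<in>D v. cls v t = cls v (Fn p_add [d, suc s])" using u by blast
        then show ?thesis by (simp add: eval_nat_numeral)
      qed
    next
      case 2
      then have "cls v (suc s) = cls v (Fn p_add [suc d, t])" using v t by simp
      then have "\<exists>d\<in>D v. cls v (suc s) = cls v (Fn p_add [d, t])"
        using 2(1) by (intro bexI[of _ "suc d"]) auto
      then show ?thesis by (simp add: eval_nat_numeral)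
    qed
  qed (use w st in auto)
  then have "(\<exists>d\<in>C w. b = op w p_add [d, a]) \<or> (\<exists>d\<in>C w. a = op w p_add [d, b])"
    using st by (auto simp: eval_nat_numeral)
  then show thesis using that by blast
qed

definition App :: "world \<Rightarrow> tm \<Rightarrow> tm \<Rightarrow> tm \<Rightarrow> bool" where
  "App w e n m \<longleftrightarrow> (\<exists>x\<in>C w. op w p_run [x, cls w e, cls w n] = op w p_pair [Z w, cls w m])"

lemma forces_app [simp]:
  "forces w \<sigma> (app e n m) \<longleftrightarrow> App w (tsubst \<sigma> e) (tsubst \<sigma> n) (tsubst \<sigma> m)"
  by (auto simp: app_def App_def C_def)

lemma App_future:
  assumes "App w e n m" "v \<in> future w"
  shows "App v e n m"
proof -
  obtain x where x: "x \<in> D w" "cls w (Fn p_run [x, e, n]) = cls w (pair zero m)"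
    using assms(1) by (auto simp: App_def C_def)
  then show ?thesis
    using cls_future[OF x(2) assms(2)] D_future[OF assms(2) x(1)] by (auto simp: App_def C_def)
qed

text \<open>Final configurations are fixed points of the step function, by
  \<open>step_final\<close>; the induction adds the extra steps one by one.\<close>

lemma op_run_final:
  assumes w: "node w" and "s \<in> D w" "e \<in> D w" "n \<in> D w" "m \<in> D w" and d: "d \<in> C w"
    and run: "op w p_run [cls w s, cls w e, cls w n] = op w p_pair [Z w, cls w m]"
  shows "op w p_run [op w p_add [d, cls w s], cls w e, cls w n] = op w p_pair [Z w, cls w m]"
proof -
  obtain t where t: "t \<in> D w" "d = cls w t" using d by (rule CE)
  have "forces w (case_nat t (case_nat s (case_nat e (case_nat n (\<lambda>_. m)))))
      (Fn p_run [Fn p_add [Var 0, Var 1], Var 2, Var 3] \<^bold>= pair zero (Var 4))"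
  proof (rule forces_induct)
    fix v t
    assume v: "v \<in> future w" "node v" "t \<in> D v" and
      "forces v (case_nat t (case_nat s (case_nat e (case_nat n (\<lambda>_. m)))))
         (Fn p_run [Fn p_add [Var 0, Var 1], Var 2, Var 3] \<^bold>= pair zero (Var 4))"
    moreover have "s \<in> D v" "e \<in> D v" "n \<in> D v" "m \<in> D v" using assms(2-5) D_future[OF v(1)] by auto
    ultimately show "forces v (case_nat (suc t) (case_nat s (case_nat e (case_nat n (\<lambda>_. m)))))
         (Fn p_run [Fn p_add [Var 0, Var 1], Var 2, Var 3] \<^bold>= pair zero (Var 4))"
      by (simp add: eval_nat_numeral run_suc step_final)
  qed (use w assms(2-5) t run in \<open>simp_all add: eval_nat_numeral case_nat_in_D\<close>)
  then show ?thesis by (simp add: t eval_nat_numeral)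
qed

lemma App_unique:
  assumes w: "node w" and D: "e \<in> D w" "n \<in> D w" "m \<in> D w" "m' \<in> D w"
    and "App w e n m" "App w e n m'"
  shows "cls w m = cls w m'"
proof -
  obtain s t where st: "s \<in> D w" "t \<in> D w"
    and run: "op w p_run [cls w s, cls w e, cls w n] = op w p_pair [Z w, cls w m]"
      "op w p_run [cls w t, cls w e, cls w n] = op w p_pair [Z w, cls w m']"
    using assms(6,7) by (auto simp: App_def C_def)
  have "op w p_pair [Z w, cls w m] = op w p_pair [Z w, cls w m']"
  proof (rule C_linear[OF w, of "cls w s" "cls w t"])
    fix d assume "d \<in> C w" "cls w t = op w p_add [d, cls w s]"
    then show ?thesis using op_run_final[OF w st(1) D(1-3) _ run(1), of d] run(2) by simp
  next
    fix d assume "d \<in> C w" "cls w s = op w p_add [d, cls w t]"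
    then show ?thesis using op_run_final[OF w st(2) D(1,2,4) _ run(2), of d] run(1) by simp
  qed (use st in auto)
  then have "op w p_right [op w p_pair [Z w, cls w m]] = op w p_right [op w p_pair [Z w, cls w m']]" by simp
  then show ?thesis using w D by simp
qed

text \<open>Tag 12 is the first one without a case in \<open>p_step\<close>, whose default branch
  leaves the configuration unchanged.\<close>

definition loop :: tm where "loop = pair (Fn (p_num 12) []) zero"

lemma step_loop:
  "node w \<Longrightarrow> r \<in> C w \<Longrightarrow> n \<in> C w \<Longrightarrow>
    op w p_step [op w p_pair [S w (op w p_pair [cls w loop, r]), n]] = op w p_pair [S w (op w p_pair [cls w loop, r]), n]"
  by (simp add: p_step_def Let_def loop_def eval_nat_numeral)

lemma App_loop: "\<not> App w loop n m" if w: "node w" and D: "n \<in> D w" "m \<in> D w"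
proof
  \<comment> \<open>Every stage equals the initial configuration, whose stack is a successor, while
    a final configuration has stack zero.\<close>
  let ?\<phi> = "Fn p_run [Var 0, loop, Var 1] \<^bold>= pair (suc (pair loop zero)) (Var 1)"
  have loop [simp]: "tsubst \<sigma> loop = loop" "loop \<in> D v" for \<sigma> v
    by (simp_all add: loop_def)
  assume "App w loop n m"
  then obtain t where t: "t \<in> D w" "op w p_run [cls w t, cls w loop, cls w n] = op w p_pair [Z w, cls w m]"
    by (auto simp: App_def C_def)
  have "forces w (case_nat t (\<lambda>_. n)) ?\<phi>"
  proof (rule forces_induct)
    fix v t
    assume v: "v \<in> future w" "node v" "t \<in> D v" and IH: "forces v (case_nat t (\<lambda>_. n)) ?\<phi>"
    have "n \<in> D v" using D v D_future by blast
    then show "forces v (case_nat (suc t) (\<lambda>_. n)) ?\<phi>"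
      using v IH by (simp add: run_suc step_loop)
  qed (use w t D in \<open>simp_all add: run_zero\<close>)
  then have "op w p_pair [S w (op w p_pair [cls w loop, Z w]), cls w n] = op w p_pair [Z w, cls w m]"
    using t by simp
  then have "op w p_left [op w p_pair [S w (op w p_pair [cls w loop, Z w]), cls w n]]
      = op w p_left [op w p_pair [Z w, cls w m]]" by simp
  then show False using w D by simp
qed

section \<open>Atoms, elements, induction on v-sets and ECT at a node\<close>

abbreviation V :: "world \<Rightarrow> tm \<Rightarrow> bool" where "V w t \<equiv> truths w \<turnstile> Vs t"
abbreviation M :: "world \<Rightarrow> tm \<Rightarrow> bool" where "M w t \<equiv> truths w \<turnstile> Mn t"
abbreviation T :: "world \<Rightarrow> tm \<Rightarrow> bool" where "T w t \<equiv> truths w \<turnstile> Tr t"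

lemma atom_cong:
  assumes "cls w s = cls w t"
  shows "V w s \<longleftrightarrow> V w t" "M w s \<longleftrightarrow> M w t" "T w s \<longleftrightarrow> T w t"
proof -
  have st: "truths w \<turnstile> s \<^bold>= t" "truths w \<turnstile> t \<^bold>= s" using assms by (simp_all flip: cls_eq_iff)
  have "(truths w \<turnstile> inst 0 s \<phi>) \<longleftrightarrow> (truths w \<turnstile> inst 0 t \<phi>)" for \<phi>
    using derives_eq_subst[OF st(1)] derives_eq_subst[OF st(2)] by blast
  from this[of "Vs (Var 0)"] this[of "Mn (Var 0)"] this[of "Tr (Var 0)"]
  show "V w s \<longleftrightarrow> V w t" "M w s \<longleftrightarrow> M w t" "T w s \<longleftrightarrow> T w t" by (simp_all add: inst_def)
qed

lemma atom_future:
  assumes "v \<in> future w"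
  shows "V w t \<Longrightarrow> V v t" "M w t \<Longrightarrow> M v t" "T w t \<Longrightarrow> T v t"
  using assms derives_mono by (auto simp: future_def)

lemma forces_cong:
  assumes "cls w s = cls w t" "node w" "\<And>i. \<sigma> i \<in> D w" "s \<in> D w" "t \<in> D w"
    and "forces w (case_nat s \<sigma>) \<phi>"
  shows "forces w (case_nat t \<sigma>) \<phi>"
proof -
  have s: "forces w (case_nat s \<sigma>) \<phi> \<longleftrightarrow> (truths w \<turnstile> subst (case_nat s \<sigma>) \<phi>)"
    by (rule truth_lemma) (use assms(2-4) in \<open>auto intro: case_nat_in_D\<close>)
  have t: "forces w (case_nat t \<sigma>) \<phi> \<longleftrightarrow> (truths w \<turnstile> subst (case_nat t \<sigma>) \<phi>)"
    by (rule truth_lemma) (use assms(2,3,5) in \<open>auto intro: case_nat_in_D\<close>)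
  have "truths w \<turnstile> s \<^bold>= t" using assms(1) by (simp only: cls_eq_iff)
  then show ?thesis
    using assms(6) derives_eq_subst[of "truths w" s t "subst (under \<sigma>) \<phi>"]
    unfolding s t inst_subst_under by blast
qed

lemma App_cong: "App w e n m \<Longrightarrow> cls w e = cls w e' \<Longrightarrow> cls w n = cls w n' \<Longrightarrow> cls w m = cls w m' \<Longrightarrow> App w e' n' m'"
  by (simp add: App_def)

lemma forces_appl [simp]:
  "forces w \<sigma> (appl e n \<phi>) \<longleftrightarrow>
    (\<exists>m\<in>D w. App w (tsubst \<sigma> e) (tsubst \<sigma> n) m \<and> forces w (case_nat m \<sigma>) \<phi>)"
  by (simp add: appl_def)

lemma forces_dfd [simp]:
  "forces w \<sigma> (dfd e n) \<longleftrightarrow> (\<exists>m\<in>D w. App w (tsubst \<sigma> e) (tsubst \<sigma> n) m)"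
  by (simp add: dfd_def)

definition EL :: "world \<Rightarrow> tm \<Rightarrow> tm \<Rightarrow> bool" where
  "EL w a x \<longleftrightarrow> (\<exists>n\<in>D w. \<exists>m\<in>D w. App w x n m \<and> T w (right m) \<and> cls w a = cls w (left m))"

lemma forces_in_EL [simp]: "forces w \<sigma> (in_EL a x) \<longleftrightarrow> EL w (tsubst \<sigma> a) (tsubst \<sigma> x)"
  by (simp add: in_EL_def EL_def)

lemma EL_future: "EL w a x \<Longrightarrow> v \<in> future w \<Longrightarrow> EL v a x"
  unfolding EL_def using D_future App_future atom_future(3) cls_future by meson

lemma EL_cong: "EL w a x \<Longrightarrow> cls w a = cls w a' \<Longrightarrow> cls w x = cls w x' \<Longrightarrow> EL w a' x'"
  unfolding EL_def using App_cong by metis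

lemma forces_V_step:
  assumes "node w"
  shows "forces w (case_nat x \<sigma>) (V_step \<phi>) \<longleftrightarrow>
    (\<forall>v\<in>future w. \<forall>n\<in>D v. \<exists>m\<in>D v. App v x n m \<and> M v (right m) \<and>
      (\<forall>u\<in>future v. T u (right m) \<longrightarrow> forces u (case_nat (left m) \<sigma>) \<phi>))"
  by (simp add: V_step_def forces_All forces_inst eval_nat_numeral)

lemma V_intro:
  assumes w: "node w" and x: "x \<in> D w"
    and "\<And>v n. v \<in> future w \<Longrightarrow> node v \<Longrightarrow> n \<in> D v \<Longrightarrow> \<exists>m\<in>D v. App v x n m \<and> M v (right m) \<and>
      (\<forall>u\<in>future v. T u (right m) \<longrightarrow> V u (left m))"
  shows "V w x"
proof -
  have "forces w (\<lambda>_. zero) (All (V_step (Vs (Var 0)) \<^bold>\<longrightarrow> Vs (Var 0)))"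
    using w by (intro forces_axiom axiom.V1) auto
  moreover have "forces w (case_nat x (\<lambda>_. zero)) (V_step (Vs (Var 0)))"
    using assms future_node by (simp add: forces_V_step)
  ultimately show ?thesis using w x future_refl by auto
qed

text \<open>(V2) is phrased through the values of the index \<open>x\<close>, whereas the step is
  wanted for \<open>EL\<close>. Application is single-valued up to \<open>cls\<close>, so the value
  that witnesses membership agrees with the one that \<open>V_step\<close> provides.\<close>

lemma V_induct:
  assumes w: "node w" and \<sigma>: "\<And>i. \<sigma> i \<in> D w" and x: "x \<in> D w" "V w x"
    and step: "\<And>v x. v \<in> future w \<Longrightarrow> node v \<Longrightarrow> x \<in> D v \<Longrightarrow> V v x \<Longrightarrow>
      (\<And>u a. u \<in> future v \<Longrightarrow> node u \<Longrightarrow> a \<in> D u \<Longrightarrow> EL u a x \<Longrightarrow> V u a \<and> forces u (case_nat a \<sigma>) \<phi>) \<Longrightarrow>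
      forces v (case_nat x \<sigma>) \<phi>"
  shows "forces w (case_nat x \<sigma>) \<phi>"
proof -
  \<comment> \<open>Inducting on the conjunction lets the step assume that \<open>x\<close> and its
    elements are v-sets; (V1) gives back the first conjunct.\<close>
  let ?\<psi> = "Vs (Var 0) \<^bold>\<and> \<phi>"
  have "forces w \<sigma> (All (V_step ?\<psi> \<^bold>\<longrightarrow> ?\<psi>) \<^bold>\<longrightarrow> All (Vs (Var 0) \<^bold>\<longrightarrow> ?\<psi>))"
    using w \<sigma> by (intro forces_axiom axiom.V2)
  moreover have "forces w \<sigma> (All (V_step ?\<psi> \<^bold>\<longrightarrow> ?\<psi>))"
    unfolding forces_All_Imp
  proof (intro ballI impI)
    fix v x
    assume v: "v \<in> future w" and x: "x \<in> D v" and "forces v (case_nat x \<sigma>) (V_step ?\<psi>)"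
    then have *: "\<exists>m\<in>D u. App u x n m \<and> M u (right m) \<and>
        (\<forall>t\<in>future u. T t (right m) \<longrightarrow> V t (left m) \<and> forces t (case_nat (left m) \<sigma>) \<phi>)"
      if "u \<in> future v" "n \<in> D u" for u n
      using that future_node[OF v] by (simp add: forces_V_step)
    have V: "V v x"
      using * future_node[OF v] x by (intro V_intro) blast+
    have "forces v (case_nat x \<sigma>) \<phi>"
    proof (rule step)
      fix u a assume u: "u \<in> future v" "node u" and a: "a \<in> D u" and "EL u a x"
      then obtain n m where m: "n \<in> D u" "m \<in> D u" "App u x n m" "T u (right m)" "cls u a = cls u (left m)"
        unfolding EL_def by auto
      obtain m' where m': "m' \<in> D u" "App u x n m'"
        "\<forall>t\<in>future u. T t (right m') \<longrightarrow> V t (left m') \<and> forces t (case_nat (left m') \<sigma>) \<phi>"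
        using *[OF u(1) m(1)] by blast
      have eq: "cls u m = cls u m'"
        using App_unique[OF u(2) _ m(1,2) m'(1) m(3) m'(2)] x u D_future by blast
      then have "T u (right m')" using m(4) atom_cong(3)[of u "right m" "right m'"] by simp
      then have "V u (left m')" "forces u (case_nat (left m') \<sigma>) \<phi>"
        using m'(3) future_refl[OF u(2)] by auto
      moreover have a': "cls u (left m') = cls u a" using m(5) eq by simp
      moreover have "\<sigma> i \<in> D u" for i using \<sigma> v u D_future by blast
      ultimately show "V u a \<and> forces u (case_nat a \<sigma>) \<phi>"
        using atom_cong(1)[OF a'] forces_cong[OF a' u(2) _ _ a] m'(1) by auto
    qed (use v x V future_node in auto)
    then show "forces v (case_nat x \<sigma>) ?\<psi>" using V by simp
  qed
  ultimately show ?thesis using w x future_refl[OF w] by auto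
qed

text \<open>(V1) only builds sets up. The way down is read off from the step of
  \<open>V_induct\<close>, whose induction hypothesis contains \<open>V u a\<close>.\<close>

lemma EL_V: "V w a" if w: "node w" and "x \<in> D w" "V w x" "a \<in> D w" "EL w a x"
proof -
  have "forces w (case_nat x (\<lambda>_. zero)) (All (in_EL (Var 0) (Var 1) \<^bold>\<longrightarrow> Vs (Var 0)))"
  proof (rule V_induct)
    fix v x
    assume v: "v \<in> future w" "node v"
      and "\<And>u a. u \<in> future v \<Longrightarrow> node u \<Longrightarrow> a \<in> D u \<Longrightarrow> EL u a x \<Longrightarrow> V u a \<and>
        forces u (case_nat a (\<lambda>_. zero)) (All (in_EL (Var 0) (Var 1) \<^bold>\<longrightarrow> Vs (Var 0)))"
    then show "forces v (case_nat x (\<lambda>_. zero)) (All (in_EL (Var 0) (Var 1) \<^bold>\<longrightarrow> Vs (Var 0)))"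
      using future_node by simp
  qed (use that in auto)
  then show ?thesis using that future_refl[OF w] by simp
qed

text \<open>ECT for a premise that is a true equation, hence almost negative. The index is found at
  \<open>w\<close> and serves all later nodes.\<close>

lemma ECT_realizer:
  assumes w: "node w" and \<sigma>: "\<And>i. \<sigma> i \<in> D w"
    and total: "\<And>v n. v \<in> future w \<Longrightarrow> node v \<Longrightarrow> n \<in> D v \<Longrightarrow> \<exists>m\<in>D v. forces v (case_nat m (case_nat n \<sigma>)) \<psi>"
  obtains e where "e \<in> D w"
    "\<And>v n. v \<in> future w \<Longrightarrow> n \<in> D v \<Longrightarrow> \<exists>m\<in>D v. App v e n m \<and> forces v (case_nat m (case_nat n \<sigma>)) \<psi>"
proof -
  let ?\<phi> = "zero \<^bold>= zero"
  have env: "(\<lambda>i. tsubst (case_nat m (case_nat n (case_nat e \<sigma>))) (case_nat (Var 0) (case_nat (Var (Suc 0)) (\<lambda>i. Var (i + 3))) i))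
      = case_nat m (case_nat n \<sigma>)" for m n e
    by (auto simp: fun_eq_iff eval_nat_numeral split: nat.split)
  have "almost_negative ?\<phi>" by (intro almost_negative.intros(1) Sigma_1.intros(1)) simp
  then have "forces w \<sigma> (All (?\<phi> \<^bold>\<longrightarrow> Ex \<psi>) \<^bold>\<longrightarrow> Ex (All (inst 2 (Var 0) ?\<phi> \<^bold>\<longrightarrow>
      appl (Var 1) (Var 0) (subst (case_nat (Var 0) (case_nat (Var 1) (\<lambda>i. Var (i + 3)))) \<psi>))))"
    using w \<sigma> by (intro forces_axiom axiom.ECT)
  moreover have "forces w \<sigma> (All (?\<phi> \<^bold>\<longrightarrow> Ex \<psi>))"
    using w total future_node by auto
  ultimately have "forces w \<sigma> (Ex (All (inst 2 (Var 0) ?\<phi> \<^bold>\<longrightarrow>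
      appl (Var 1) (Var 0) (subst (case_nat (Var 0) (case_nat (Var 1) (\<lambda>i. Var (i + 3)))) \<psi>))))"
    using future_refl[OF w] by (simp only: forces.simps)
  then have "\<exists>e\<in>D w. \<forall>v\<in>future w. \<forall>n\<in>D v. \<exists>m\<in>D v. App v e n m \<and> forces v (case_nat m (case_nat n \<sigma>)) \<psi>"
    using w unfolding forces.simps(10)
    by (simp add: inst_def forces_subst env)
  then show thesis using that by blast
qed

lemma term_index:
  assumes w: "node w" and \<sigma>: "\<And>i. \<sigma> i \<in> D w"
  obtains e where "e \<in> D w" "\<And>v n. v \<in> future w \<Longrightarrow> n \<in> D v \<Longrightarrow> App v e n (tsubst (case_nat n \<sigma>) t)"
proof (rule ECT_realizer[OF w \<sigma>, where \<psi> = "Var 0 \<^bold>= up t"])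
  fix v n assume v: "v \<in> future w" and n: "n \<in> D v"
  have "tsubst (case_nat n \<sigma>) t \<in> D v"
    using \<sigma> v n D_future by (intro D_tsubst case_nat_in_D) blast+
  then show "\<exists>m\<in>D v. forces v (case_nat m (case_nat n \<sigma>)) (Var 0 \<^bold>= up t)"
    by (intro bexI[of _ "tsubst (case_nat n \<sigma>) t"]) simp_all
next
  fix e
  assume e: "e \<in> D w" and
    "\<And>v n. v \<in> future w \<Longrightarrow> n \<in> D v \<Longrightarrow> \<exists>m\<in>D v. App v e n m \<and> forces v (case_nat m (case_nat n \<sigma>)) (Var 0 \<^bold>= up t)"
  then have "App v e n (tsubst (case_nat n \<sigma>) t)" if "v \<in> future w" "n \<in> D v" for v n
    using that App_cong[of v e n] by fastforce
  with e show thesis by (rule that)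
qed


section \<open>Conditions and two-element sets\<close>

text \<open>Both premises of (X2) are met in a simple form, with values of \<open>f\<close> and
  \<open>g\<close> Meaningful wherever they are defined; the functions used below have such
  values.\<close>

lemma M_xi:
  assumes w: "node w" and fg: "f \<in> D w" "g \<in> D w"
    and M: "\<And>v n m. v \<in> future w \<Longrightarrow> node v \<Longrightarrow> n \<in> D v \<Longrightarrow> m \<in> D v \<Longrightarrow> App v f n m \<Longrightarrow> M v m"
      "\<And>v n m. v \<in> future w \<Longrightarrow> node v \<Longrightarrow> n \<in> D v \<Longrightarrow> m \<in> D v \<Longrightarrow> App v g n m \<Longrightarrow> M v m"
  shows "M w (Fn xi [f, g])"
proof -
  let ?P = "All (dfd (Var 2) (Var 0) \<^bold>\<longrightarrow> appl (Var 2) (Var 0) (Mn (Var 0))) \<^bold>\<and>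
    All (dfd (Var 2) (Var 0) \<^bold>\<and> dfd (Var 1) (Var 0) \<^bold>\<and> appl (Var 2) (Var 0) (Tr (Var 0)) \<^bold>\<longrightarrow>
      appl (Var 1) (Var 0) (Mn (Var 0)))"
  let ?\<sigma> = "case_nat g (case_nat f (\<lambda>_. zero))"
  have "forces w (\<lambda>_. zero) (All (All (?P \<^bold>\<longrightarrow> Mn (Fn xi [Var 1, Var 0]))))"
    using w by (intro forces_axiom axiom.X2) auto
  then have "forces w (case_nat f (\<lambda>_. zero)) (All (?P \<^bold>\<longrightarrow> Mn (Fn xi [Var 1, Var 0])))"
    unfolding forces_All[of w "\<lambda>_. zero"] using future_refl[OF w] fg by blast
  then have "forces w ?\<sigma> ?P \<longrightarrow> forces w ?\<sigma> (Mn (Fn xi [Var 1, Var 0]))"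
    unfolding forces_All_Imp using future_refl[OF w] fg by blast
  moreover have "forces w ?\<sigma> ?P"
    using w M future_node by (simp add: eval_nat_numeral) blast
  ultimately show ?thesis by simp
qed

lemma T_xi:
  assumes w: "node w" and fg: "f \<in> D w" "g \<in> D w" and M: "M w (Fn xi [f, g])"
  shows "T w (Fn xi [f, g]) \<longleftrightarrow> (\<forall>v\<in>future w. \<forall>n\<in>D v. (\<exists>m\<in>D v. App v f n m \<and> T v m) \<longrightarrow>
    (\<exists>m\<in>D v. App v g n m \<and> T v m))"
proof -
  let ?P = "All (appl (Var 2) (Var 0) (Tr (Var 0)) \<^bold>\<longrightarrow> appl (Var 1) (Var 0) (Tr (Var 0)))"
  let ?Q = "Tr (Fn xi [Var 1, Var 0]) \<^bold>\<longleftrightarrow> ?P"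
  let ?\<sigma> = "case_nat g (case_nat f (\<lambda>_. zero))"
  have "forces w (\<lambda>_. zero) (All (All (Mn (Fn xi [Var 1, Var 0]) \<^bold>\<longrightarrow> ?Q)))"
    using w by (intro forces_axiom axiom.X1) auto
  then have "forces w (case_nat f (\<lambda>_. zero)) (All (Mn (Fn xi [Var 1, Var 0]) \<^bold>\<longrightarrow> ?Q))"
    unfolding forces_All[of w "\<lambda>_. zero"] using future_refl[OF w] fg by blast
  moreover have "forces w ?\<sigma> (Mn (Fn xi [Var 1, Var 0]))" using M by simp
  ultimately have "forces w ?\<sigma> ?Q"
    unfolding forces_All_Imp using future_refl[OF w] fg by blast
  then have "forces w ?\<sigma> (Tr (Fn xi [Var 1, Var 0])) \<longleftrightarrow> forces w ?\<sigma> ?P"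
    using future_refl[OF w] by (auto simp only: forces.simps)
  then show ?thesis using w by (simp add: eval_nat_numeral)
qed

text \<open>As \<open>loop\<close> is nowhere defined, the premises of (X2) hold vacuously, and the
  implication in (X1) is trivial. No condition has to be given beforehand.\<close>

definition verum :: tm where "verum = Fn xi [loop, loop]"

lemma loop_in_D [simp]: "loop \<in> D w" by (simp add: loop_def)

lemma verum: assumes w: "node w" shows "verum \<in> D w" "M w verum" "T w verum"
proof -
  show "verum \<in> D w" by (simp add: verum_def)
  show M: "M w verum" unfolding verum_def by (rule M_xi) (use w App_loop in auto)
  have "(\<forall>v\<in>future w. \<forall>n\<in>D v. (\<exists>m\<in>D v. App v loop n m \<and> T v m) \<longrightarrow> (\<exists>m\<in>D v. App v loop n m \<and> T v m))"
    by blast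
  then show "T w verum" using T_xi[OF w loop_in_D loop_in_D] M unfolding verum_def by blast
qed

text \<open>For \<open>k\<close> the constant function with value \<open>verum\<close>, (X1) turns
  \<open>Fn xi [k, loop]\<close> into the claim that \<open>loop\<close> is defined
  everywhere.\<close>

lemma falsum_exists:
  assumes w: "node w"
  obtains b where "b \<in> D w" "M w b" "\<And>v. v \<in> future w \<Longrightarrow> \<not> T v b"
proof (rule term_index[OF w, where \<sigma> = "\<lambda>_. zero" and t = verum])
  fix k
  assume k: "k \<in> D w" and App: "\<And>v n. v \<in> future w \<Longrightarrow> n \<in> D v \<Longrightarrow> App v k n (tsubst (case_nat n (\<lambda>_. zero)) verum)"
  have verum_k: "App v k n verum" if "v \<in> future w" "n \<in> D v" for v n
    using App[OF that] by (simp add: verum_def loop_def)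
  show thesis
  proof (rule that)
    show "Fn xi [k, loop] \<in> D w" using k by simp
    show M: "M w (Fn xi [k, loop])"
    proof (rule M_xi)
      fix v n m assume v: "v \<in> future w" "node v" "n \<in> D v" "m \<in> D v" "App v k n m"
      then have "cls v verum = cls v m"
        using App_unique[OF v(2) D_future[OF v(1) k] v(3) verum(1)[OF v(2)] v(4) verum_k] by blast
      then show "M v m" using verum(2)[OF v(2)] atom_cong(2) by blast
    qed (use w k App_loop in auto)
    show "\<not> T v (Fn xi [k, loop])" if v: "v \<in> future w" for v
    proof
      assume "T v (Fn xi [k, loop])"
      moreover have "k \<in> D v" "M v (Fn xi [k, loop])" "node v"
        using v D_future k atom_future M future_node by auto
      ultimately have "(\<exists>m\<in>D v. App v k zero m \<and> T v m) \<longrightarrow> (\<exists>m\<in>D v. App v loop zero m \<and> T v m)"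
        using T_xi[of v k loop] future_refl by auto
      moreover have "App v k zero verum" using verum_k v by simp
      ultimately show False using verum[OF \<open>node v\<close>] App_loop[OF \<open>node v\<close>, of zero] by auto
    qed
  qed
qed simp

text \<open>The index returns \<open>pair a p\<close> at zero and \<open>pair b q\<close> at every
  successor, which \<open>p_if0\<close> expresses by a term. An entry counts as an element only if
  its condition is true, so it has to be a v-set only then.\<close>

lemma two_element_set:
  assumes w: "node w" and D: "a \<in> D w" "p \<in> D w" "b \<in> D w" "q \<in> D w"
    and M: "M w p" "M w q"
    and V: "\<And>v. v \<in> future w \<Longrightarrow> T v p \<Longrightarrow> V v a" "\<And>v. v \<in> future w \<Longrightarrow> T v q \<Longrightarrow> V v b"
  obtains x where "x \<in> D w" "V w x"
    "\<And>v z. v \<in> future w \<Longrightarrow> z \<in> D v \<Longrightarrow>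
      EL v z x \<longleftrightarrow> (T v p \<and> cls v z = cls v a) \<or> (T v q \<and> cls v z = cls v b)"
proof (rule term_index[OF w, where \<sigma> = "case_nat a (case_nat p (case_nat b (\<lambda>_. q)))"
      and t = "Fn p_if0 [Var 0, pair (Var 1) (Var 2), pair (Var 3) (Var 4)]"])
  fix x
  assume x: "x \<in> D w" and "\<And>v n. v \<in> future w \<Longrightarrow> n \<in> D v \<Longrightarrow> App v x n
      (tsubst (case_nat n (case_nat a (case_nat p (case_nat b (\<lambda>_. q)))))
        (Fn p_if0 [Var 0, pair (Var 1) (Var 2), pair (Var 3) (Var 4)]))"
  then have App: "App v x n (Fn p_if0 [n, pair a p, pair b q])" if "v \<in> future w" "n \<in> D v" for v n
    using that by (simp add: eval_nat_numeral)
  have Dv: "a \<in> D v" "p \<in> D v" "b \<in> D v" "q \<in> D v" "x \<in> D v" "node v" if "v \<in> future w" for v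
    using D x D_future[OF that] future_node[OF that] by auto
  have App_zero: "App v x n (pair a p)" if v: "v \<in> future w" "n \<in> D v" "cls v n = Z v" for v n
    by (rule App_cong[OF App[OF v(1,2)]]) (use v Dv[OF v(1)] in simp_all)
  have App_suc: "App v x n (pair b q)"
    if v: "v \<in> future w" "n \<in> D v" "cls v n = S v k" "k \<in> C v" for v n k
    by (rule App_cong[OF App[OF v(1,2)]]) (use v Dv[OF v(1)] in simp_all)
  have cases: "App v x n (pair a p) \<or> App v x n (pair b q)" if v: "v \<in> future w" "n \<in> D v" for v n
    using C_cases[of v "cls v n"] App_zero[OF v] App_suc[OF v] Dv[OF v(1)] v(2) by auto
  have ap: "T v (right (pair a p)) \<longleftrightarrow> T v p" "M v (right (pair a p)) \<longleftrightarrow> M v p"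
      "V v (left (pair a p)) \<longleftrightarrow> V v a" "T v (right (pair b q)) \<longleftrightarrow> T v q"
      "M v (right (pair b q)) \<longleftrightarrow> M v q" "V v (left (pair b q)) \<longleftrightarrow> V v b"
    if "v \<in> future w" for v
    by (rule atom_cong; use Dv[OF that] in simp)+
  show thesis
  proof (rule that[OF x])
    show "V w x"
    proof (rule V_intro[OF w x])
      fix v n assume v: "v \<in> future w" "node v" "n \<in> D v"
      have u: "u \<in> future w" if "u \<in> future v" for u using v(1) that by (rule future_trans)
      have Mv: "M v p" "M v q" using M v atom_future by auto
      show "\<exists>m\<in>D v. App v x n m \<and> M v (right m) \<and> (\<forall>u\<in>future v. T u (right m) \<longrightarrow> V u (left m))"
        using cases[OF v(1,3)]
      proof
        assume "App v x n (pair a p)"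
        then show ?thesis using Mv V(1)[OF u] Dv[OF v(1)] ap[OF v(1)] ap[OF u]
          by (intro bexI[of _ "pair a p"]) auto
      next
        assume "App v x n (pair b q)"
        then show ?thesis using Mv V(2)[OF u] Dv[OF v(1)] ap[OF v(1)] ap[OF u]
          by (intro bexI[of _ "pair b q"]) auto
      qed
    qed
  next
    fix v z assume v: "v \<in> future w" and z: "z \<in> D v"
    note Dv = Dv[OF v] and ap = ap[OF v]
    show "EL v z x \<longleftrightarrow> (T v p \<and> cls v z = cls v a) \<or> (T v q \<and> cls v z = cls v b)"
    proof
      assume "EL v z x"
      then obtain n m where nm: "n \<in> D v" "m \<in> D v" "App v x n m" "T v (right m)" "cls v z = cls v (left m)"
        unfolding EL_def by auto
      from cases[OF v nm(1)] show "(T v p \<and> cls v z = cls v a) \<or> (T v q \<and> cls v z = cls v b)"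
      proof
        assume "App v x n (pair a p)"
        then have m: "cls v m = cls v (pair a p)"
          by (intro App_unique[OF Dv(6,5) nm(1,2) _ nm(3)]) (simp_all add: Dv)
        then have "T v (right (pair a p))" using nm(4) atom_cong(3)[of v "right m" "right (pair a p)"] by simp
        then show ?thesis using nm(5) m ap Dv by simp
      next
        assume "App v x n (pair b q)"
        then have m: "cls v m = cls v (pair b q)"
          by (intro App_unique[OF Dv(6,5) nm(1,2) _ nm(3)]) (simp_all add: Dv)
        then have "T v (right (pair b q))" using nm(4) atom_cong(3)[of v "right m" "right (pair b q)"] by simp
        then show ?thesis using nm(5) m ap Dv by simp
      qed
    next
      assume "(T v p \<and> cls v z = cls v a) \<or> (T v q \<and> cls v z = cls v b)"
      then show "EL v z x"
      proof
        assume "T v p \<and> cls v z = cls v a"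
        moreover have "App v x zero (pair a p)" by (rule App_zero) (use v in auto)
        ultimately show ?thesis
          unfolding EL_def using Dv ap by (intro bexI[of _ zero] bexI[of _ "pair a p"]) auto
      next
        assume "T v q \<and> cls v z = cls v b"
        moreover have "App v x (suc zero) (pair b q)" by (rule App_suc[of _ _ "Z v"]) (use v in auto)
        ultimately show ?thesis
          unfolding EL_def using Dv ap by (intro bexI[of _ "suc zero"] bexI[of _ "pair b q"]) auto
      qed
    qed
  qed
qed (use D in \<open>auto intro: case_nat_in_D\<close>)

text \<open>The condition \<open>c\<close> says that no stage of the computation of \<open>e\<close> on \<open>e\<close> is final
  with value \<open>0\<close>. Each stage is decidable, so total functions suffice to express it.\<close>

lemma negated_application_condition:
  assumes w: "node w" and e: "e \<in> D w"
  obtains c where "c \<in> D w" "M w c"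
    "\<And>v. v \<in> future w \<Longrightarrow> T v c \<longleftrightarrow> (\<forall>u\<in>future v. \<not> App u e e zero)"
proof -
  obtain b where b: "b \<in> D w" "M w b" "\<And>v. v \<in> future w \<Longrightarrow> \<not> T v b"
    using falsum_exists[OF w] by blast
  \<comment> \<open>Constantly false, so that (X1) makes \<open>Fn xi [f, g]\<close> say that no
    value of \<open>f\<close> is true.\<close>
  obtain g where g: "g \<in> D w" "\<And>v n. v \<in> future w \<Longrightarrow> n \<in> D v \<Longrightarrow> App v g n (tsubst (case_nat n (\<lambda>_. b)) (Var 1))"
    by (rule term_index[OF w, where \<sigma> = "\<lambda>_. b" and t = "Var 1"]) (use b in auto)
  have g_b: "App v g n b" if "v \<in> future w" "n \<in> D v" for v n using g(2)[OF that] by simp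
  \<comment> \<open>By \<open>pair_zero_zero\<close>, a stage is final with value \<open>0\<close>
    if its configuration is zero. Then \<open>f\<close> returns \<open>verum\<close>, and otherwise
    the false \<open>b\<close>.\<close>
  obtain f where f: "f \<in> D w" "\<And>v n. v \<in> future w \<Longrightarrow> n \<in> D v \<Longrightarrow> App v f n
      (tsubst (case_nat n (case_nat e (\<lambda>_. b))) (Fn p_if0 [Fn p_run [Var 0, Var 1, Var 1], verum, Var 2]))"
    by (rule term_index[OF w, where \<sigma> = "case_nat e (\<lambda>_. b)"
          and t = "Fn p_if0 [Fn p_run [Var 0, Var 1, Var 1], verum, Var 2]"])
      (use b e in \<open>auto intro: case_nat_in_D\<close>)
  have f_if0: "App v f n (Fn p_if0 [Fn p_run [n, e, e], verum, b])" if "v \<in> future w" "n \<in> D v" for v n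
    using f(2)[OF that] by (simp add: eval_nat_numeral verum_def loop_def)
  have Dv: "node v" "e \<in> D v" "b \<in> D v" "f \<in> D v" "g \<in> D v" "verum \<in> D v" "M v verum" "T v verum"
      "M v b" "\<not> T v b" if "v \<in> future w" for v
    using e b f(1) g(1) D_future[OF that] future_node[OF that] verum[of v] atom_future[OF that] b(3)[OF that] by auto
  have f_verum: "App v f n verum" if v: "v \<in> future w" "n \<in> D v" "cls v (Fn p_run [n, e, e]) = Z v" for v n
    by (rule App_cong[OF f_if0[OF v(1,2)]]) (use v Dv[OF v(1)] in simp_all)
  have f_cases: "cls v (Fn p_run [n, e, e]) = Z v \<and> App v f n verum \<or> App v f n b" if v: "v \<in> future w" "n \<in> D v" for v n
  proof -
    have C: "cls v (Fn p_run [n, e, e]) \<in> C v" using v Dv[OF v(1)] by simp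
    from Dv(1)[OF v(1)] C show ?thesis
    proof (cases rule: C_cases)
      case 1
      then show ?thesis using f_verum[OF v] by blast
    next
      case (2 k)
      then have "App v f n b"
        by (intro App_cong[OF f_if0[OF v]]) (use Dv[OF v(1)] in simp_all)
      then show ?thesis ..
    qed
  qed
  let ?c = "Fn xi [f, g]"
  have M: "M w ?c"
  proof (rule M_xi)
    fix v n m assume v: "v \<in> future w" "node v" "n \<in> D v" "m \<in> D v" "App v f n m"
    from f_cases[OF v(1,3)] show "M v m"
    proof
      assume "cls v (Fn p_run [n, e, e]) = Z v \<and> App v f n verum"
      then have "cls v m = cls v verum" using App_unique[OF v(2) _ v(3,4) _ v(5)] Dv[OF v(1)] by blast
      then show ?thesis using atom_cong(2) Dv[OF v(1)] by blast
    next
      assume "App v f n b"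
      then have "cls v m = cls v b" using App_unique[OF v(2) _ v(3,4) _ v(5)] Dv[OF v(1)] by blast
      then show ?thesis using atom_cong(2) Dv[OF v(1)] by blast
    qed
  next
    fix v n m assume v: "v \<in> future w" "node v" "n \<in> D v" "m \<in> D v" "App v g n m"
    then have "cls v m = cls v b" using App_unique[OF v(2) _ v(3,4) _ v(5) g_b] Dv[OF v(1)] by blast
    then show "M v m" using atom_cong(2) Dv[OF v(1)] by blast
  qed (use w f g in auto)
  have no_T_g: "\<not> (App v g n m \<and> T v m)" if v: "v \<in> future w" "n \<in> D v" "m \<in> D v" for v n m
  proof
    assume m: "App v g n m \<and> T v m"
    then have "cls v m = cls v b"
      using App_unique[OF Dv(1)[OF v(1)] _ v(2,3) _ _ g_b[OF v(1,2)]] Dv[OF v(1)] by blast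
    then show False using m atom_cong(3) Dv[OF v(1)] by blast
  qed
  have "T v ?c \<longleftrightarrow> (\<forall>u\<in>future v. \<not> App u e e zero)" if v: "v \<in> future w" for v
  proof -
    have "T v ?c \<longleftrightarrow> (\<forall>u\<in>future v. \<forall>n\<in>D u. (\<exists>m\<in>D u. App u f n m \<and> T u m) \<longrightarrow>
        (\<exists>m\<in>D u. App u g n m \<and> T u m))"
      using Dv[OF v] atom_future(2)[OF v M] by (intro T_xi)
    also have "\<dots> \<longleftrightarrow> (\<forall>u\<in>future v. \<forall>n\<in>D u. \<not> (\<exists>m\<in>D u. App u f n m \<and> T u m))"
      using no_T_g future_trans[OF v] by blast
    also have "\<dots> \<longleftrightarrow> (\<forall>u\<in>future v. \<not> App u e e zero)"
    proof (intro ball_cong refl)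
      fix u assume "u \<in> future v"
      then have u: "u \<in> future w" using v future_trans by blast
      note Du = Dv[OF u]
      show "(\<forall>n\<in>D u. \<not> (\<exists>m\<in>D u. App u f n m \<and> T u m)) \<longleftrightarrow> \<not> App u e e zero"
      proof
        assume none: "\<forall>n\<in>D u. \<not> (\<exists>m\<in>D u. App u f n m \<and> T u m)"
        show "\<not> App u e e zero"
        proof
          assume "App u e e zero"
          then obtain n where "n \<in> D u" "cls u (Fn p_run [n, e, e]) = Z u"
            by (auto simp: App_def C_def pair_zero_zero)
          then show False using none f_verum[OF u] Du by blast
        qed
      next
        assume no: "\<not> App u e e zero"
        show "\<forall>n\<in>D u. \<not> (\<exists>m\<in>D u. App u f n m \<and> T u m)"
        proof (intro ballI notI)
          fix n assume n: "n \<in> D u" and "\<exists>m\<in>D u. App u f n m \<and> T u m"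
          then obtain m where m: "m \<in> D u" "App u f n m" "T u m" by blast
          have "cls u (Fn p_run [n, e, e]) \<noteq> Z u"
          proof
            assume run: "cls u (Fn p_run [n, e, e]) = Z u"
            have "App u e e zero" unfolding App_def
              by (rule bexI[of _ "cls u n"]) (use run n in \<open>simp_all add: pair_zero_zero\<close>)
            then show False using no by contradiction
          qed
          then have "App u f n b" using f_cases[OF u n] by blast
          then have "cls u m = cls u b" using App_unique[OF Du(1,4) n m(1) _ m(2)] Du by blast
          then show False using m(3) atom_cong(3) Du by blast
        qed
      qed
    qed
    finally show ?thesis .
  qed
  moreover have "?c \<in> D w" using f g by simp
  ultimately show thesis using M that by blast
qed

end


section \<open>Extensional equality and Choice\<close>

text \<open>\<open>E\<close> is known only through its provable characterization, so even the
  equivalence laws have to be derived.\<close>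

locale vset_equality = vset_system +
  fixes E :: fm
  assumes extensional: "extensional_equality xi E"
begin

definition EE :: "world \<Rightarrow> tm \<Rightarrow> tm \<Rightarrow> bool" where
  "EE w s t \<longleftrightarrow> forces w (case_nat s (case_nat t (\<lambda>_. zero))) E"

lemma forces_rel [simp]: "forces w \<sigma> (rel E s t) \<longleftrightarrow> EE w (tsubst \<sigma> s) (tsubst \<sigma> t)"
proof -
  have "(\<lambda>i. tsubst \<sigma> (case_nat s (case_nat t (\<lambda>_. zero)) i)) =
      case_nat (tsubst \<sigma> s) (case_nat (tsubst \<sigma> t) (\<lambda>_. zero))"
    by (auto simp: fun_eq_iff split: nat.split)
  then show ?thesis by (simp add: rel_def forces_subst EE_def)
qed

lemma EE_future: "EE w s t \<Longrightarrow> node w \<Longrightarrow> s \<in> D w \<Longrightarrow> t \<in> D w \<Longrightarrow> v \<in> future w \<Longrightarrow> EE v s t"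
  unfolding EE_def by (erule forces_mono) (auto intro!: case_nat_in_D)

lemma EE_cong1: "EE w s t \<Longrightarrow> cls w s = cls w s' \<Longrightarrow> node w \<Longrightarrow> s \<in> D w \<Longrightarrow> s' \<in> D w \<Longrightarrow> t \<in> D w \<Longrightarrow> EE w s' t"
  unfolding EE_def by (rule forces_cong[of w s s']) (auto intro!: case_nat_in_D)

lemma EE_iff:
  assumes w: "node w" and D: "x \<in> D w" "y \<in> D w" and V: "V w x" "V w y"
  shows "EE w x y \<longleftrightarrow>
    (\<forall>v\<in>future w. \<forall>a\<in>D v. EL v a x \<longrightarrow> (\<exists>b\<in>D v. EL v b y \<and> EE v a b)) \<and>
    (\<forall>v\<in>future w. \<forall>b\<in>D v. EL v b y \<longrightarrow> (\<exists>a\<in>D v. EL v a x \<and> EE v b a))"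
proof -
  let ?P = "All (in_EL (Var 0) (Var 2) \<^bold>\<longrightarrow> Ex (in_EL (Var 0) (Var 2) \<^bold>\<and> rel E (Var 1) (Var 0))) \<^bold>\<and>
       All (in_EL (Var 0) (Var 1) \<^bold>\<longrightarrow> Ex (in_EL (Var 0) (Var 3) \<^bold>\<and> rel E (Var 1) (Var 0)))"
  let ?Q = "rel E (Var 1) (Var 0) \<^bold>\<longleftrightarrow> ?P"
  let ?\<sigma> = "case_nat y (case_nat x (\<lambda>_. zero))"
  have "forces w (\<lambda>_. zero) (All (All (Vs (Var 1) \<^bold>\<and> Vs (Var 0) \<^bold>\<longrightarrow> ?Q)))"
    using extensional w unfolding extensional_equality_def by (intro forces_provable) auto
  then have "forces w (case_nat x (\<lambda>_. zero)) (All (Vs (Var 1) \<^bold>\<and> Vs (Var 0) \<^bold>\<longrightarrow> ?Q))"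
    unfolding forces_All[of w "\<lambda>_. zero"] using future_refl[OF w] D by blast
  moreover have "forces w ?\<sigma> (Vs (Var 1) \<^bold>\<and> Vs (Var 0))" using V by simp
  ultimately have "forces w ?\<sigma> ?Q"
    unfolding forces_All_Imp using future_refl[OF w] D by blast
  with w have "forces w ?\<sigma> (rel E (Var 1) (Var 0)) \<longleftrightarrow> forces w ?\<sigma> ?P" by (rule forces_Iff)
  then show ?thesis by (simp add: eval_nat_numeral)
qed

text \<open>No induction is involved: exchanging \<open>x\<close> and \<open>y\<close> merely
  exchanges the two clauses of \<open>EE_iff\<close>.\<close>

lemma EE_sym: "EE w x y \<Longrightarrow> node w \<Longrightarrow> x \<in> D w \<Longrightarrow> y \<in> D w \<Longrightarrow> V w x \<Longrightarrow> V w y \<Longrightarrow> EE w y x"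
  using EE_iff[of w x y] EE_iff[of w y x] by blast

lemma EE_refl: "EE w x x" if "node w" "x \<in> D w" "V w x"
proof -
  have "forces w (case_nat x (\<lambda>_. zero)) (rel E (Var 0) (Var 0))"
  proof (rule V_induct)
    fix v x
    assume v: "node v" "x \<in> D v" "V v x"
      and IH: "\<And>u a. u \<in> future v \<Longrightarrow> node u \<Longrightarrow> a \<in> D u \<Longrightarrow> EL u a x \<Longrightarrow>
        V u a \<and> forces u (case_nat a (\<lambda>_. zero)) (rel E (Var 0) (Var 0))"
    then have "EE u a a" if "u \<in> future v" "a \<in> D u" "EL u a x" for u a
      using that future_node by auto
    then have "EE v x x" using EE_iff[OF v(1,2,2,3,3)] by blast
    then show "forces v (case_nat x (\<lambda>_. zero)) (rel E (Var 0) (Var 0))" by simp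
  qed (use that in auto)
  then show ?thesis by simp
qed

text \<open>Induction on \<open>x\<close> with \<open>y\<close> and \<open>z\<close> quantified. In
  the clause that starts from \<open>z\<close> the chain runs from \<open>c\<close> over
  \<open>b\<close> to \<open>a\<close>; symmetry reverses it, because the induction hypothesis is
  available only at the element \<open>a\<close> of \<open>x\<close>.\<close>

lemma EE_trans:
  assumes w: "node w" and D: "x \<in> D w" "y \<in> D w" "z \<in> D w" and V: "V w x" "V w y" "V w z"
    and EE: "EE w x y" "EE w y z"
  shows "EE w x z"
proof -
  let ?\<chi> = "Vs (Var 1) \<^bold>\<and> Vs (Var 0) \<^bold>\<and> rel E (Var 2) (Var 1) \<^bold>\<and> rel E (Var 1) (Var 0) \<^bold>\<longrightarrow> rel E (Var 2) (Var 0)"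
  have "forces w (case_nat x (\<lambda>_. zero)) (All (All ?\<chi>))"
  proof (rule V_induct)
    fix v x
    assume v: "node v" "x \<in> D v" "V v x"
      and IH: "\<And>u a. u \<in> future v \<Longrightarrow> node u \<Longrightarrow> a \<in> D u \<Longrightarrow> EL u a x \<Longrightarrow>
        V u a \<and> forces u (case_nat a (\<lambda>_. zero)) (All (All ?\<chi>))"
    have IH': "EE u a c" if "u \<in> future v" "a \<in> D u" "b \<in> D u" "c \<in> D u" "EL u a x" "V u b" "V u c" "EE u a b" "EE u b c"
      for u a b c
    proof -
      have u: "node u" using that future_node by blast
      have "forces u (case_nat a (\<lambda>_. zero)) (All (All ?\<chi>))" using IH that u by blast
      then have "forces u (case_nat b (case_nat a (\<lambda>_. zero))) (All ?\<chi>)"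
        unfolding forces_All[of u "case_nat a (\<lambda>_. zero)"] using future_refl[OF u] that by blast
      then have "forces u (case_nat c (case_nat b (case_nat a (\<lambda>_. zero)))) ?\<chi>"
        unfolding forces_All using future_refl[OF u] that by blast
      then show ?thesis using that future_refl[OF u] by (simp add: eval_nat_numeral)
    qed
    have trans: "EE u x z" if u: "u \<in> future v" and yz: "y \<in> D u" "z \<in> D u" "V u y" "V u z" and xy: "EE u x y" and "EE u y z" for u y z
    proof -
      have "node u" "x \<in> D u" "V u x" using u v future_node D_future atom_future by auto
      note xz = EE_iff[OF this(1,2) yz(2) this(3) yz(4)] and yz' = EE_iff[OF this(1) yz]
        and xy' = EE_iff[OF this(1,2) yz(1) this(3) yz(3)]
      have el: "node t" "V t a \<and> V t b \<and> V t c" "t \<in> future v"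
        if "t \<in> future u" "a \<in> D t" "EL t a x" "b \<in> D t" "EL t b y" "c \<in> D t" "EL t c z" for t a b c
      proof -
        show t: "node t" "t \<in> future v" using that u future_node future_trans by blast+
        have "x \<in> D t" "y \<in> D t" "z \<in> D t" "V t x" "V t y" "V t z"
          using that(1) \<open>x \<in> D u\<close> \<open>V u x\<close> yz D_future atom_future by auto
        then show "V t a \<and> V t b \<and> V t c" using EL_V[OF t(1)] that by blast
      qed
      show ?thesis unfolding xz
      proof (intro conjI ballI impI)
        fix t a assume t: "t \<in> future u" and a: "a \<in> D t" "EL t a x"
        obtain b where b: "b \<in> D t" "EL t b y" "EE t a b" using xy t a unfolding xy' by blast
        obtain c where c: "c \<in> D t" "EL t c z" "EE t b c" using \<open>EE u y z\<close> t b unfolding yz' by blast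
        have "EE t a c" using IH' el[OF t a b(1,2) c(1,2)] a b c by blast
        then show "\<exists>c\<in>D t. EL t c z \<and> EE t a c" using c by blast
      next
        fix t c assume t: "t \<in> future u" and c: "c \<in> D t" "EL t c z"
        obtain b where b: "b \<in> D t" "EL t b y" "EE t c b" using \<open>EE u y z\<close> t c unfolding yz' by blast
        obtain a where a: "a \<in> D t" "EL t a x" "EE t b a" using xy t b unfolding xy' by blast
        note el = el[OF t a(1,2) b(1,2) c]
        have "EE t a b" "EE t b c" using EE_sym el a b c by blast+
        then have "EE t a c" using IH' el a b c by blast
        then show "\<exists>a\<in>D t. EL t a x \<and> EE t c a" using EE_sym el a c by blast
      qed
    qed
    have "forces t (case_nat z (case_nat y (case_nat x (\<lambda>_. zero)))) ?\<chi>"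
      if "u \<in> future v" "y \<in> D u" "t \<in> future u" "z \<in> D t" for u t y z
      unfolding forces.simps(8)
    proof (intro ballI impI)
      fix s assume s: "s \<in> future t" and *: "forces s (case_nat z (case_nat y (case_nat x (\<lambda>_. zero))))
        (Vs (Var 1) \<^bold>\<and> Vs (Var 0) \<^bold>\<and> rel E (Var 2) (Var 1) \<^bold>\<and> rel E (Var 1) (Var 0))"
      have "s \<in> future v" "y \<in> D s" "z \<in> D s"
        using that s by (meson future_trans D_future)+
      then have "EE s x z" by (rule trans) (use * in \<open>simp_all add: eval_nat_numeral\<close>)
      then show "forces s (case_nat z (case_nat y (case_nat x (\<lambda>_. zero)))) (rel E (Var 2) (Var 0))"
        by (simp add: eval_nat_numeral)
    qed
    then show "forces v (case_nat x (\<lambda>_. zero)) (All (All ?\<chi>))"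
      unfolding forces_All by blast
  qed (use w D V in auto)
  then have "forces w (case_nat y (case_nat x (\<lambda>_. zero))) (All ?\<chi>)"
    unfolding forces_All[of w "case_nat x (\<lambda>_. zero)"] using future_refl[OF w] D by blast
  then have "forces w (case_nat z (case_nat y (case_nat x (\<lambda>_. zero)))) ?\<chi>"
    unfolding forces_All using future_refl[OF w] D by blast
  then show ?thesis using V EE future_refl[OF w] by (simp add: eval_nat_numeral)
qed

section \<open>Forcing of the set-theoretic formulas that occur in Choice\<close>

definition Mem :: "world \<Rightarrow> tm \<Rightarrow> tm \<Rightarrow> bool" where
  "Mem w x y \<longleftrightarrow> (\<exists>z\<in>D w. EL w z y \<and> EE w x z)"

definition Upair :: "world \<Rightarrow> tm \<Rightarrow> tm \<Rightarrow> tm \<Rightarrow> bool" where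
  "Upair w q y z \<longleftrightarrow> (\<forall>v\<in>future w. \<forall>x\<in>D v. V v x \<longrightarrow> (Mem v x q \<longleftrightarrow> EE v x y \<or> EE v x z))"

definition Opair :: "world \<Rightarrow> tm \<Rightarrow> tm \<Rightarrow> tm \<Rightarrow> bool" where
  "Opair w p y z \<longleftrightarrow> (\<forall>v\<in>future w. \<forall>q\<in>D v. V v q \<longrightarrow> (Mem v q p \<longleftrightarrow> Upair v q y y \<or> Upair v q y z))"

definition Opair_mem :: "world \<Rightarrow> tm \<Rightarrow> tm \<Rightarrow> tm \<Rightarrow> bool" where
  "Opair_mem w y z f \<longleftrightarrow> (\<exists>p\<in>D w. EL w p f \<and> Opair w p y z)"

text \<open>As in \<open>forces_All_Imp\<close>, the quantifiers over later nodes merge; the guard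
  \<open>Vs\<close> persists along them.\<close>

lemma forces_All_V_Iff:
  "forces w \<sigma> (All (Vs (Var 0) \<^bold>\<longrightarrow> (\<phi> \<^bold>\<longleftrightarrow> \<psi>))) \<longleftrightarrow>
    (\<forall>v\<in>future w. \<forall>x\<in>D v. V v x \<longrightarrow> (forces v (case_nat x \<sigma>) \<phi> \<longleftrightarrow> forces v (case_nat x \<sigma>) \<psi>))"
  (is "?L \<longleftrightarrow> ?R")
proof
  assume L: ?L
  show ?R
  proof (intro ballI impI)
    fix v x assume v: "v \<in> future w" and "x \<in> D v" "V v x"
    then have "forces v (case_nat x \<sigma>) (\<phi> \<^bold>\<longleftrightarrow> \<psi>)" using L unfolding forces_All_Imp by simp
    with future_node[OF v] show "forces v (case_nat x \<sigma>) \<phi> \<longleftrightarrow> forces v (case_nat x \<sigma>) \<psi>"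
      by (rule forces_Iff)
  qed
next
  assume R: ?R
  show ?L
    unfolding forces_All_Imp
  proof (intro ballI impI)
    fix v x assume v: "v \<in> future w" and x: "x \<in> D v" "forces v (case_nat x \<sigma>) (Vs (Var 0))"
    have "forces u (case_nat x \<sigma>) \<phi> \<longleftrightarrow> forces u (case_nat x \<sigma>) \<psi>" if u: "u \<in> future v" for u
      using R future_trans[OF v u] D_future[OF u x(1)] atom_future(1)[OF u] x(2) by simp
    then show "forces v (case_nat x \<sigma>) (\<phi> \<^bold>\<longleftrightarrow> \<psi>)" by simp
  qed
qed

lemma forces_Mem [simp]: "forces w \<sigma> (interp E (SMem i j)) \<longleftrightarrow> Mem w (\<sigma> i) (\<sigma> j)"
  by (simp add: Mem_def)

lemma forces_upair [simp]: "forces w \<sigma> (interp E (is_upair i j k)) \<longleftrightarrow> Upair w (\<sigma> i) (\<sigma> j) (\<sigma> k)"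
  by (simp add: is_upair_def forces_All_V_Iff Upair_def del: forces_All_Imp interp.simps(3) add: forces_Mem)

lemma forces_opair [simp]: "forces w \<sigma> (interp E (is_opair i j k)) \<longleftrightarrow> Opair w (\<sigma> i) (\<sigma> j) (\<sigma> k)"
  by (simp add: is_opair_def forces_All_V_Iff Opair_def del: forces_All_Imp interp.simps(3) add: forces_Mem)

lemma forces_opair_mem [simp]:
  "forces w \<sigma> (interp E (opair_mem i j k)) \<longleftrightarrow> Opair_mem w (\<sigma> i) (\<sigma> j) (\<sigma> k)"
  by (simp add: opair_mem_def Opair_mem_def)

text \<open>The consequences that Diaconescu's argument uses. Uniqueness is kept at all later nodes,
  since it is applied where the condition has become true; the values of \<open>f\<close> are taken
  at \<open>w\<close>.\<close>

lemma choice_function: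
  assumes w: "node w" and choice: "forces w \<sigma> (interp E Choice)" and x: "x \<in> D w" "V w x"
    and inhabited: "\<forall>v\<in>future w. \<forall>y\<in>D v. EL v y x \<longrightarrow> (\<exists>z\<in>D v. V v z \<and> Mem v z y)"
  shows "\<exists>f\<in>D w.
    (\<forall>v\<in>future w. \<forall>y\<in>D v. \<forall>z\<in>D v. \<forall>z'\<in>D v. V v y \<longrightarrow> V v z \<longrightarrow> V v z' \<longrightarrow>
      Opair_mem v y z f \<longrightarrow> Opair_mem v y z' f \<longrightarrow> EE v z z') \<and>
    (\<forall>y\<in>D w. V w y \<longrightarrow> Mem w y x \<longrightarrow> (\<exists>z\<in>D w. V w z \<and> Opair_mem w y z f)) \<and>
    (\<forall>y\<in>D w. EL w y x \<longrightarrow> (\<forall>z\<in>D w. V w z \<longrightarrow> Opair_mem w y z f \<longrightarrow> Mem w z y))"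
proof -
  note refl = future_refl[OF w]
  let ?inh = "interp E (SBAll 0 (SEx (SMem 0 1)))"
  have "forces w (case_nat x \<sigma>) (?inh \<^bold>\<longrightarrow> interp E (SEx (is_choice_function 0 1)))"
    using choice x refl unfolding Choice_def interp.simps(6,7) forces_All_Imp by simp
  moreover have "forces w (case_nat x \<sigma>) ?inh"
    using inhabited by (simp add: Mem_def)
  ultimately have "forces w (case_nat x \<sigma>) (interp E (SEx (is_choice_function 0 1)))"
    using refl unfolding forces.simps(8) by blast
  then obtain f where f: "f \<in> D w" and cf: "forces w (case_nat f (case_nat x \<sigma>)) (interp E (is_choice_function 0 1))"
    by auto
  let ?\<sigma> = "case_nat f (case_nat x \<sigma>)"
  have parts: "forces w ?\<sigma> (interp E (is_function 0))" "forces w ?\<sigma> (interp E (has_domain 0 1))"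
    "forces w ?\<sigma> (interp E (SBAll 1 (SAll (SImp (opair_mem 1 0 2) (SMem 0 1)))))"
    using cf by (simp_all add: is_choice_function_def eval_nat_numeral del: interp.simps(6-10))
  show ?thesis
  proof (rule bexI[OF _ f], intro conjI ballI impI)
    fix v y z z'
    assume v: "v \<in> future w" and *: "y \<in> D v" "z \<in> D v" "z' \<in> D v" "V v y" "V v z" "V v z'"
      "Opair_mem v y z f" "Opair_mem v y z' f"
    \<comment> \<open>All three nested quantifiers are instantiated at \<open>v\<close>
      itself.\<close>
    have "v \<in> future v" using v future_node future_refl by blast
    moreover have "forces w ?\<sigma> (interp E (SAll (SAll (SAll (SImp (SAnd (opair_mem 2 1 3) (opair_mem 2 0 3)) (SEq 1 0))))))"
      using parts(1) by (simp add: is_function_def eval_nat_numeral del: interp.simps(6-10))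
    ultimately show "EE v z z'" using v * by (simp add: eval_nat_numeral)
  next
    fix y assume y: "y \<in> D w" "V w y" "Mem w y x"
    have "forces w ?\<sigma> (All (Vs (Var 0) \<^bold>\<longrightarrow> (interp E (SMem 0 2) \<^bold>\<longleftrightarrow> interp E (SEx (opair_mem 1 0 2)))))"
      using parts(2) by (simp add: has_domain_def eval_nat_numeral del: forces_All_Imp)
    then show "\<exists>z\<in>D w. V w z \<and> Opair_mem w y z f"
      using refl y unfolding forces_All_V_Iff forces_Mem by (auto simp: eval_nat_numeral)
  next
    fix y z assume "y \<in> D w" "EL w y x" "z \<in> D w" "V w z" "Opair_mem w y z f"
    then show "Mem w z y" using parts(3) refl by (simp add: eval_nat_numeral Mem_def)
  qed
qed

text \<open>Pairs are described by membership up to \<open>EE\<close>, so extensionally equal first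
  components have the same pairs. This is what forces a choice function to respect extensional
  equality.\<close>

lemma Opair_cong:
  assumes w: "node w" and D: "y \<in> D w" "y' \<in> D w" and V: "V w y" "V w y'" and EE: "EE w y y'"
  shows "Opair w p y z \<longleftrightarrow> Opair w p y' z"
proof -
  have EE_iff: "EE v x y \<longleftrightarrow> EE v x y'" if v: "v \<in> future w" and x: "x \<in> D v" "V v x" for v x
  proof -
    have v': "node v" "y \<in> D v" "y' \<in> D v" "V v y" "V v y'" "EE v y y'"
      using v future_node D_future D V atom_future EE_future[OF EE w D v] by auto
    then have "EE v y' y" using EE_sym by blast
    then show ?thesis using EE_trans[OF v'(1) x(1)] v' x by blast
  qed
  have "Upair v q y y \<longleftrightarrow> Upair v q y' y'" "Upair v q y z \<longleftrightarrow> Upair v q y' z" if v: "v \<in> future w" for v q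
    unfolding Upair_def using EE_iff[OF future_trans[OF v]] by (simp_all cong: ball_cong imp_cong)
  then show ?thesis unfolding Opair_def by (simp cong: ball_cong)
qed

text \<open>Diaconescu's argument for the sets \<open>A = {0} \<union> {1 | c}\<close> and \<open>B = {1} \<union> {0 | c}\<close>, which are
  equal if \<open>c\<close> holds.\<close>

lemma choice_decides_condition:
  assumes w: "node w" and choice: "forces w \<sigma> (interp E Choice)" and c: "c \<in> D w" "M w c"
  shows "T w c \<or> (\<forall>v\<in>future w. \<not> T v c)"
proof -
  have vM: "verum \<in> D v" "M v verum" "T v verum" if "v \<in> future w" for v
    using verum future_node[OF that] by auto
  note refl = future_refl[OF w]
  obtain b where b: "b \<in> D w" "M w b" "\<And>v. v \<in> future w \<Longrightarrow> \<not> T v b"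
    using falsum_exists[OF w] by blast
  \<comment> \<open>The empty set: both conditions are the false \<open>b\<close>, so the entry
    \<open>zero\<close> is never an element.\<close>
  obtain z0 where z0: "z0 \<in> D w" "V w z0"
    "\<And>v z. v \<in> future w \<Longrightarrow> z \<in> D v \<Longrightarrow> EL v z z0 \<longleftrightarrow> (T v b \<and> cls v z = cls v zero) \<or> (T v b \<and> cls v z = cls v zero)"
    by (rule two_element_set[OF w _ b(1) _ b(1) b(2) b(2), of zero zero]) (use b(3) in auto)
  \<comment> \<open>The numeral 1 as the singleton of \<open>z0\<close>.\<close>
  obtain z1 where z1: "z1 \<in> D w" "V w z1"
    "\<And>v z. v \<in> future w \<Longrightarrow> z \<in> D v \<Longrightarrow> EL v z z1 \<longleftrightarrow> (T v verum \<and> cls v z = cls v z0) \<or> (T v b \<and> cls v z = cls v z0)"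
    by (rule two_element_set[OF w z0(1) vM(1)[OF refl] z0(1) b(1) vM(2)[OF refl] b(2)])
      (use z0(2) atom_future in auto)
  have Vv: "V v z0" "V v z1" if "v \<in> future w" for v using z0 z1 atom_future[OF that] by auto
  obtain A where A: "A \<in> D w" "V w A"
    "\<And>v z. v \<in> future w \<Longrightarrow> z \<in> D v \<Longrightarrow> EL v z A \<longleftrightarrow> (T v verum \<and> cls v z = cls v z0) \<or> (T v c \<and> cls v z = cls v z1)"
    by (rule two_element_set[OF w z0(1) vM(1)[OF refl] z1(1) c(1) vM(2)[OF refl] c(2)]) (use Vv in auto)
  obtain B where B: "B \<in> D w" "V w B"
    "\<And>v z. v \<in> future w \<Longrightarrow> z \<in> D v \<Longrightarrow> EL v z B \<longleftrightarrow> (T v verum \<and> cls v z = cls v z1) \<or> (T v c \<and> cls v z = cls v z0)"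
    by (rule two_element_set[OF w z1(1) vM(1)[OF refl] z0(1) c(1) vM(2)[OF refl] c(2)]) (use Vv in auto)
  have VAB: "V v A" "V v B" if "v \<in> future w" for v using A B atom_future[OF that] by auto
  obtain X where X: "X \<in> D w" "V w X"
    "\<And>v z. v \<in> future w \<Longrightarrow> z \<in> D v \<Longrightarrow> EL v z X \<longleftrightarrow> (T v verum \<and> cls v z = cls v A) \<or> (T v verum \<and> cls v z = cls v B)"
    by (rule two_element_set[OF w A(1) vM(1)[OF refl] B(1) vM(1)[OF refl] vM(2)[OF refl] vM(2)[OF refl]])
      (use VAB in auto)
  have Dv: "node v" "z0 \<in> D v" "z1 \<in> D v" "A \<in> D v" "B \<in> D v" if "v \<in> future w" for v
    using D_future[OF that] future_node[OF that] z0 z1 A B by auto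
  have inhabited: "\<forall>v\<in>future w. \<forall>y\<in>D v. EL v y X \<longrightarrow> (\<exists>z\<in>D v. V v z \<and> Mem v z y)"
  proof (intro ballI impI)
    fix v y assume v: "v \<in> future w" "y \<in> D v" "EL v y X"
    note Dv = Dv[OF v(1)] and vM = vM[OF v(1)] and Vv = Vv[OF v(1)]
    consider "cls v A = cls v y" | "cls v B = cls v y" using X(3) v by auto
    then show "\<exists>z\<in>D v. V v z \<and> Mem v z y"
    proof cases
      case 1
      have "EL v z0 A" using A(3)[OF v(1)] Dv vM by simp
      then have "EL v z0 y" using EL_cong 1 by blast
      then show ?thesis using Dv Vv EE_refl[OF Dv(1)] unfolding Mem_def by blast
    next
      case 2
      have "EL v z1 B" using B(3)[OF v(1)] Dv vM by simp
      then have "EL v z1 y" using EL_cong 2 by blast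
      then show ?thesis using Dv Vv EE_refl[OF Dv(1)] unfolding Mem_def by blast
    qed
  qed
  obtain f where
    f_unique: "\<forall>v\<in>future w. \<forall>y\<in>D v. \<forall>z\<in>D v. \<forall>z'\<in>D v. V v y \<longrightarrow> V v z \<longrightarrow> V v z' \<longrightarrow>
      Opair_mem v y z f \<longrightarrow> Opair_mem v y z' f \<longrightarrow> EE v z z'"
    and f_total: "\<forall>y\<in>D w. V w y \<longrightarrow> Mem w y X \<longrightarrow> (\<exists>z\<in>D w. V w z \<and> Opair_mem w y z f)"
    and f_choice: "\<forall>y\<in>D w. EL w y X \<longrightarrow> (\<forall>z\<in>D w. V w z \<longrightarrow> Opair_mem w y z f \<longrightarrow> Mem w z y)"
    using choice_function[OF w choice X(1,2) inhabited] by (elim bexE conjE)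
  have EL_X: "EL w A X" "EL w B X" using X(3)[OF refl] A(1) B(1) vM[OF refl] by auto
  then have "Mem w A X" "Mem w B X" using A(1,2) B(1,2) EE_refl[OF w] unfolding Mem_def by blast+
  then obtain z z' where z: "z \<in> D w" "V w z" "Opair_mem w A z f" and z': "z' \<in> D w" "V w z'" "Opair_mem w B z' f"
    using f_total A(1,2) B(1,2) by blast
  have "Mem w z A" "Mem w z' B" using f_choice EL_X A(1) B(1) z z' by blast+
  then obtain y y' where y: "y \<in> D w" "EL w y A" "EE w z y" and y': "y' \<in> D w" "EL w y' B" "EE w z' y'"
    unfolding Mem_def by blast
  show ?thesis
  proof (cases "T w c")
    case False
    \<comment> \<open>While \<open>c\<close> is not true at \<open>w\<close>, the only element of
      \<open>A\<close> is \<open>z0\<close> and that of \<open>B\<close> is \<open>z1\<close>. The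
      choice has thus fixed its values before any later node can make \<open>c\<close> true.\<close>
    then have "cls w y = cls w z0" "cls w y' = cls w z1"
      using A(3)[OF refl y(1)] B(3)[OF refl y'(1)] y y' by auto
    then have yo: "EE w y z0" and yi: "EE w y' z1"
      using EE_cong1[OF EE_refl[OF w z0(1,2)] _ w z0(1) y(1) z0(1)] EE_cong1[OF EE_refl[OF w z1(1,2)] _ w z1(1) y'(1) z1(1)]
      by auto
    have Vy: "V w y" "V w y'" using EL_V[OF w] A(1,2) B(1,2) y y' by blast+
    have zo: "EE w z z0" by (rule EE_trans[OF w z(1) y(1) z0(1) z(2) Vy(1) z0(2) y(3) yo])
    have zi: "EE w z' z1" by (rule EE_trans[OF w z'(1) y'(1) z1(1) z'(2) Vy(2) z1(2) y'(3) yi])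
    have "\<not> T v c" if v: "v \<in> future w" for v
    proof
      assume c: "T v c"
      note Dv = Dv[OF v] and Vv = Vv[OF v] and VAB = VAB[OF v]
      have zv: "z \<in> D v" "z' \<in> D v" "V v z" "V v z'" using z z' D_future[OF v] atom_future[OF v] by auto
      have cu: "T u c" "T u verum" "u \<in> future w" "node u" if "u \<in> future v" for u
        using c atom_future(3)[OF that] future_trans[OF v that] vM future_node that by auto
      \<comment> \<open>From \<open>v\<close> on \<open>c\<close> is true, so \<open>A\<close> and
        \<open>B\<close> have literally the same elements, and reflexivity suffices for
        \<open>EE_iff\<close>.\<close>
      have "EL u a A \<longleftrightarrow> EL u a B" if "u \<in> future v" "a \<in> D u" for u a
        using A(3)[OF cu(3)[OF that(1)] that(2)] B(3)[OF cu(3)[OF that(1)] that(2)] cu[OF that(1)] by blast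
      moreover have "EE u a a" if "u \<in> future v" "a \<in> D u" "EL u a A" for u a
      proof -
        have "A \<in> D u" "V u A" using D_future[OF that(1)] Dv atom_future[OF that(1)] VAB by auto
        then have "V u a" using EL_V cu[OF that(1)] that by blast
        then show ?thesis using EE_refl cu[OF that(1)] that by blast
      qed
      ultimately have AB: "EE v A B" unfolding EE_iff[OF Dv(1,4,5) VAB] by blast
      \<comment> \<open>The element \<open>p\<close> of \<open>f\<close> pairs \<open>B\<close> with
        \<open>z'\<close>. Now that \<open>A\<close> and \<open>B\<close> are equal it also pairs
        \<open>A\<close> with \<open>z'\<close>, so \<open>z\<close> and \<open>z'\<close> are both
        values of \<open>f\<close> at \<open>A\<close>.\<close>
      obtain p where p: "p \<in> D w" "EL w p f" "Opair w p B z'" using z'(3) unfolding Opair_mem_def by blast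
      have "Opair v p B z'" using p(3) future_trans[OF v] unfolding Opair_def by blast
      then have "Opair v p A z'" using Opair_cong[OF Dv(1,4,5) VAB AB] by blast
      then have "Opair_mem v A z' f"
        using EL_future[OF p(2) v] D_future[OF v p(1)] unfolding Opair_mem_def by blast
      moreover have "Opair_mem v A z f"
        using z(3) EL_future[OF _ v] D_future[OF v] future_trans[OF v] unfolding Opair_mem_def Opair_def by blast
      ultimately have zz: "EE v z z'" using bspec[OF f_unique v] Dv VAB zv by blast
      have zo: "EE v z z0" "EE v z' z1" using EE_future[OF zo w z(1) z0(1) v] EE_future[OF zi w z'(1) z1(1) v] by auto
      have "EE v z0 z" using EE_sym[OF zo(1) Dv(1)] zv Dv Vv by blast
      then have "EE v z0 z'" using EE_trans[OF Dv(1,2) zv(1,2) Vv(1) zv(3,4)] zz by blast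
      then have "EE v z0 z1" using EE_trans[OF Dv(1,2) zv(2) Dv(3) Vv(1) zv(4) Vv(2)] zo(2) by blast
      \<comment> \<open>Equality of \<open>z0\<close> and \<open>z1\<close> would carry the element
        \<open>z0\<close> of \<open>z1\<close> over to an element of the empty set.\<close>
      moreover have "EL v z0 z1" using z1(3)[OF v Dv(2)] vM(3)[OF v] by simp
      ultimately obtain a where "a \<in> D v" "EL v a z0"
        using future_refl[OF Dv(1)] Dv(2) unfolding EE_iff[OF Dv(1-3) Vv] by blast
      then show False using z0(3)[OF v] b(3)[OF v] by blast
    qed
    then show ?thesis by blast
  qed simp
qed

lemma choice_refuted: "\<not> forces w \<sigma> (interp E Choice)" if w: "node w" and \<sigma>: "\<And>i. \<sigma> i \<in> D w"
proof
  assume choice: "forces w \<sigma> (interp E Choice)"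
  let ?P = "app (Var 1) (Var 1) zero \<^bold>\<longrightarrow> Bot"
  \<comment> \<open>Value \<open>0\<close> claims that \<open>n\<close> applied to \<open>n\<close>
    is not \<open>0\<close>, and value \<open>1\<close> claims the negation of this. A disjunction
    is admissible because ECT restricts only its premise.\<close>
  let ?\<psi> = "((Var 0 \<^bold>= zero) \<^bold>\<and> ?P) \<^bold>\<or> ((Var 0 \<^bold>= suc zero) \<^bold>\<and> (?P \<^bold>\<longrightarrow> Bot))"
  obtain k where k: "k \<in> D w" "\<And>v n. v \<in> future w \<Longrightarrow> n \<in> D v \<Longrightarrow>
      \<exists>m\<in>D v. App v k n m \<and> forces v (case_nat m (case_nat n \<sigma>)) ?\<psi>"
  proof (rule ECT_realizer[OF w \<sigma>, where \<psi> = ?\<psi>])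
    fix v n assume v: "v \<in> future w" "node v" and n: "n \<in> D v"
    obtain c where c: "c \<in> D v" "M v c"
      "\<And>u. u \<in> future v \<Longrightarrow> T u c \<longleftrightarrow> (\<forall>t\<in>future u. \<not> App t n n zero)"
      using negated_application_condition[OF v(2) n] by blast
    \<comment> \<open>ECT asks for a decision at every later node, so Choice is first carried
      there.\<close>
    have "forces v \<sigma> (interp E Choice)" using forces_mono[OF choice v(1) w] \<sigma> by blast
    from choice_decides_condition[OF v(2) this c(1,2)]
    show "\<exists>m\<in>D v. forces v (case_nat m (case_nat n \<sigma>)) ?\<psi>"
    proof
      assume "T v c"
      then show ?thesis using c(3)[OF future_refl[OF v(2)]] by (intro bexI[of _ zero]) auto
    next
      assume "\<forall>u\<in>future v. \<not> T u c"
      \<comment> \<open>That no later node makes \<open>c\<close> true means that none forces the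
        value to differ from \<open>0\<close>; this is the forcing clause of the double
        negation.\<close>
      then show ?thesis using c(3) by (intro bexI[of _ "suc zero"]) auto
    qed
  qed blast
  note refl = future_refl[OF w]
  obtain m where m: "m \<in> D w" "App w k k m" "forces w (case_nat m (case_nat k \<sigma>)) ?\<psi>"
    using k(2)[OF refl k(1)] by blast
  from m(3) consider "cls w m = Z w" "\<forall>v\<in>future w. \<not> App v k k zero"
    | "cls w m = S w (Z w)" "\<forall>v\<in>future w. \<not> (\<forall>u\<in>future v. \<not> App u k k zero)"
    by auto
  then show False
  proof cases
    case 1
    then have "App w k k zero" using App_cong[OF m(2), of k k zero] by simp
    then show False using 1 refl by blast
  next
    case 2
    \<comment> \<open>The double negation yields the value \<open>0\<close> only at some later node,
      but the value \<open>1\<close> obtained at \<open>w\<close> persists to it.\<close>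
    then obtain v where v: "v \<in> future w" "App v k k zero" using refl by blast
    have nv: "node v" "k \<in> D v" "m \<in> D v" using v future_node D_future[OF v(1)] k m by auto
    have "cls v m = cls v zero"
      by (rule App_unique[OF nv(1,2,2,3) _ App_future[OF m(2) v(1)] v(2)]) simp
    moreover have "cls v m = cls v (suc zero)" using cls_future[of w m "suc zero" v] 2(1) v(1) by simp
    ultimately show False using nv(1) by simp
  qed
qed

end

theorem theorem18:
  fixes xi :: prsym and E :: fm
  assumes "\<And>f g f' g'. eval xi [f, g] = eval xi [f', g'] \<Longrightarrow> f = f' \<and> g = g'"
    and "extensional_equality xi E"
  shows "false_in_vsets xi E Choice"
proof -
  interpret vset_equality xi E by unfold_locales (rule assms(2))
  show ?thesis
    unfolding false_in_vsets_def
  proof (rule kripke_completeness)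
    fix w and \<sigma> :: "nat \<Rightarrow> tm" assume w: "node w" and \<sigma>: "\<And>i. \<sigma> i \<in> D w"
    have "\<not> forces v \<sigma> (interp E Choice)" if v: "v \<in> future w" for v
      using choice_refuted[OF future_node[OF v]] D_future[OF v \<sigma>] by blast
    then show "forces w \<sigma> (interp E (SNeg Choice))" by simp
  qed
qed

end
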